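(* Let $X$ be a smooth variety over an algebraically closed field of characteristic $p>0$, and let $\mathfrak{a}_\star$ be a graded sequence of ideals on $X$. Suppose $\lambda=\mathrm{lct}(\mathfrak{a}_\star)<\infty$. For any generic point $x$ of an irreducible component of $\mathbb{V}(\mathcal{J}(X,\mathfrak{a}_\star^\lambda))$ there exists a valuation $v\in \mathrm{Val}_X^*$ with center $x$ computing $\mathrm{lct}(\mathfrak{a}_\star)$, i.e. such that $\lambda=A_X(v)/v(\mathfrak{a}_\star)$.
   Context: A graded sequence of ideals is a sequence $\mathfrak{a}_\star=\{\mathfrak{a}_m\}_{m\ge1}$ of nonzero (quasi-coherent) ideals of $\mathcal{O}_X$ with $\mathfrak{a}_s\mathfrak{a}_t\subseteq\mathfrak{a}_{s+t}$ for all $s,t$. $\mathbb{V}(I)$ is the closed subscheme defined by an ideal $I$. Let $L$ be the function field of $X$. For an open $U\subseteq X$, $\mathrm{Val}_U$ is the set of real-valued valuations $v:L\to\mathbb{R}\cup\{+\infty\}$ centered on $U$ (the center $c_U(v)$ is the point $x\in U$ with $\mathcal{O}_{U,x}$ dominated by the valuation ring of $v$), and $\mathrm{Val}_U^*$ is $\mathrm{Val}_U$ minus the trivial valuation. For an ideal $\mathfrak{a}$, $v(\mathfrak{a})=\min\{v(f):f\in\mathfrak{a}_{c_X(v)}\}$, and $v(\mathfrak{a}_\star)=\lim_m v(\mathfrak{a}_m)/m=\inf_m v(\mathfrak{a}_m)/m$. A $p^{-e}$-linear map on $L$ is an additive $\psi:L\to L$ with $\psi(f^{p^e}g)=f\psi(g)$.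 Let $(\mathcal{C}^X_e)_x$ be the set of such $\psi$ with $\psi(\mathcal{O}_{X,x})\subseteq\mathcal{O}_{X,x}$. For $\psi\neq0$, $e\ge1$, put $E(f,\psi,v)=\frac{v(f)-p^ev(\psi(f))}{p^e-1}$ for $0\ne f\in L$, $A(v;\psi)=\sup_{f\ne0,n\ge1}E(f,\psi^n,v)$ ($\psi^n$ is the $n$-fold composition), and define the log discrepancy $A_X(v)=\sup_{e\ge1}\sup_{0\ne\psi\in(\mathcal{C}^X_e)_{c_X(v)}}A(v;\psi)$. $\mathrm{lct}(\mathfrak{a}_\star)=\inf_{v\in\mathrm{Val}_X^*}A_X(v)/v(\mathfrak{a}_\star)$, where the quotient is interpreted as $+\infty$ if $v(\mathfrak{a}_\star)=0$ or $A_X(v)=+\infty$. $\mathcal{J}(X,\mathfrak{a}_\star^t)$ is the sheaf of ideals whose sections over an affine open $U=\mathrm{Spec}(R)\subseteq X$ are those $f\in R$ such that for every $v\in\mathrm{Val}_U^*$ one has $v(f)+A_X(v)-(t/m)\,v(\mathfrak{a}_m)>0$ for all sufficiently large $m$ (depending on $v$). *)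

theory Defs
  imports
    "HOL-Analysis.Abstract_Topology"
    "HOL-Library.Extended_Real"
    "HOL-Library.Poly_Mapping"
    "HOL-Computational_Algebra.Computational_Algebra"
    "HOL-Algebra.Algebraic_Closure_Type"
    "HOL-Algebra.Ideal_Product"
    "HOL-Algebra.Generated_Rings"
    "Jordan_Normal_Form.Determinant"
begin

section \<open>Integral schemes and their sheaves of ideals\<close>

text \<open>
  All restriction maps between nonempty open subsets of an integral scheme are injective, and so
  are the maps from sections to the function field. We therefore describe an integral scheme by its
  underlying topological space \<open>\<X>\<close>, its function field (a type \<open>'l\<close> of class \<open>field\<close>), and its
  structure sheaf \<open>\<O>\<close>, where \<open>\<O> U\<close> is a subring of \<open>'l\<close> for every nonempty open \<open>U\<close> and restriction
  maps are inclusions. Sheaves of ideals are described in the same way. The value of such a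
  function at the empty set, or at a set that is not open, is never used.
\<close>

abbreviation subring_struct :: "'l::field set \<Rightarrow> 'l ring" where
  "subring_struct R \<equiv> ring_of_type_algebra\<lparr>carrier := R\<rparr>"

text \<open>
  In an irreducible space, a family of compatible sections over nonempty open sets is the same as
  one element of the function field, because any two members of the cover meet.
\<close>

definition function_sheaf :: "'x topology \<Rightarrow> ('x set \<Rightarrow> 'l set) \<Rightarrow> bool" where
  "function_sheaf \<X> F \<longleftrightarrow>
     (\<forall>U V. openin \<X> U \<and> openin \<X> V \<and> U \<noteq> {} \<and> U \<subseteq> V \<longrightarrow> F V \<subseteq> F U) \<and>
     (\<forall>\<U>. \<U> \<noteq> {} \<and> (\<forall>U\<in>\<U>. openin \<X> U \<and> U \<noteq> {}) \<longrightarrow> (\<Inter>U\<in>\<U>. F U) \<subseteq> F (\<Union>\<U>))"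

definition stalk :: "'x topology \<Rightarrow> ('x set \<Rightarrow> 'l set) \<Rightarrow> 'x \<Rightarrow> 'l set" where
  "stalk \<X> F x = (\<Union>U\<in>{U. openin \<X> U \<and> x \<in> U}. F U)"

definition stalk_nonunits :: "'x topology \<Rightarrow> ('x set \<Rightarrow> 'l::field set) \<Rightarrow> 'x \<Rightarrow> 'l set" where
  "stalk_nonunits \<X> \<O> x = {f \<in> stalk \<X> \<O> x. f = 0 \<or> inverse f \<notin> stalk \<X> \<O> x}"

definition spec_topology :: "'l::field set \<Rightarrow> 'l set topology" where
  "spec_topology R =
     topology_generated_by ((\<lambda>f. {P. primeideal P (subring_struct R) \<and> f \<notin> P}) ` R)"

definition point_prime :: "'x topology \<Rightarrow> ('x set \<Rightarrow> 'l::field set) \<Rightarrow> 'x set \<Rightarrow> 'x \<Rightarrow> 'l set" where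
  "point_prime \<X> \<O> U x = \<O> U \<inter> stalk_nonunits \<X> \<O> x"

definition frac_at :: "'x topology \<Rightarrow> ('x set \<Rightarrow> 'l::field set) \<Rightarrow> 'x set \<Rightarrow> 'l set \<Rightarrow> 'x \<Rightarrow> 'l set" where
  "frac_at \<X> \<O> U M x = {a / b | a b. a \<in> M \<and> b \<in> \<O> U \<and> b \<notin> point_prime \<X> \<O> U x}"

text \<open>
  \<open>U\<close> is affine if the canonical map from \<open>U\<close> to the spectrum of \<open>\<O> U\<close> is an isomorphism of locally
  ringed spaces; as sections glue, it suffices to compare the stalks.
\<close>

definition affine_open :: "'x topology \<Rightarrow> ('x set \<Rightarrow> 'l::field set) \<Rightarrow> 'x set \<Rightarrow> bool" where
  "affine_open \<X> \<O> U \<longleftrightarrow> openin \<X> U \<and> U \<noteq> {} \<and>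
     homeomorphic_map (subtopology \<X> U) (spec_topology (\<O> U)) (point_prime \<X> \<O> U) \<and>
     (\<forall>x\<in>U. stalk \<X> \<O> x = frac_at \<X> \<O> U (\<O> U) x)"

definition irreducible_in :: "'x topology \<Rightarrow> 'x set \<Rightarrow> bool" where
  "irreducible_in \<X> C \<longleftrightarrow> C \<subseteq> topspace \<X> \<and> C \<noteq> {} \<and>
     (\<forall>A B. closedin \<X> A \<and> closedin \<X> B \<and> C \<subseteq> A \<union> B \<longrightarrow> C \<subseteq> A \<or> C \<subseteq> B)"

definition irreducible_component_of :: "'x topology \<Rightarrow> 'x set \<Rightarrow> 'x set \<Rightarrow> bool" where
  "irreducible_component_of \<X> Z C \<longleftrightarrow> irreducible_in \<X> C \<and> C \<subseteq> Z \<and>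
     (\<forall>D. irreducible_in \<X> D \<and> C \<subseteq> D \<and> D \<subseteq> Z \<longrightarrow> D = C)"

definition generic_point_of :: "'x topology \<Rightarrow> 'x set \<Rightarrow> 'x \<Rightarrow> bool" where
  "generic_point_of \<X> C x \<longleftrightarrow> x \<in> C \<and> \<X> closure_of {x} = C"

locale integral_scheme =
  fixes \<X> :: "'x topology" and \<O> :: "'x set \<Rightarrow> 'l::field set"
  assumes irreducible: "irreducible_in \<X> (topspace \<X>)"
    and sections_subring: "\<lbrakk>openin \<X> U; U \<noteq> {}\<rbrakk> \<Longrightarrow> subring (\<O> U) (ring_of_type_algebra :: 'l ring)"
    and sheaf: "function_sheaf \<X> \<O>"
    and function_field: "\<exists>U. openin \<X> U \<and> U \<noteq> {} \<and> f \<in> \<O> U"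
    and affine_cover: "x \<in> topspace \<X> \<Longrightarrow> \<exists>U. affine_open \<X> \<O> U \<and> x \<in> U"

locale qcoh_ideal = integral_scheme \<X> \<O>
  for \<X> :: "'x topology" and \<O> :: "'x set \<Rightarrow> 'l::field set" +
  fixes I :: "'x set \<Rightarrow> 'l set"
  assumes ideal_sections: "\<lbrakk>openin \<X> U; U \<noteq> {}\<rbrakk> \<Longrightarrow> ideal (I U) (subring_struct (\<O> U))"
    and ideal_sheaf: "function_sheaf \<X> I"
    and quasi_coherent: "x \<in> topspace \<X> \<Longrightarrow>
      \<exists>U. affine_open \<X> \<O> U \<and> x \<in> U \<and> (\<forall>y\<in>U. stalk \<X> I y = frac_at \<X> \<O> U (I U) y)"

definition nonzero_ideal :: "'x topology \<Rightarrow> ('x set \<Rightarrow> 'l::field set) \<Rightarrow> bool" where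
  "nonzero_ideal \<X> I \<longleftrightarrow> (\<exists>U. openin \<X> U \<and> U \<noteq> {} \<and> I U \<noteq> {0})"

definition graded_ideal_sequence ::
  "'x topology \<Rightarrow> ('x set \<Rightarrow> 'l::field set) \<Rightarrow> (nat \<Rightarrow> 'x set \<Rightarrow> 'l set) \<Rightarrow> bool" where
  "graded_ideal_sequence \<X> \<O> \<aa> \<longleftrightarrow>
     (\<forall>m\<ge>1. qcoh_ideal \<X> \<O> (\<aa> m) \<and> nonzero_ideal \<X> (\<aa> m)) \<and>
     (\<forall>s\<ge>1. \<forall>t\<ge>1. \<forall>U. openin \<X> U \<and> U \<noteq> {} \<longrightarrow>
        ideal_prod (subring_struct (\<O> U)) (\<aa> s U) (\<aa> t U) \<subseteq> \<aa> (s + t) U)"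

text \<open>The underlying closed set of the subscheme defined by \<open>I\<close>, i.e. the support of \<open>\<O>/I\<close>.\<close>

definition ideal_locus :: "'x topology \<Rightarrow> ('x set \<Rightarrow> 'l::field set) \<Rightarrow> ('x set \<Rightarrow> 'l set) \<Rightarrow> 'x set" where
  "ideal_locus \<X> \<O> I = {x \<in> topspace \<X>. stalk \<X> I x \<noteq> stalk \<X> \<O> x}"


section \<open>Smooth varieties\<close>

text \<open>
  Polynomials over \<open>'k\<close> in variables indexed by \<open>nat\<close> are finitely supported functions on monomials,
  and monomials are finitely supported exponent functions.
\<close>

type_synonym 'k mpoly = "(nat \<Rightarrow>\<^sub>0 nat) \<Rightarrow>\<^sub>0 'k"

definition mpolys :: "nat \<Rightarrow> 'k::field mpoly set" where
  "mpolys n = {F. \<forall>m \<in> Poly_Mapping.keys F. Poly_Mapping.keys m \<subseteq> {..<n}}"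

definition mpoly_eval :: "('k::field \<Rightarrow> 'l::field) \<Rightarrow> (nat \<Rightarrow> 'l) \<Rightarrow> 'k mpoly \<Rightarrow> 'l" where
  "mpoly_eval \<iota> a F = (\<Sum>m \<in> Poly_Mapping.keys F. \<iota> (Poly_Mapping.lookup F m) *
     (\<Prod>i \<in> Poly_Mapping.keys m. a i ^ Poly_Mapping.lookup m i))"

text \<open>
  If the variable \<open>j\<close> does not occur in \<open>m\<close>, the coefficient below is zero, so that truncated
  subtraction of exponents does no harm.
\<close>

definition mpoly_deriv :: "nat \<Rightarrow> 'k::field mpoly \<Rightarrow> 'k mpoly" where
  "mpoly_deriv j F = (\<Sum>m \<in> Poly_Mapping.keys F.
     Poly_Mapping.single (m - Poly_Mapping.single j 1)
       (of_nat (Poly_Mapping.lookup m j) * Poly_Mapping.lookup F m))"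

definition jacobian :: "('k::field \<Rightarrow> 'l::field) \<Rightarrow> (nat \<Rightarrow> 'l) \<Rightarrow> (nat \<Rightarrow> 'k mpoly) \<Rightarrow> nat \<Rightarrow> 'l mat" where
  "jacobian \<iota> a f c = Matrix.mat c c (\<lambda>(i, j). mpoly_eval \<iota> a (mpoly_deriv j (f i)))"

text \<open>
  \<open>R\<close> is a standard smooth algebra: the quotient of the polynomial ring in \<open>n\<close> variables by an ideal
  generated by \<open>f 0, \<dots>, f (c - 1)\<close>, where \<open>c \<le> n\<close> and the Jacobian determinant of
  these polynomials with respect to the first \<open>c\<close> variables is a unit of \<open>R\<close>. The elements \<open>a i\<close> are
  the classes of the variables.
\<close>

definition standard_smooth :: "('k::field \<Rightarrow> 'l::field) \<Rightarrow> 'l set \<Rightarrow> bool" where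
  "standard_smooth \<iota> R \<longleftrightarrow> (\<exists>n c a f. c \<le> n \<and> (\<forall>i<c. f i \<in> mpolys n) \<and>
     R = mpoly_eval \<iota> a ` mpolys n \<and>
     (\<forall>F\<in>mpolys n. mpoly_eval \<iota> a F = 0 \<longleftrightarrow>
        (\<exists>g. (\<forall>i<c. g i \<in> mpolys n) \<and> F = (\<Sum>i<c. g i * f i))) \<and>
     det (jacobian \<iota> a f c) \<noteq> 0 \<and> inverse (det (jacobian \<iota> a f c)) \<in> R)"

text \<open>
  Separatedness says that the diagonal is a closed immersion. Over the product of two affine opens
  \<open>U\<close> and \<open>V\<close> this means that \<open>U \<inter> V\<close> is affine and that the tensor product of \<open>\<O> U\<close> and \<open>\<O> V\<close>
  surjects onto \<open>\<O> (U \<inter> V)\<close>.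
\<close>

locale variety = integral_scheme \<X> \<O>
  for \<X> :: "'x topology" and \<O> :: "'x set \<Rightarrow> 'l::field set" +
  fixes \<iota> :: "'k::alg_closed_field \<Rightarrow> 'l"
  assumes base_hom: "\<iota> 1 = 1" "\<iota> (c + d) = \<iota> c + \<iota> d" "\<iota> (c * d) = \<iota> c * \<iota> d"
    and base_sections: "range \<iota> \<subseteq> \<O> (topspace \<X>)"
    and finite_type: "\<exists>\<U>. finite \<U> \<and> \<Union>\<U> = topspace \<X> \<and>
      (\<forall>U\<in>\<U>. affine_open \<X> \<O> U \<and>
        (\<exists>S. finite S \<and> \<O> U = generate_ring ring_of_type_algebra (range \<iota> \<union> S)))"
    and separated: "\<lbrakk>affine_open \<X> \<O> U; affine_open \<X> \<O> V\<rbrakk> \<Longrightarrow>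
      affine_open \<X> \<O> (U \<inter> V) \<and> \<O> (U \<inter> V) = generate_ring ring_of_type_algebra (\<O> U \<union> \<O> V)"

locale smooth_variety = variety \<X> \<O> \<iota>
  for \<X> :: "'x topology" and \<O> :: "'x set \<Rightarrow> 'l::field set" and \<iota> :: "'k::alg_closed_field \<Rightarrow> 'l" +
  assumes smooth: "x \<in> topspace \<X> \<Longrightarrow> \<exists>U. affine_open \<X> \<O> U \<and> x \<in> U \<and> standard_smooth \<iota> (\<O> U)"


section \<open>Valuations\<close>

definition real_valuation :: "('l::field \<Rightarrow> ereal) \<Rightarrow> bool" where
  "real_valuation v \<longleftrightarrow>
     (\<forall>f. v f \<noteq> -\<infinity>) \<and> (\<forall>f. v f = \<infinity> \<longleftrightarrow> f = 0) \<and>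
     (\<forall>f g. v (f * g) = v f + v g) \<and> (\<forall>f g. min (v f) (v g) \<le> v (f + g))"

definition trivial_valuation :: "'l::field \<Rightarrow> ereal" where
  "trivial_valuation f = (if f = 0 then \<infinity> else 0)"

text \<open>The valuation ring of \<open>v\<close> dominates the local ring at \<open>x\<close>.\<close>

definition is_center :: "'x topology \<Rightarrow> ('x set \<Rightarrow> 'l::field set) \<Rightarrow> ('l \<Rightarrow> ereal) \<Rightarrow> 'x \<Rightarrow> bool" where
  "is_center \<X> \<O> v x \<longleftrightarrow> x \<in> topspace \<X> \<and> stalk \<X> \<O> x \<subseteq> {f. 0 \<le> v f} \<and>
     stalk_nonunits \<X> \<O> x = stalk \<X> \<O> x \<inter> {f. 0 < v f}"

text \<open>The center of a valuation is unique if it exists, because varieties are separated.\<close>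

definition center :: "'x topology \<Rightarrow> ('x set \<Rightarrow> 'l::field set) \<Rightarrow> ('l \<Rightarrow> ereal) \<Rightarrow> 'x" where
  "center \<X> \<O> v = (THE x. is_center \<X> \<O> v x)"

definition Val :: "'x topology \<Rightarrow> ('x set \<Rightarrow> 'l::field set) \<Rightarrow> 'x set \<Rightarrow> ('l \<Rightarrow> ereal) set" where
  "Val \<X> \<O> U = {v. real_valuation v \<and> (\<exists>x\<in>U. is_center \<X> \<O> v x)}"

definition Val_star :: "'x topology \<Rightarrow> ('x set \<Rightarrow> 'l::field set) \<Rightarrow> 'x set \<Rightarrow> ('l \<Rightarrow> ereal) set" where
  "Val_star \<X> \<O> U = Val \<X> \<O> U - {trivial_valuation}"

definition val_ideal ::
  "'x topology \<Rightarrow> ('x set \<Rightarrow> 'l::field set) \<Rightarrow> ('l \<Rightarrow> ereal) \<Rightarrow> ('x set \<Rightarrow> 'l set) \<Rightarrow> ereal" where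
  "val_ideal \<X> \<O> v I = (INF f \<in> stalk \<X> I (center \<X> \<O> v). v f)"

definition val_graded ::
  "'x topology \<Rightarrow> ('x set \<Rightarrow> 'l::field set) \<Rightarrow> ('l \<Rightarrow> ereal) \<Rightarrow> (nat \<Rightarrow> 'x set \<Rightarrow> 'l set) \<Rightarrow> ereal" where
  "val_graded \<X> \<O> v \<aa> = (INF m \<in> {1..}. val_ideal \<X> \<O> v (\<aa> m) / ereal (real m))"


section \<open>Log discrepancies, thresholds and asymptotic multiplier ideals\<close>

definition p_linear :: "nat \<Rightarrow> nat \<Rightarrow> ('l::field \<Rightarrow> 'l) \<Rightarrow> bool" where
  "p_linear p e \<psi> \<longleftrightarrow> (\<forall>f g. \<psi> (f + g) = \<psi> f + \<psi> g) \<and> (\<forall>f g. \<psi> (f ^ (p ^ e) * g) = f * \<psi> g)"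

definition cartier_maps ::
  "'x topology \<Rightarrow> ('x set \<Rightarrow> 'l::field set) \<Rightarrow> nat \<Rightarrow> nat \<Rightarrow> 'x \<Rightarrow> ('l \<Rightarrow> 'l) set" where
  "cartier_maps \<X> \<O> p e x = {\<psi>. p_linear p e \<psi> \<and> \<psi> ` stalk \<X> \<O> x \<subseteq> stalk \<X> \<O> x}"

text \<open>Here \<open>v f\<close> is finite for nonzero \<open>f\<close>, and the value is \<open>-\<infinity>\<close> if \<open>\<psi> f = 0\<close>.\<close>

definition log_disc_E :: "nat \<Rightarrow> nat \<Rightarrow> 'l::field \<Rightarrow> ('l \<Rightarrow> 'l) \<Rightarrow> ('l \<Rightarrow> ereal) \<Rightarrow> ereal" where
  "log_disc_E p e f \<psi> v = (v f - ereal (real p ^ e) * v (\<psi> f)) / ereal (real p ^ e - 1)"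

text \<open>If \<open>\<psi>\<close> is \<open>p\<^sup>-\<^sup>e\<close>-linear, then its \<open>n\<close>-fold composition is \<open>p\<^sup>-\<^sup>n\<^sup>e\<close>-linear.\<close>

definition log_disc_map :: "nat \<Rightarrow> nat \<Rightarrow> ('l::field \<Rightarrow> ereal) \<Rightarrow> ('l \<Rightarrow> 'l) \<Rightarrow> ereal" where
  "log_disc_map p e v \<psi> = (SUP (f, n) \<in> (- {0}) \<times> {1..}. log_disc_E p (n * e) f (\<psi> ^^ n) v)"

definition log_discrepancy ::
  "'x topology \<Rightarrow> ('x set \<Rightarrow> 'l::field set) \<Rightarrow> nat \<Rightarrow> ('l \<Rightarrow> ereal) \<Rightarrow> ereal" where
  "log_discrepancy \<X> \<O> p v =
     (SUP e \<in> {1..}. SUP \<psi> \<in> cartier_maps \<X> \<O> p e (center \<X> \<O> v) - {\<lambda>_. 0}. log_disc_map p e v \<psi>)"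

definition lct_quotient ::
  "'x topology \<Rightarrow> ('x set \<Rightarrow> 'l::field set) \<Rightarrow> nat \<Rightarrow> (nat \<Rightarrow> 'x set \<Rightarrow> 'l set) \<Rightarrow> ('l \<Rightarrow> ereal) \<Rightarrow> ereal" where
  "lct_quotient \<X> \<O> p \<aa> v =
     (if val_graded \<X> \<O> v \<aa> = 0 \<or> log_discrepancy \<X> \<O> p v = \<infinity> then \<infinity>
      else log_discrepancy \<X> \<O> p v / val_graded \<X> \<O> v \<aa>)"

definition lct ::
  "'x topology \<Rightarrow> ('x set \<Rightarrow> 'l::field set) \<Rightarrow> nat \<Rightarrow> (nat \<Rightarrow> 'x set \<Rightarrow> 'l set) \<Rightarrow> ereal" where
  "lct \<X> \<O> p \<aa> = (INF v \<in> Val_star \<X> \<O> (topspace \<X>). lct_quotient \<X> \<O> p \<aa> v)"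

text \<open>
  The condition is stated for arbitrary nonempty open \<open>U\<close>, not only for affine ones. Since the
  valuations centered on \<open>U\<close> are those centered on some member of an affine cover of \<open>U\<close>, this is the
  sheaf with the prescribed sections over affine opens.
\<close>

definition multiplier_ideal ::
  "'x topology \<Rightarrow> ('x set \<Rightarrow> 'l::field set) \<Rightarrow> nat \<Rightarrow> (nat \<Rightarrow> 'x set \<Rightarrow> 'l set) \<Rightarrow> real \<Rightarrow> 'x set \<Rightarrow> 'l set" where
  "multiplier_ideal \<X> \<O> p \<aa> t U = {f \<in> \<O> U. \<forall>v \<in> Val_star \<X> \<O> U. \<forall>\<^sub>F m in sequentially.
     v f + log_discrepancy \<X> \<O> p v - ereal (t / real m) * val_ideal \<X> \<O> v (\<aa> m) > 0}"

end

theory Submission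
  imports Defs "HOL-Analysis.Function_Topology"
begin

text \<open>
  If \<open>x\<close> lies in \<open>\<V>(\<J>)\<close>, every neighbourhood \<open>V\<close> of \<open>x\<close> carries a nontrivial valuation with
  \<open>A(v) \<le> \<lambda> v(\<aa>\<^sub>m) / m\<close> for all \<open>m\<close>. Normalized by \<open>A(v) = 1\<close>, these valuations have a cluster point
  as \<open>V\<close> shrinks to \<open>x\<close>, provided that each \<open>f\<close> has a bound \<open>\<bar>v(f)\<bar> \<le> K\<^sub>f A(v)\<close> that is uniform in \<open>v\<close>.
  The cluster point computes the threshold and its center specializes to \<open>x\<close>; the closure of that
  center lies in \<open>\<V>(\<J>)\<close> and contains the given component, so the center is \<open>x\<close>.

  The uniform bound comes from the Frobenius on a smooth chart \<open>R\<close>. There are finitely many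
  \<open>p\<^sup>-\<^sup>1\<close>-linear maps \<open>\<psi>\<^sub>\<alpha>\<close> and elements \<open>w\<^sub>\<alpha>\<close> with \<open>r = (\<Sum>\<alpha>. \<psi>\<^sub>\<alpha>(r)\<^sup>p w\<^sub>\<alpha>)\<close>, and the \<open>\<psi>\<^sub>\<alpha>\<close> do not increase
  large degrees. Hence the images of a given \<open>g \<noteq> 0\<close> under compositions of the \<open>\<psi>\<^sub>\<alpha>\<close> span a finite-dimensional
  space, on which a valuation attains its minimum \<open>\<mu> \<ge> 0\<close> at such an image. The expansion gives
  \<open>\<mu> \<ge> p \<mu>\<close>, so \<open>\<mu> = 0\<close>, and a composition of bounded length maps \<open>g\<close> to an element of value \<open>0\<close>.
\<close>

section \<open>Polynomials\<close>

text \<open>The log discrepancy is a supremum over Cartier maps on the stalk at the center, and the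
  center may change in the limit. The conditions passed to the limit therefore involve only maps
  that preserve \<open>\<O> U\<close>. They suffice at every point of the chart: sections are
  finitely generated over p^e-th powers, so a Cartier map on a stalk preserves \<open>\<O> U\<close>
  after multiplication by a denominator of value 0. Only the bound A <= 1 survives in the limit.
  Together with v(a) >= 1 / \<open>lam\<close> it makes the quotient at most \<open>lam\<close>, and
  \<open>lam\<close> is the infimum. Failing to lie in the multiplier ideal gives an inequality for
  infinitely many m only; subadditivity of the values v(a_m) extends it to every m. On polynomials,
  the coordinates over p-th powers are explicit and divide exponents by p; their coefficients need
  p-th roots, which exist in an algebraically closed field. Passing to the quotient
  \<open>\<O> U\<close> costs multiplication by a fixed polynomial, whose degree is absorbed by the
  division by p.\<close>

lemma mpoly_sum_single:
  "F = (\<Sum>m\<in>Poly_Mapping.keys F. Poly_Mapping.single m (Poly_Mapping.lookup F m))"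
  for F :: "'k::field mpoly"
  by (rule poly_mapping_eqI)
    (auto simp: lookup_sum lookup_single when_def sum.delta in_keys_iff)

text \<open>Evaluation, derivatives and Frobenius coordinates are additive, so their identities
  reduce to single terms. The coefficient stays in the term because Frobenius coordinates take its
  p-th root instead of pulling it out.\<close>

lemma mpoly_additive_induct [case_names zero single add]:
  assumes "P 0" "\<And>m c. P (Poly_Mapping.single m c)" "\<And>F G. P F \<Longrightarrow> P G \<Longrightarrow> P (F + G)"
  shows "P (F :: 'k::field mpoly)"
proof -
  have "P (\<Sum>m\<in>A. Poly_Mapping.single m (Poly_Mapping.lookup F m))" if "finite A" for A
    using that by induction (auto intro: assms)
  from this[OF finite_keys[of F]] show ?thesis
    using mpoly_sum_single[of F] by simp
qed

text \<open>This makes the freshman's dream applicable to polynomials.\<close>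

lemma CHAR_mpoly: "CHAR('k::field mpoly) = CHAR('k)"
proof (rule CHAR_eqI)
  show "of_nat CHAR('k) = (0 :: 'k mpoly)"
    by (simp flip: single_of_nat)
  show "CHAR('k) dvd x" if "of_nat x = (0 :: 'k mpoly)" for x
  proof -
    have "Poly_Mapping.lookup (Poly_Mapping.single (0::nat \<Rightarrow>\<^sub>0 nat) (of_nat x :: 'k)) 0 = 0"
      using that by (simp only: single_of_nat lookup_zero)
    then show ?thesis by (simp only: lookup_single_eq of_nat_eq_0_iff_char_dvd)
  qed
qed

lemma single_power:
  "Poly_Mapping.single m c ^ k = Poly_Mapping.single (Poly_Mapping.map ((*) k) m) (c ^ k)"
  for m :: "nat \<Rightarrow>\<^sub>0 nat" and c :: "'k::field"
proof (induction k)
  case 0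
  have "Poly_Mapping.map ((*) 0) m = (0 :: nat \<Rightarrow>\<^sub>0 nat)"
    by (rule poly_mapping_eqI) (simp add: map.rep_eq)
  then show ?case by (simp only: power_0 single_one)
next
  case (Suc k)
  have "Poly_Mapping.map ((*) (Suc k)) m = m + Poly_Mapping.map ((*) k) m"
    by (rule poly_mapping_eqI) (auto simp: map.rep_eq lookup_add when_def)
  then show ?case by (simp only: power_Suc Suc mult_single)
qed

lemma keys_add_monomial:
  "Poly_Mapping.keys (m + m') = Poly_Mapping.keys m \<union> Poly_Mapping.keys m'"
  for m m' :: "nat \<Rightarrow>\<^sub>0 nat"
  by (auto simp: in_keys_iff lookup_add)

subsection \<open>Subrings of polynomials and boxes of monomials\<close>

text \<open>Degree here means the largest exponent of a single variable. It is subadditive under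
  products and is divided by p under \<open>frob_coeff\<close>; the bound p - 1 gives the monomial
  basis over p-th powers.\<close>

definition box_monomials :: "nat \<Rightarrow> nat \<Rightarrow> (nat \<Rightarrow>\<^sub>0 nat) set" where
  "box_monomials n s = {m. Poly_Mapping.keys m \<subseteq> {..<n} \<and> (\<forall>i. Poly_Mapping.lookup m i \<le> s)}"

definition box_polys :: "nat \<Rightarrow> nat \<Rightarrow> 'k::field mpoly set" where
  "box_polys n s = {F. Poly_Mapping.keys F \<subseteq> box_monomials n s}"

lemma finite_box_monomials: "finite (box_monomials n s)"
proof (rule finite_imageD)
  have "Poly_Mapping.lookup ` box_monomials n s \<subseteq>
      {f. \<forall>i. (i \<in> {..<n} \<longrightarrow> f i \<in> {..s}) \<and> (i \<notin> {..<n} \<longrightarrow> f i = 0)}"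
    by (auto simp: box_monomials_def in_keys_iff)
  then show "finite (Poly_Mapping.lookup ` box_monomials n s)"
    by (rule finite_subset) (rule finite_set_of_finite_funs; simp)
  show "inj_on Poly_Mapping.lookup (box_monomials n s)"
    by (auto intro!: inj_onI poly_mapping_eqI)
qed

lemma box_polys_0: "0 \<in> box_polys n s"
  by (simp add: box_polys_def)

lemma box_polys_add: "F \<in> box_polys n s \<Longrightarrow> G \<in> box_polys n s \<Longrightarrow> F + G \<in> box_polys n s"
  using keys_add[of F G] by (auto simp: box_polys_def)

lemma box_polys_sum: "(\<And>i. i \<in> A \<Longrightarrow> F i \<in> box_polys n s) \<Longrightarrow> sum F A \<in> box_polys n s"
  by (induction A rule: infinite_finite_induct) (auto intro: box_polys_add box_polys_0)

lemma box_polys_mult: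
  assumes "F \<in> box_polys n s" "G \<in> box_polys n t" shows "F * G \<in> box_polys n (s + t)"
proof -
  have "a + b \<in> box_monomials n (s + t)" if "a \<in> box_monomials n s" "b \<in> box_monomials n t" for a b
    using that by (auto simp: box_monomials_def keys_add_monomial lookup_add intro: add_mono)
  then show ?thesis
    using keys_mult[of F G] assms unfolding box_polys_def by blast
qed

lemma box_polys_mono: "s \<le> t \<Longrightarrow> box_polys n s \<subseteq> box_polys n t"
proof -
  assume "s \<le> t"
  then have "box_monomials n s \<subseteq> box_monomials n t"
    unfolding box_monomials_def using order_trans by blast
  then show ?thesis unfolding box_polys_def by blast
qed

lemma box_polys_subset_mpolys: "box_polys n s \<subseteq> mpolys n"
  by (auto simp: box_polys_def mpolys_def box_monomials_def)

lemma mpolys_in_box: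
  assumes "F \<in> mpolys n" obtains s where "F \<in> box_polys n s"
proof -
  define S where "S = (\<Union>m\<in>Poly_Mapping.keys F. Poly_Mapping.lookup m ` Poly_Mapping.keys m)"
  have fin: "finite S" by (simp add: S_def)
  have "Poly_Mapping.lookup m i \<le> Max (insert 0 S)" if "m \<in> Poly_Mapping.keys F" for m i
  proof (cases "i \<in> Poly_Mapping.keys m")
    case True
    then have "Poly_Mapping.lookup m i \<in> S" using that by (auto simp: S_def)
    then show ?thesis using fin by simp
  qed (simp add: in_keys_iff)
  then have "F \<in> box_polys n (Max (insert 0 S))"
    using assms by (auto simp: box_polys_def box_monomials_def mpolys_def)
  then show thesis by (rule that)
qed

lemma mpolys_single: "Poly_Mapping.keys m \<subseteq> {..<n} \<Longrightarrow> Poly_Mapping.single m c \<in> mpolys n"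
  by (auto simp: mpolys_def)

lemma mpolys_0: "0 \<in> mpolys n"
  by (simp add: mpolys_def)

lemma mpolys_1: "1 \<in> mpolys n"
  using mpolys_single[of 0 n 1] by simp

lemma mpolys_add: "F \<in> mpolys n \<Longrightarrow> G \<in> mpolys n \<Longrightarrow> F + G \<in> mpolys n"
  using keys_add[of F G] by (auto simp: mpolys_def)

lemma mpolys_mult:
  assumes "F \<in> mpolys n" "G \<in> mpolys n" shows "F * G \<in> mpolys n"
proof -
  obtain s t where "F \<in> box_polys n s" "G \<in> box_polys n t"
    using assms mpolys_in_box by metis
  then have "F * G \<in> box_polys n (s + t)" by (rule box_polys_mult)
  then show ?thesis using box_polys_subset_mpolys by blast
qed

lemma mpolys_uminus: "F \<in> mpolys n \<Longrightarrow> - F \<in> mpolys n"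
  by (auto simp: mpolys_def in_keys_iff)

lemma mpolys_sum: "(\<And>i. i \<in> A \<Longrightarrow> F i \<in> mpolys n) \<Longrightarrow> sum F A \<in> mpolys n"
  by (induction A rule: infinite_finite_induct) (auto intro: mpolys_add mpolys_0)

lemma mpolys_prod: "(\<And>i. i \<in> A \<Longrightarrow> F i \<in> mpolys n) \<Longrightarrow> prod F A \<in> mpolys n"
  by (induction A rule: infinite_finite_induct) (auto intro: mpolys_mult mpolys_1)

lemma mpolys_power: "F \<in> mpolys n \<Longrightarrow> F ^ k \<in> mpolys n"
  by (induction k) (auto intro: mpolys_mult mpolys_1)

subsection \<open>Evaluation\<close>

locale base_field_hom =
  fixes \<iota> :: "'k::field \<Rightarrow> 'l::field"
  assumes iota: "\<iota> 1 = 1" "\<iota> (c + d) = \<iota> c + \<iota> d" "\<iota> (c * d) = \<iota> c * \<iota> d"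
begin

lemma iota_0: "\<iota> 0 = 0"
  using iota(2)[of 0 0] unfolding add_0 by (metis add_cancel_right_right)

lemma iota_eq_0: "\<iota> c = 0 \<Longrightarrow> c = 0"
  using iota(3)[of c "inverse c"] by (cases "c = 0") (auto simp: iota)

lemma iota_of_nat: "\<iota> (of_nat k) = of_nat k"
  by (induction k) (auto simp: iota iota_0)

lemma CHAR_eq: "CHAR('l) = CHAR('k)"
proof (rule CHAR_eqI)
  show "of_nat CHAR('k) = (0 :: 'l)"
    using iota_of_nat[of "CHAR('k)"] by (simp add: iota_0)
  show "CHAR('k) dvd x" if "of_nat x = (0 :: 'l)" for x
    using that iota_of_nat[of x] iota_eq_0 by (metis of_nat_eq_0_iff_char_dvd)
qed

lemma mpoly_eval_add: "mpoly_eval \<iota> a (F + G) = mpoly_eval \<iota> a F + mpoly_eval \<iota> a G"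
  unfolding mpoly_eval_def
  by (rule setsum_keys_plus_distrib) (auto simp: iota iota_0 algebra_simps)

lemma mpoly_eval_0: "mpoly_eval \<iota> a 0 = 0"
  by (simp add: mpoly_eval_def)

lemma mpoly_eval_single:
  "mpoly_eval \<iota> a (Poly_Mapping.single m c) =
     \<iota> c * (\<Prod>i\<in>Poly_Mapping.keys m. a i ^ Poly_Mapping.lookup m i)"
  by (cases "c = 0") (auto simp: mpoly_eval_def iota_0)

lemma mpoly_eval_mult: "mpoly_eval \<iota> a (F * G) = mpoly_eval \<iota> a F * mpoly_eval \<iota> a G"
proof (induction F rule: mpoly_additive_induct)
  case (single m c)
  show ?case
  proof (induction G rule: mpoly_additive_induct)
    case (single m' c')
    \<comment> \<open>The supports of m, m' and their sum differ; enlarging each product to the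
      support of the sum only adds factors with exponent 0.\<close>
    have *: "(\<Prod>i\<in>Poly_Mapping.keys q. a i ^ Poly_Mapping.lookup q i) =
        (\<Prod>i\<in>Poly_Mapping.keys (m + m'). a i ^ Poly_Mapping.lookup q i)"
      if "Poly_Mapping.keys q \<subseteq> Poly_Mapping.keys (m + m')" for q
      using that by (intro prod.mono_neutral_left) (auto simp: in_keys_iff)
    have "(\<Prod>i\<in>Poly_Mapping.keys (m + m'). a i ^ Poly_Mapping.lookup (m + m') i) =
        (\<Prod>i\<in>Poly_Mapping.keys m. a i ^ Poly_Mapping.lookup m i) *
        (\<Prod>i\<in>Poly_Mapping.keys m'. a i ^ Poly_Mapping.lookup m' i)"
      unfolding lookup_add power_add prod.distrib
      by (intro arg_cong2[where f = "(*)"] *[symmetric]) (auto simp: keys_add_monomial)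
    then show ?case
      by (simp add: mult_single mpoly_eval_single iota)
  qed (auto simp: mpoly_eval_0 mpoly_eval_add distrib_left)
qed (auto simp: mpoly_eval_0 mpoly_eval_add distrib_right)

lemma mpoly_eval_1: "mpoly_eval \<iota> a 1 = 1"
  using mpoly_eval_single[of a 0 1] by (simp add: iota)

sublocale mpoly_eval: comm_ring_hom "mpoly_eval \<iota> a" for a
  by standard (auto simp: mpoly_eval_0 mpoly_eval_1 mpoly_eval_add mpoly_eval_mult)

end

subsection \<open>Derivations\<close>

definition derivation :: "('a::comm_ring_1 \<Rightarrow> 'a) \<Rightarrow> bool" where
  "derivation d \<longleftrightarrow> (\<forall>f g. d (f + g) = d f + d g) \<and> (\<forall>f g. d (f * g) = d f * g + f * d g)"

lemma derivation_add: "derivation d \<Longrightarrow> d (f + g) = d f + d g"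
  and derivation_mult: "derivation d \<Longrightarrow> d (f * g) = d f * g + f * d g"
  by (auto simp: derivation_def)

lemma derivation_1: "derivation d \<Longrightarrow> d 1 = 0"
  using derivation_mult[of d 1 1] by (metis add_cancel_right_right mult.left_neutral mult.right_neutral)

lemma derivation_power:
  assumes "derivation d" shows "d (f ^ k) = of_nat k * f ^ (k - 1) * d f"
proof (induction k)
  case (Suc k)
  have "f * f ^ (k - 1) = f ^ k" if "k \<noteq> 0"
    using that by (cases k) auto
  \<comment> \<open>For k = 0 the exponent k - 1 is truncated, but the factor
    \<open>of_nat k\<close> vanishes.\<close>
  then have "of_nat k * (f * f ^ (k - 1)) = of_nat k * f ^ k"
    by (cases "k = 0") auto
  then show ?case
    using Suc by (simp add: derivation_mult[OF assms] distrib_left distrib_right) (metis mult.assoc mult.left_commute)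
qed (simp add: derivation_1[OF assms])

lemma derivation_prod_eq_0:
  assumes "derivation d" "\<And>i. i \<in> A \<Longrightarrow> d (f i) = 0" shows "d (prod f A) = 0"
  using assms(2)
  by (induction A rule: infinite_finite_induct)
    (auto simp: derivation_1[OF assms(1)] derivation_mult[OF assms(1)])

lemma derivation_power_mult:
  assumes "derivation d" "d f = 0" shows "(d ^^ k) (f * g) = f * (d ^^ k) g"
  by (induction k) (auto simp: derivation_mult[OF assms(1)] assms(2))

lemma derivation_funpow_add:
  assumes "derivation d" shows "(d ^^ k) (f + g) = (d ^^ k) f + (d ^^ k) g"
  by (induction k) (auto simp: derivation_add[OF assms])

text \<open>Modulo f, each of the k derivatives has to hit a different one of the k factors f, which
  can happen in k! orders. The cofactor u varies in the induction because one derivative turns it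
  into another cofactor of \<open>f ^ k\<close>.\<close>

lemma derivation_funpow_power:
  fixes d :: "'a::comm_ring_1 \<Rightarrow> 'a"
  assumes "derivation d" shows "\<exists>w. (d ^^ k) (f ^ k * u) = of_nat (fact k) * d f ^ k * u + f * w"
proof (induction k arbitrary: u)
  case (Suc k)
  have "d (f ^ Suc k * u) = f ^ k * (of_nat (Suc k) * d f * u + f * d u)"
    unfolding derivation_mult[OF assms] derivation_power[OF assms] by (simp add: algebra_simps)
  moreover obtain w where
    "(d ^^ k) (f ^ k * (of_nat (Suc k) * d f * u + f * d u)) =
       of_nat (fact k) * d f ^ k * (of_nat (Suc k) * d f * u + f * d u) + f * w"
    using Suc by blast
  moreover have "of_nat (fact k) * d f ^ k * (of_nat (Suc k) * d f * u + f * d u) + f * w =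
      of_nat (fact (Suc k)) * d f ^ Suc k * u + f * (of_nat (fact k) * d f ^ k * d u + w)"
    by (simp add: algebra_simps)
  ultimately show ?case
    unfolding funpow_Suc_right o_def by metis
qed (auto intro: exI[of _ 0])

lemma mpoly_deriv_single:
  "mpoly_deriv j (Poly_Mapping.single m c) =
     Poly_Mapping.single (m - Poly_Mapping.single j 1) (of_nat (Poly_Mapping.lookup m j) * c)"
  by (cases "c = 0") (auto simp: mpoly_deriv_def)

lemma mpoly_deriv_add: "mpoly_deriv j (F + G) = mpoly_deriv j F + mpoly_deriv j G"
  unfolding mpoly_deriv_def
  by (rule setsum_keys_plus_distrib) (auto simp: algebra_simps single_add)

lemma mpoly_deriv_0: "mpoly_deriv j 0 = 0"
  by (simp add: mpoly_deriv_def)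

lemma monomial_add_diff_single:
  "Poly_Mapping.lookup m j \<noteq> 0 \<Longrightarrow>
     m + m' - Poly_Mapping.single j 1 = (m - Poly_Mapping.single j 1) + (m' :: nat \<Rightarrow>\<^sub>0 nat)"
  by (rule poly_mapping_eqI) (auto simp: lookup_add lookup_minus lookup_single when_def)

lemma derivation_mpoly_deriv: "derivation (mpoly_deriv j)"
proof -
  have "mpoly_deriv j (F * G) = mpoly_deriv j F * G + F * mpoly_deriv j G" for F G :: "'a mpoly"
  proof (induction F rule: mpoly_additive_induct)
    case (single m c)
    show ?case
    proof (induction G rule: mpoly_additive_induct)
      case (single m' c')
      define e where "e = Poly_Mapping.single j (1::nat)"
      \<comment> \<open>If the variable j does not occur in m, truncation makes the exponents
        differ, but then both coefficients are 0.\<close>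
      have "Poly_Mapping.single (m - e + m') (of_nat (Poly_Mapping.lookup m j) * (c * c')) =
          Poly_Mapping.single (m + m' - e) (of_nat (Poly_Mapping.lookup m j) * (c * c'))"
        using monomial_add_diff_single[of m j m']
        by (cases "Poly_Mapping.lookup m j = 0") (auto simp: e_def)
      moreover
      have "Poly_Mapping.single (m + (m' - e)) (of_nat (Poly_Mapping.lookup m' j) * (c * c')) =
          Poly_Mapping.single (m + m' - e) (of_nat (Poly_Mapping.lookup m' j) * (c * c'))"
        using monomial_add_diff_single[of m' j m]
        by (cases "Poly_Mapping.lookup m' j = 0") (auto simp: e_def add.commute)
      ultimately show ?case
        unfolding mult_single mpoly_deriv_single e_def[symmetric]
        by (simp add: single_add[symmetric] lookup_add algebra_simps)
    qed (auto simp: mpoly_deriv_0 mpoly_deriv_add algebra_simps)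
  qed (auto simp: mpoly_deriv_0 mpoly_deriv_add algebra_simps)
  then show ?thesis by (auto simp: derivation_def mpoly_deriv_add)
qed

lemma keys_diff_monomial: "Poly_Mapping.keys (m - m') \<subseteq> Poly_Mapping.keys m"
  for m m' :: "nat \<Rightarrow>\<^sub>0 nat"
proof
  fix i assume "i \<in> Poly_Mapping.keys (m - m')"
  then have "Poly_Mapping.lookup m i - Poly_Mapping.lookup m' i \<noteq> 0"
    unfolding in_keys_iff lookup_minus .
  then show "i \<in> Poly_Mapping.keys m" unfolding in_keys_iff by (metis diff_0_eq_0)
qed

lemma mpoly_deriv_mpolys: "F \<in> mpolys n \<Longrightarrow> mpoly_deriv j F \<in> mpolys n"
  unfolding mpoly_deriv_def
proof (rule mpolys_sum, rule mpolys_single)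
  fix m assume "F \<in> mpolys n" "m \<in> Poly_Mapping.keys F"
  then have "Poly_Mapping.keys m \<subseteq> {..<n}" by (auto simp: mpolys_def)
  then show "Poly_Mapping.keys (m - Poly_Mapping.single j 1) \<subseteq> {..<n}"
    using keys_diff_monomial by blast
qed

subsection \<open>Frobenius coefficients\<close>

text \<open>Division with remainder in every exponent: a monomial is the p-th power of its
  \<open>exp_div\<close> part times its \<open>exp_mod\<close> part.\<close>

definition exp_mod :: "nat \<Rightarrow> (nat \<Rightarrow>\<^sub>0 nat) \<Rightarrow> (nat \<Rightarrow>\<^sub>0 nat)" where
  "exp_mod p m = Poly_Mapping.map (\<lambda>i. i mod p) m"

definition exp_div :: "nat \<Rightarrow> (nat \<Rightarrow>\<^sub>0 nat) \<Rightarrow> (nat \<Rightarrow>\<^sub>0 nat)" where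
  "exp_div p m = Poly_Mapping.map (\<lambda>i. i div p) m"

lemma lookup_exp_mod: "Poly_Mapping.lookup (exp_mod p m) i = Poly_Mapping.lookup m i mod p"
  by (auto simp: exp_mod_def map.rep_eq when_def)

lemma lookup_exp_div: "Poly_Mapping.lookup (exp_div p m) i = Poly_Mapping.lookup m i div p"
  by (auto simp: exp_div_def map.rep_eq when_def)

lemma lookup_map_times: "Poly_Mapping.lookup (Poly_Mapping.map ((*) p) m) i = p * Poly_Mapping.lookup m i"
  for m :: "nat \<Rightarrow>\<^sub>0 nat"
  by (auto simp: map.rep_eq when_def)

text \<open>The inverse of the Frobenius of the base field. Uniqueness of p-th roots in
  characteristic p makes the choice additive.\<close>

definition char_root :: "'k::alg_closed_field \<Rightarrow> 'k" where
  "char_root c = (SOME d. d ^ CHAR('k) = c)"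

text \<open>The polynomial ring is free over its p-th powers on the monomials with exponents below
  p. This is the p-th root of the coordinate of F at \<alpha>.\<close>

definition frob_coeff :: "(nat \<Rightarrow>\<^sub>0 nat) \<Rightarrow> 'k::alg_closed_field mpoly \<Rightarrow> 'k mpoly" where
  "frob_coeff \<alpha> F = (\<Sum>m\<in>Poly_Mapping.keys F.
     if exp_mod CHAR('k) m = \<alpha>
     then Poly_Mapping.single (exp_div CHAR('k) m) (char_root (Poly_Mapping.lookup F m)) else 0)"

context
  assumes pos: "CHAR('k::alg_closed_field) > 0"
begin

lemma prime_CHAR: "prime CHAR('k)"
  using pos by (rule prime_CHAR_semidom)

lemma char_root_power: "char_root c ^ CHAR('k) = (c::'k)"
  unfolding char_root_def using nth_root_exists[OF pos, of c] by (rule someI_ex)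

lemma frobenius_inj: "(c::'k) ^ CHAR('k) = d ^ CHAR('k) \<Longrightarrow> c = d"
proof -
  assume *: "c ^ CHAR('k) = d ^ CHAR('k)"
  \<comment> \<open>Expanding this sum, and not a difference, avoids the sign of (-1)^p.\<close>
  have "((c - d) + d) ^ CHAR('k) = (c - d) ^ CHAR('k) + d ^ CHAR('k)"
    by (rule freshmans_dream) (auto simp: prime_CHAR)
  then show "c = d" using * by simp
qed

lemma char_root_add: "char_root (c + d) = char_root c + (char_root d :: 'k)"
  by (rule frobenius_inj) (simp add: char_root_power freshmans_dream prime_CHAR)

lemma char_root_mult: "char_root (c ^ CHAR('k) * d) = c * (char_root d :: 'k)"
  by (rule frobenius_inj) (simp add: char_root_power power_mult_distrib)

lemma char_root_0: "char_root 0 = (0 :: 'k)"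
  using char_root_power[of 0] pos by simp

lemma frob_coeff_add: "frob_coeff \<alpha> (F + G) = frob_coeff \<alpha> F + frob_coeff \<alpha> (G :: 'k mpoly)"
  unfolding frob_coeff_def
  by (rule setsum_keys_plus_distrib) (auto simp: char_root_0 char_root_add single_add)

lemma frob_coeff_0: "frob_coeff \<alpha> (0 :: 'k mpoly) = 0"
  by (simp add: frob_coeff_def)

lemma frob_coeff_sum: "frob_coeff \<alpha> (sum F A) = (\<Sum>i\<in>A. frob_coeff \<alpha> (F i :: 'k mpoly))"
  by (induction A rule: infinite_finite_induct) (auto simp: frob_coeff_add frob_coeff_0)

lemma frob_coeff_single:
  "frob_coeff \<alpha> (Poly_Mapping.single m (c :: 'k)) =
     (if exp_mod CHAR('k) m = \<alpha> then Poly_Mapping.single (exp_div CHAR('k) m) (char_root c) else 0)"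
  by (cases "c = 0") (auto simp: frob_coeff_def char_root_0)

lemma mpoly_power_CHAR_add: "(F + G :: 'k mpoly) ^ CHAR('k) = F ^ CHAR('k) + G ^ CHAR('k)"
  by (rule freshmans_dream) (auto simp: CHAR_mpoly prime_CHAR)

text \<open>Multiplying a monomial by the p-th power of m leaves the residues of its exponents
  unchanged and adds m to the quotients.\<close>

lemma frob_coeff_power_mult:
  "frob_coeff \<alpha> (F ^ CHAR('k) * G) = F * frob_coeff \<alpha> (G :: 'k mpoly)"
proof (induction F rule: mpoly_additive_induct)
  case zero
  then show ?case using pos by (simp add: frob_coeff_0 power_0_left)
next
  case (add F F')
  then show ?case by (simp add: mpoly_power_CHAR_add distrib_right frob_coeff_add)
next
  case (single m c)
  show ?case
  proof (induction G rule: mpoly_additive_induct)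
    case (single m' c')
    have "exp_mod CHAR('k) (Poly_Mapping.map ((*) CHAR('k)) m + m') = exp_mod CHAR('k) m'"
      by (rule poly_mapping_eqI) (simp add: lookup_exp_mod lookup_add lookup_map_times)
    moreover
    have "exp_div CHAR('k) (Poly_Mapping.map ((*) CHAR('k)) m + m') = m + exp_div CHAR('k) m'"
      by (rule poly_mapping_eqI) (use pos in \<open>simp add: lookup_exp_div lookup_add lookup_map_times\<close>)
    ultimately show ?case
      by (simp add: single_power mult_single frob_coeff_single char_root_mult)
  qed (auto simp: frob_coeff_0 frob_coeff_add distrib_left)
qed

text \<open>For a single term only its own residue class contributes. The sum over all terms passes
  through the p-th power by the freshman's dream.\<close>

lemma frob_coeff_expand:
  assumes "F \<in> mpolys n"
  shows "F = (\<Sum>\<alpha>\<in>box_monomials n (CHAR('k) - 1).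
           frob_coeff \<alpha> F ^ CHAR('k) * Poly_Mapping.single \<alpha> (1::'k))"
proof -
  let ?A = "box_monomials n (CHAR('k) - 1)"
  have single: "Poly_Mapping.single m c =
      (\<Sum>\<alpha>\<in>?A. frob_coeff \<alpha> (Poly_Mapping.single m c) ^ CHAR('k) * Poly_Mapping.single \<alpha> 1)"
    if "Poly_Mapping.keys m \<subseteq> {..<n}" for m and c :: 'k
  proof -
    have "exp_mod CHAR('k) m \<in> ?A"
    proof -
      have "i < n" if "Poly_Mapping.lookup m i mod CHAR('k) \<noteq> 0" for i
        using that \<open>Poly_Mapping.keys m \<subseteq> {..<n}\<close> by (metis mod_0 in_keys_iff lessThan_iff subsetD)
      moreover have "Poly_Mapping.lookup m i mod CHAR('k) \<le> CHAR('k) - 1" for i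
        using mod_less_divisor[OF pos] by (metis Suc_pred' less_Suc_eq_le pos)
      ultimately show ?thesis
        by (auto simp: box_monomials_def in_keys_iff lookup_exp_mod)
    qed
    moreover have "Poly_Mapping.map ((*) CHAR('k)) (exp_div CHAR('k) m) + exp_mod CHAR('k) m = m"
      by (rule poly_mapping_eqI) (simp add: lookup_add lookup_map_times lookup_exp_div lookup_exp_mod)
    moreover have "(\<Sum>\<alpha>\<in>?A. frob_coeff \<alpha> (Poly_Mapping.single m c) ^ CHAR('k) * Poly_Mapping.single \<alpha> 1) =
        (\<Sum>\<alpha>\<in>?A. if exp_mod CHAR('k) m = \<alpha>
          then Poly_Mapping.single (exp_div CHAR('k) m) (char_root c) ^ CHAR('k) * Poly_Mapping.single \<alpha> 1 else 0)"
      using pos by (intro sum.cong) (auto simp: frob_coeff_single power_0_left)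
    ultimately show ?thesis
      by (simp add: finite_box_monomials single_power mult_single char_root_power)
  qed
  have "F = (\<Sum>m\<in>Poly_Mapping.keys F. Poly_Mapping.single m (Poly_Mapping.lookup F m))"
    by (rule mpoly_sum_single)
  also have "\<dots> = (\<Sum>m\<in>Poly_Mapping.keys F. \<Sum>\<alpha>\<in>?A.
      frob_coeff \<alpha> (Poly_Mapping.single m (Poly_Mapping.lookup F m)) ^ CHAR('k) * Poly_Mapping.single \<alpha> 1)"
    using assms by (intro sum.cong refl single) (auto simp: mpolys_def)
  also have "\<dots> = (\<Sum>\<alpha>\<in>?A.
      frob_coeff \<alpha> (\<Sum>m\<in>Poly_Mapping.keys F. Poly_Mapping.single m (Poly_Mapping.lookup F m)) ^ CHAR('k)
        * Poly_Mapping.single \<alpha> 1)"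
    by (subst sum.swap)
      (simp add: frob_coeff_sum freshmans_dream_sum CHAR_mpoly prime_CHAR sum_distrib_right)
  finally show ?thesis using mpoly_sum_single[of F] by simp
qed

text \<open>This contraction of degrees is what keeps all iterates in a finite-dimensional space, in
  \<open>bounded_degree_space\<close>.\<close>

lemma frob_coeff_box:
  assumes "F \<in> box_polys n s" shows "frob_coeff \<alpha> (F :: 'k mpoly) \<in> box_polys n (s div CHAR('k))"
  unfolding frob_coeff_def
proof (rule box_polys_sum)
  fix m assume "m \<in> Poly_Mapping.keys F"
  then have "m \<in> box_monomials n s" using assms by (auto simp: box_polys_def)
  then have "exp_div CHAR('k) m \<in> box_monomials n (s div CHAR('k))"
  proof -
    assume m: "m \<in> box_monomials n s"
    have "i \<in> Poly_Mapping.keys m" if "i \<in> Poly_Mapping.keys (exp_div CHAR('k) m)" for i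
      using that unfolding in_keys_iff lookup_exp_div by (metis div_0)
    moreover have "Poly_Mapping.lookup m i div CHAR('k) \<le> s div CHAR('k)" for i
      using m by (intro div_le_mono) (simp add: box_monomials_def)
    ultimately show ?thesis
      using m unfolding box_monomials_def mem_Collect_eq lookup_exp_div by blast
  qed
  then show "(if exp_mod CHAR('k) m = \<alpha> then Poly_Mapping.single (exp_div CHAR('k) m)
      (char_root (Poly_Mapping.lookup F m)) else 0) \<in> box_polys n (s div CHAR('k))"
    by (auto simp: box_polys_def)
qed

lemma frob_coeff_mpolys: "F \<in> mpolys n \<Longrightarrow> frob_coeff \<alpha> (F :: 'k mpoly) \<in> mpolys n"
  by (metis mpolys_in_box frob_coeff_box box_polys_subset_mpolys subsetD)

end

section \<open>A dual basis for the Frobenius of a standard smooth algebra\<close>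

lemma det_mpolys:
  assumes "A \<in> carrier_mat k k" "\<And>i j. i < k \<Longrightarrow> j < k \<Longrightarrow> A $$ (i, j) \<in> mpolys n"
  shows "det A \<in> mpolys n"
proof -
  have "signof \<pi> \<in> mpolys n" for \<pi> :: "nat \<Rightarrow> nat"
    by (auto simp: sign_def mpolys_1 mpolys_uminus)
  moreover have "(\<Prod>i = 0..<k. A $$ (i, \<pi> i)) \<in> mpolys n" if "\<pi> permutes {0..<k}" for \<pi>
    using that permutes_in_image[OF that] by (intro mpolys_prod assms(2)) auto
  ultimately show ?thesis
    unfolding det_def'[OF assms(1)] by (intro mpolys_sum mpolys_mult) auto
qed

lemma adj_mat_mpolys:
  assumes "A \<in> carrier_mat k k" "\<And>i j. i < k \<Longrightarrow> j < k \<Longrightarrow> A $$ (i, j) \<in> mpolys n"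
    and "i < k" "j < k"
  shows "adj_mat A $$ (i, j) \<in> mpolys n"
proof -
  have "det (mat_delete A j i) \<in> mpolys n"
  proof (rule det_mpolys)
    show "mat_delete A j i \<in> carrier_mat (k - 1) (k - 1)"
      using assms(1) by (rule mat_delete_carrier)
    show "mat_delete A j i $$ (i', j') \<in> mpolys n" if "i' < k - 1" "j' < k - 1" for i' j'
      using that assms by (auto simp: mat_delete_def)
  qed
  moreover have "(-1) ^ (j + i) \<in> mpolys n"
    by (intro mpolys_power mpolys_uminus mpolys_1)
  ultimately have "cofactor A j i \<in> mpolys n"
    unfolding cofactor_def by (rule mpolys_mult[rotated])
  then show ?thesis using assms by (simp add: adj_mat_def)
qed

locale smooth_algebra = base_field_hom \<iota>
  for \<iota> :: "'k::alg_closed_field \<Rightarrow> 'l::field" +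
  fixes p n c :: nat and a :: "nat \<Rightarrow> 'l" and f :: "nat \<Rightarrow> 'k mpoly"
  assumes p_eq: "p = CHAR('k)" and pos: "p > 0"
    and f_mpolys: "i < c \<Longrightarrow> f i \<in> mpolys n"
    and kernel: "F \<in> mpolys n \<Longrightarrow>
      mpoly_eval \<iota> a F = 0 \<longleftrightarrow> (\<exists>g. (\<forall>i<c. g i \<in> mpolys n) \<and> F = (\<Sum>i<c. g i * f i))"
    and det_nz: "det (jacobian \<iota> a f c) \<noteq> 0"
    and det_unit: "inverse (det (jacobian \<iota> a f c)) \<in> mpoly_eval \<iota> a ` mpolys n"
begin

lemma CHAR_pos: "CHAR('k) > 0"
  using pos p_eq by simp

abbreviation "ev \<equiv> mpoly_eval \<iota> a"

abbreviation "R \<equiv> ev ` mpolys n"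

definition Jac :: "'k mpoly mat" where
  "Jac = Matrix.mat c c (\<lambda>(i, j). mpoly_deriv j (f i))"

text \<open>
  As \<open>adj_mat Jac\<close> is the adjugate of the Jacobian matrix, \<open>\<delta> l (f i)\<close> is \<open>det Jac\<close> for \<open>i = l\<close> and \<open>0\<close>
  otherwise. Therefore \<open>\<D> c\<close>, which is linear over \<open>p\<close>-th powers, takes \<open>G * H\<close> to a unit times \<open>H\<close>
  modulo the ideal of the \<open>f i\<close>. Multiplication by \<open>G\<close> makes the Frobenius coefficients descend to
  the quotient \<open>R\<close>, as in Fedder's criterion.
\<close>

definition \<delta> :: "nat \<Rightarrow> 'k mpoly \<Rightarrow> 'k mpoly" where
  "\<delta> l H = (\<Sum>j<c. adj_mat Jac $$ (j, l) * mpoly_deriv j H)"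

fun \<D> :: "nat \<Rightarrow> 'k mpoly \<Rightarrow> 'k mpoly" where
  "\<D> 0 H = H"
| "\<D> (Suc l) H = (\<delta> l ^^ (p - 1)) (\<D> l H)"

text \<open>The factor that \<open>\<delta> l\<close>, iterated p - 1 times, produces from the (p -
  1)-st power of \<open>f l\<close> modulo \<open>f l\<close>, as computed in
  \<open>derivation_funpow_power\<close>. The unit in question is its c-th power.\<close>

definition \<kappa> :: "'k mpoly" where "\<kappa> = of_nat (fact (p - 1)) * det Jac ^ (p - 1)"

definition G :: "'k mpoly" where "G = (\<Prod>j<c. f j ^ (p - 1))"

text \<open>Meaningful on \<open>R\<close> only, where the choice of the lift is immaterial by
  \<open>frob_coeff_G_well_defined\<close>. The extension to the function field comes from
  \<open>p_linear_extension\<close>.\<close>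

definition \<psi> :: "(nat \<Rightarrow>\<^sub>0 nat) \<Rightarrow> 'l \<Rightarrow> 'l" where
  "\<psi> \<alpha> r = ev (frob_coeff \<alpha> (G * (SOME H. H \<in> mpolys n \<and> ev H = r)))"

text \<open>What remains of the basis monomial \<alpha> when \<open>\<D> c\<close> is applied to the
  Frobenius expansion of \<open>G * H\<close> and the unit is divided out.\<close>

definition w :: "(nat \<Rightarrow>\<^sub>0 nat) \<Rightarrow> 'l" where
  "w \<alpha> = inverse (ev \<kappa> ^ c) * ev (\<D> c (Poly_Mapping.single \<alpha> 1))"

lemma R_mult: "r \<in> R \<Longrightarrow> s \<in> R \<Longrightarrow> r * s \<in> R"
  by (auto intro!: imageI mpolys_mult simp flip: mpoly_eval_mult)

lemma R_add: "r \<in> R \<Longrightarrow> s \<in> R \<Longrightarrow> r + s \<in> R"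
  by (auto intro!: imageI mpolys_add simp flip: mpoly_eval_add)

lemma R_1: "1 \<in> R"
  using imageI[OF mpolys_1, of ev] by (simp add: mpoly_eval_1)

lemma R_power: "r \<in> R \<Longrightarrow> r ^ k \<in> R"
  by (induction k) (auto intro: R_mult R_1)

lemma iota_in_R: "\<iota> d \<in> R"
proof
  show "\<iota> d = ev (Poly_Mapping.single 0 d)" by (simp add: mpoly_eval_single)
qed (simp add: mpolys_single)

lemma ev_f: "i < c \<Longrightarrow> ev (f i) = 0"
  by (subst kernel[OF f_mpolys]) (auto intro!: exI[of _ "\<lambda>j. if j = i then 1 else 0"]
      simp: mpolys_1 mpolys_0 if_distrib[of "\<lambda>x. x * _"] sum.delta' cong: if_cong)

lemma Jac_carrier: "Jac \<in> carrier_mat c c"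
  by (simp add: Jac_def)

lemma ev_det_Jac: "ev (det Jac) = det (jacobian \<iota> a f c)"
proof -
  have "map_mat ev Jac = jacobian \<iota> a f c"
    by (auto simp: Jac_def jacobian_def)
  then show ?thesis using mpoly_eval.hom_det[of a Jac] by simp
qed

lemma derivation_\<delta>: "derivation (\<delta> l)"
  unfolding derivation_def \<delta>_def
  by (simp add: mpoly_deriv_add derivation_mult[OF derivation_mpoly_deriv] sum.distrib
      sum_distrib_left sum_distrib_right algebra_simps)

lemma \<delta>_f:
  assumes "i < c" "l < c" shows "\<delta> l (f i) = (if i = l then det Jac else 0)"
proof -
  have "\<delta> l (f i) = (Jac * adj_mat Jac) $$ (i, l)"
    using assms Jac_carrier adj_mat(1)[OF Jac_carrier]
    by (simp add: \<delta>_def scalar_prod_def mult.commute atLeast0LessThan) (simp add: Jac_def)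
  then show ?thesis
    using assms by (simp add: adj_mat(2)[OF Jac_carrier])
qed

lemma \<delta>_mpolys:
  assumes "H \<in> mpolys n" "l < c" shows "\<delta> l H \<in> mpolys n"
proof -
  have "adj_mat Jac $$ (j, l) \<in> mpolys n" if "j < c" for j
    using Jac_carrier _ that assms(2)
    by (rule adj_mat_mpolys) (simp add: Jac_def mpoly_deriv_mpolys f_mpolys)
  then show ?thesis
    unfolding \<delta>_def using assms by (intro mpolys_sum mpolys_mult mpoly_deriv_mpolys) auto
qed

lemma \<D>_mpolys: "l \<le> c \<Longrightarrow> H \<in> mpolys n \<Longrightarrow> \<D> l H \<in> mpolys n"
proof (induction l)
  case (Suc l)
  have "(\<delta> l ^^ k) (\<D> l H) \<in> mpolys n" for k
    using Suc by (induction k) (auto intro: \<delta>_mpolys)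
  then show ?case by simp
qed simp

lemma \<D>_add: "\<D> l (H + H') = \<D> l H + \<D> l H'"
  by (induction l) (auto simp: derivation_funpow_add[OF derivation_\<delta>])

lemma \<D>_sum: "\<D> l (sum F A) = (\<Sum>i\<in>A. \<D> l (F i))"
proof (induction A rule: infinite_finite_induct)
  have *: "\<D> l 0 = 0" using \<D>_add[of l 0 0] by (metis add_cancel_right_right)
  { case (infinite A) then show ?case by (simp add: *) }
  { case empty then show ?case by (simp add: *) }
qed (simp add: \<D>_add)

lemma \<delta>_power_p: "\<delta> l (u ^ p) = 0"
proof -
  have "of_nat p = (0 :: 'k mpoly)" by (metis CHAR_mpoly of_nat_CHAR p_eq)
  then show ?thesis by (simp add: derivation_power[OF derivation_\<delta>])
qed

lemma \<D>_power_p_mult: "\<D> l (u ^ p * H) = u ^ p * \<D> l H"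
  by (induction l) (auto simp: derivation_power_mult[OF derivation_\<delta>] \<delta>_power_p)

text \<open>The l-th operator kills the factors \<open>f j\<close> with j > l, so they pass through
  it, and it consumes the power of \<open>f l\<close>, leaving \<kappa> modulo \<open>f l\<close>.
  The cofactor u remains a polynomial because later operators still differentiate it; only its class
  in \<open>R\<close> is controlled.\<close>

lemma \<D>_product:
  "l \<le> c \<Longrightarrow> \<exists>u. \<D> l (G * H) = (\<Prod>j\<in>{l..<c}. f j ^ (p - 1)) * u \<and> ev u = ev \<kappa> ^ l * ev H"
proof (induction l)
  case 0
  show ?case by (auto simp: G_def lessThan_atLeast0 intro: exI[of _ H])
next
  case (Suc l)
  then obtain u where u: "\<D> l (G * H) = (\<Prod>j\<in>{l..<c}. f j ^ (p - 1)) * u"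
    "ev u = ev \<kappa> ^ l * ev H" by auto
  obtain w where w: "(\<delta> l ^^ (p - 1)) (f l ^ (p - 1) * u) =
      of_nat (fact (p - 1)) * \<delta> l (f l) ^ (p - 1) * u + f l * w"
    using derivation_funpow_power[OF derivation_\<delta>] by blast
  let ?P = "\<Prod>j\<in>{Suc l..<c}. f j ^ (p - 1)"
  have l: "l < c" using Suc by simp
  have "(\<Prod>j\<in>{l..<c}. f j ^ (p - 1)) = f l ^ (p - 1) * ?P"
    using l by (simp add: prod.atLeast_Suc_lessThan)
  then have "\<D> (Suc l) (G * H) = (\<delta> l ^^ (p - 1)) (?P * (f l ^ (p - 1) * u))"
    unfolding \<D>.simps u(1) by (simp only: mult_ac)
  also have "\<dots> = ?P * (\<delta> l ^^ (p - 1)) (f l ^ (p - 1) * u)"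
    using l by (intro derivation_power_mult[OF derivation_\<delta>] derivation_prod_eq_0[OF derivation_\<delta>])
      (auto simp: derivation_power[OF derivation_\<delta>] \<delta>_f)
  also have "\<dots> = ?P * (\<kappa> * u + f l * w)"
    unfolding w \<delta>_f[OF l l] \<kappa>_def by simp
  finally have "\<D> (Suc l) (G * H) = ?P * (\<kappa> * u + f l * w)" .
  moreover have "ev (\<kappa> * u + f l * w) = ev \<kappa> ^ Suc l * ev H"
    using l by (simp add: mpoly_eval_add mpoly_eval_mult ev_f u(2) mult_ac)
  ultimately show ?case by blast
qed

lemma ev_\<D>_G: "ev (\<D> c (G * H)) = ev \<kappa> ^ c * ev H"
  using \<D>_product[of c H] by auto

lemma ev_of_nat: "ev (of_nat k) = of_nat k"
  by (induction k) (auto simp: mpoly_eval_0 mpoly_eval_add mpoly_eval_1)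

lemma fact_nz: "(of_nat (fact (p - 1)) :: 'k) \<noteq> 0"
proof
  assume "(of_nat (fact (p - 1)) :: 'k) = 0"
  then have "p dvd fact (p - 1)"
    unfolding p_eq of_nat_eq_0_iff_char_dvd .
  then show False
    using prime_CHAR[OF CHAR_pos, folded p_eq] pos by (simp add: prime_dvd_fact_iff)
qed

lemma ev_\<kappa>: "ev \<kappa> = \<iota> (of_nat (fact (p - 1))) * det (jacobian \<iota> a f c) ^ (p - 1)"
proof -
  have "ev (x ^ k) = ev x ^ k" for x k
    by (induction k) (auto simp: mpoly_eval_mult mpoly_eval_1)
  then show ?thesis
    by (simp add: \<kappa>_def mpoly_eval_mult ev_det_Jac iota_of_nat ev_of_nat del: of_nat_fact)
qed

lemma ev_\<kappa>_nz: "ev \<kappa> \<noteq> 0"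
  using fact_nz det_nz iota_eq_0 unfolding ev_\<kappa> by fastforce

lemma inverse_\<kappa>: "inverse (ev \<kappa>) \<in> R"
proof -
  define d :: 'k where "d = of_nat (fact (p - 1))"
  have "\<iota> d * \<iota> (inverse d) = 1"
    using fact_nz by (simp add: iota(1) d_def flip: iota(3))
  then have "inverse (\<iota> d) \<in> R" using iota_in_R by (metis inverse_unique)
  then show ?thesis
    unfolding ev_\<kappa> d_def[symmetric] inverse_mult_distrib power_inverse[symmetric]
    using det_unit by (intro R_mult R_power) auto
qed

lemma w_in_R: "\<alpha> \<in> box_monomials n s \<Longrightarrow> w \<alpha> \<in> R"
  unfolding w_def power_inverse[symmetric]
  by (intro R_mult R_power inverse_\<kappa> imageI \<D>_mpolys mpolys_single) (auto simp: box_monomials_def)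

lemma G_mpolys: "G \<in> mpolys n"
  unfolding G_def by (intro mpolys_prod mpolys_power f_mpolys) auto

text \<open>Two lifts differ by a combination of the \<open>f i\<close>, and G times
  \<open>f i\<close> is divisible by the p-th power of \<open>f i\<close>. A Frobenius coordinate
  turns that power into \<open>f i\<close>, which vanishes in \<open>R\<close>.\<close>

lemma frob_coeff_G_well_defined:
  assumes "H \<in> mpolys n" "H' \<in> mpolys n" "ev H = ev H'"
  shows "ev (frob_coeff \<alpha> (G * H)) = ev (frob_coeff \<alpha> (G * H'))"
proof -
  have "H + - H' \<in> mpolys n" using assms by (intro mpolys_add mpolys_uminus)
  moreover have "ev (H + - H') = 0"
    using assms(3) mpoly_eval_add[of a "H + - H'" H'] by simp
  ultimately obtain g where "H + - H' = (\<Sum>i<c. g i * f i)"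
    using kernel by blast
  then have H: "H = (\<Sum>i<c. g i * f i) + H'" by (simp add: algebra_simps)
  have "ev (frob_coeff \<alpha> (G * (g i * f i))) = 0" if "i < c" for i
  proof -
    have "G = f i ^ (p - 1) * (\<Prod>j\<in>{..<c} - {i}. f j ^ (p - 1))"
      unfolding G_def using that by (subst prod.remove[of _ i]) auto
    moreover have "f i ^ p = f i ^ (p - 1) * f i"
      using pos by (metis power_minus_mult)
    ultimately have "G * (g i * f i) = f i ^ p * ((\<Prod>j\<in>{..<c} - {i}. f j ^ (p - 1)) * g i)"
      by (simp add: mult_ac)
    then show ?thesis
      by (simp only: frob_coeff_power_mult[OF CHAR_pos, folded p_eq] mpoly_eval_mult ev_f[OF that] mult_zero_left)
  qed
  then have "ev (\<Sum>i<c. frob_coeff \<alpha> (G * (g i * f i))) = 0"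
    unfolding mpoly_eval.hom_sum by simp
  then show ?thesis
    unfolding H distrib_left sum_distrib_left frob_coeff_add[OF CHAR_pos, folded p_eq] frob_coeff_sum[OF CHAR_pos, folded p_eq]
    by (simp add: mpoly_eval_add)
qed

lemma \<psi>_ev: "H \<in> mpolys n \<Longrightarrow> \<psi> \<alpha> (ev H) = ev (frob_coeff \<alpha> (G * H))"
  unfolding \<psi>_def
  by (rule someI2[of _ H]) (auto intro: frob_coeff_G_well_defined)

lemma \<psi>_in_R: "r \<in> R \<Longrightarrow> \<psi> \<alpha> r \<in> R"
  by (auto simp: \<psi>_ev intro!: imageI frob_coeff_mpolys[OF CHAR_pos, folded p_eq] mpolys_mult G_mpolys)

lemma \<psi>_add:
  assumes "r \<in> R" "s \<in> R" shows "\<psi> \<alpha> (r + s) = \<psi> \<alpha> r + \<psi> \<alpha> s"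
proof -
  obtain H H' where H: "H \<in> mpolys n" "H' \<in> mpolys n" "r = ev H" "s = ev H'" using assms by blast
  then have rs: "r + s = ev (H + H')" by (simp add: mpoly_eval_add)
  show ?thesis
    unfolding rs unfolding H(3,4) \<psi>_ev[OF H(1)] \<psi>_ev[OF H(2)] \<psi>_ev[OF mpolys_add[OF H(1,2)]]
    by (simp only: distrib_left frob_coeff_add[OF CHAR_pos, folded p_eq] mpoly_eval_add)
qed

lemma \<psi>_power_mult:
  assumes "r \<in> R" "s \<in> R" shows "\<psi> \<alpha> (r ^ p * s) = r * \<psi> \<alpha> s"
proof -
  obtain H H' where H: "H \<in> mpolys n" "H' \<in> mpolys n" "r = ev H" "s = ev H'" using assms by blast
  have ev_power: "ev (H ^ k) = ev H ^ k" for k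
    by (induction k) (auto simp: mpoly_eval_mult mpoly_eval_1)
  have rs: "r ^ p * s = ev (H ^ p * H')" by (simp add: H mpoly_eval_mult ev_power)
  have "G * (H ^ p * H') = H ^ p * (G * H')" by (simp add: mult_ac)
  then show ?thesis
    unfolding rs unfolding H(3,4) \<psi>_ev[OF H(2)] \<psi>_ev[OF mpolys_mult[OF mpolys_power[OF H(1)] H(2)]]
    by (simp only: frob_coeff_power_mult[OF CHAR_pos, folded p_eq] mpoly_eval_mult)
qed

text \<open>Expand \<open>G * H\<close> over p-th powers and apply \<open>\<D> c\<close>: the p-th
  powers pass through, and the left side becomes a unit times H in \<open>R\<close>.\<close>

lemma dual_basis:
  assumes "r \<in> R" shows "r = (\<Sum>\<alpha>\<in>box_monomials n (p - 1). \<psi> \<alpha> r ^ p * w \<alpha>)"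
proof -
  obtain H where H: "H \<in> mpolys n" "r = ev H" using assms by blast
  have ev_power: "ev (H ^ k) = ev H ^ k" for k H
    by (induction k) (auto simp: mpoly_eval_mult mpoly_eval_1)
  have "ev \<kappa> ^ c * r = ev (\<D> c (G * H))"
    by (simp add: ev_\<D>_G H)
  also have "\<dots> = ev (\<D> c (\<Sum>\<alpha>\<in>box_monomials n (p - 1).
      frob_coeff \<alpha> (G * H) ^ p * Poly_Mapping.single \<alpha> 1))"
    using frob_coeff_expand[OF CHAR_pos, folded p_eq, OF mpolys_mult[OF G_mpolys H(1)]] by simp
  also have "\<dots> = (\<Sum>\<alpha>\<in>box_monomials n (p - 1). \<psi> \<alpha> r ^ p * ev (\<D> c (Poly_Mapping.single \<alpha> 1)))"
    by (simp add: \<D>_sum \<D>_power_p_mult mpoly_eval.hom_sum mpoly_eval_mult ev_power H \<psi>_ev)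
  finally have "inverse (ev \<kappa> ^ c) * (ev \<kappa> ^ c * r) = (\<Sum>\<alpha>\<in>box_monomials n (p - 1). \<psi> \<alpha> r ^ p * w \<alpha>)"
    by (simp add: w_def sum_distrib_left mult_ac)
  moreover have "inverse (ev \<kappa> ^ c) * (ev \<kappa> ^ c * r) = r"
    using ev_\<kappa>_nz by (simp flip: mult.assoc)
  ultimately show ?thesis by metis
qed

lemma vector_space_iota: "vector_space (\<lambda>d x. \<iota> d * x)"
  by standard (auto simp: iota algebra_simps)

text \<open>The quotient \<open>R\<close> has no degree of its own, so the degree is bounded on
  representing polynomials.\<close>

lemma bounded_degree_space:
  assumes "g \<in> R"
  obtains V B where "finite B" "g \<in> V" "V \<subseteq> R" "\<And>\<alpha>. \<psi> \<alpha> ` V \<subseteq> V"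
    "V \<subseteq> module.span (\<lambda>d x. \<iota> d * x) B"
proof -
  interpret vs: vector_space "\<lambda>d x. \<iota> d * x" by (rule vector_space_iota)
  obtain H where H: "H \<in> mpolys n" "g = ev H" using assms by blast
  obtain s where s: "H \<in> box_polys n s" using H mpolys_in_box by blast
  obtain t where t: "G \<in> box_polys n t" using G_mpolys mpolys_in_box by blast
  \<comment> \<open>D bounds the degree of H, so that g belongs to the space, and the degree t of G,
    so that (t + D) / p <= 2 D / p <= D.\<close>
  define D where "D = max s t"
  define B where "B = (\<lambda>m. ev (Poly_Mapping.single m 1)) ` box_monomials n D"
  show thesis
  proof (rule that[of B "ev ` box_polys n D"])
    show "finite B" by (simp add: B_def finite_box_monomials)
    show "g \<in> ev ` box_polys n D"
      using s H box_polys_mono[of s D] by (auto simp: D_def)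
    show "ev ` box_polys n D \<subseteq> R" using box_polys_subset_mpolys by blast
    show "\<psi> \<alpha> ` ev ` box_polys n D \<subseteq> ev ` box_polys n D" for \<alpha>
    proof clarify
      fix F :: "'k mpoly" assume F: "F \<in> box_polys n D"
      have "frob_coeff \<alpha> (G * F) \<in> box_polys n ((t + D) div p)"
        using frob_coeff_box[OF CHAR_pos, folded p_eq, OF box_polys_mult[OF t F]] .
      moreover have "(t + D) div p \<le> D"
      proof -
        have "t + D \<le> 2 * D" by (simp add: D_def)
        moreover have "2 * D \<le> p * D"
          using prime_ge_2_nat[OF prime_CHAR[OF CHAR_pos, folded p_eq]] by simp
        ultimately have "(t + D) div p \<le> (p * D) div p" by (intro div_le_mono) linarith
        then show ?thesis using pos by simp
      qed
      ultimately have "frob_coeff \<alpha> (G * F) \<in> box_polys n D"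
        using box_polys_mono by blast
      then show "\<psi> \<alpha> (ev F) \<in> ev ` box_polys n D"
        using F box_polys_subset_mpolys by (subst \<psi>_ev) blast+
    qed
    show "ev ` box_polys n D \<subseteq> vs.span B"
    proof clarify
      fix F :: "'k mpoly" assume F: "F \<in> box_polys n D"
      have "ev F = ev (\<Sum>m\<in>Poly_Mapping.keys F. Poly_Mapping.single m (Poly_Mapping.lookup F m))"
        using mpoly_sum_single[of F] by simp
      also have "\<dots> = (\<Sum>m\<in>Poly_Mapping.keys F. \<iota> (Poly_Mapping.lookup F m) * ev (Poly_Mapping.single m 1))"
        by (simp add: mpoly_eval.hom_sum mpoly_eval_single iota)
      also have "\<dots> \<in> vs.span B"
        using F by (intro vs.span_sum vs.span_scale vs.span_base) (auto simp: B_def box_polys_def)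
      finally show "ev F \<in> vs.span B" .
    qed
  qed
qed

end

section \<open>Valuations and $p^{-e}$-linear maps\<close>

lemma val_0: "real_valuation v \<Longrightarrow> v 0 = \<infinity>"
  by (simp add: real_valuation_def)

lemma val_real:
  assumes "real_valuation v" "f \<noteq> 0" obtains r where "v f = ereal r"
  using assms unfolding real_valuation_def by (metis ereal_cases)

lemma val_mult: "real_valuation v \<Longrightarrow> v (f * g) = v f + v g"
  and val_add: "real_valuation v \<Longrightarrow> min (v f) (v g) \<le> v (f + g)"
  by (auto simp: real_valuation_def)

lemma val_1: assumes "real_valuation v" shows "v 1 = 0"
proof -
  obtain r where "v 1 = ereal r" using val_real[OF assms, of 1] by auto
  then show ?thesis using val_mult[OF assms, of 1 1] by (simp add: zero_ereal_def)
qed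

lemma val_power: "real_valuation v \<Longrightarrow> v (f ^ k) = ereal (real k) * v f"
proof (induction k)
  case (Suc k)
  show ?case
  proof (cases "f = 0")
    case True
    then show ?thesis using Suc by (simp add: val_0)
  next
    case False
    then obtain r where "v f = ereal r" using val_real Suc by blast
    then show ?thesis using Suc by (simp add: val_mult algebra_simps)
  qed
qed (simp add: val_1 zero_ereal_def[symmetric])

lemma val_sum_ge:
  assumes v: "real_valuation v" and "\<And>i. i \<in> A \<Longrightarrow> d \<le> v (f i)" shows "d \<le> v (sum f A)"
  using assms(2)
proof (induction A rule: infinite_finite_induct)
  case (insert i A)
  then have "d \<le> min (v (f i)) (v (sum f A))" by simp
  also have "\<dots> \<le> v (f i + sum f A)" using v by (rule val_add)
  finally show ?case using insert by simp
qed (auto simp: val_0[OF v])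

lemma val_div:
  assumes "real_valuation v" "b \<noteq> 0" shows "v (a / b) = v a - v b"
proof -
  obtain r where r: "v b = ereal r" using val_real assms by blast
  have "v a = v (a / b) + v b" using assms by (simp flip: val_mult)
  then show ?thesis unfolding r by (cases "v (a / b)") auto
qed

lemma val_minus:
  assumes v: "real_valuation v" shows "v (- f) = v f"
proof -
  obtain r where r: "v (- 1) = ereal r" using val_real[OF v, of "- 1"] by auto
  have "v (- 1) + v (- 1) = 0" using val_mult[OF v, of "- 1" "- 1"] val_1[OF v] by simp
  then have "v (- 1) = 0" by (simp add: r zero_ereal_def)
  then show ?thesis using val_mult[OF v, of "- 1" f] by simp
qed

lemma p_linear_add: "p_linear p e \<psi> \<Longrightarrow> \<psi> (f + g) = \<psi> f + \<psi> g"
  and p_linear_mult: "p_linear p e \<psi> \<Longrightarrow> \<psi> (f ^ (p ^ e) * g) = f * \<psi> g"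
  by (auto simp: p_linear_def)

lemma p_linear_0: "p_linear p e \<psi> \<Longrightarrow> \<psi> 0 = 0"
  using p_linear_add[of p e \<psi> 0 0] by (metis add_cancel_right_right)

lemma p_linear_comp:
  assumes "p_linear p e \<psi>" "p_linear p e' \<psi>'" shows "p_linear p (e + e') (\<psi> \<circ> \<psi>')"
proof -
  have "\<psi> (\<psi>' (f ^ (p ^ (e + e')) * g)) = f * \<psi> (\<psi>' g)" for f g
    using p_linear_mult[OF assms(2), of "f ^ (p ^ e)" g] p_linear_mult[OF assms(1)]
    by (simp add: power_add power_mult)
  then show ?thesis
    using p_linear_add[OF assms(1)] p_linear_add[OF assms(2)] by (auto simp: p_linear_def)
qed

lemma p_linear_id: "p_linear p 0 id"
  by (simp add: p_linear_def)

lemma p_linear_funpow: "p_linear p e \<psi> \<Longrightarrow> p_linear p (k * e) (\<psi> ^^ k)"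
  by (induction k) (auto intro: p_linear_comp simp: p_linear_id[unfolded id_def] id_def)

lemma p_linear_scale: "p_linear p e \<psi> \<Longrightarrow> p_linear p e (\<lambda>f. h * \<psi> f)"
  by (simp add: p_linear_def algebra_simps)

text \<open>Rewrite the fraction with denominator b^q, where q = p^e; a p^e-th power leaves \<psi>
  as its root.\<close>

lemma p_linear_div:
  assumes "p_linear p e \<psi>" "p > 0" "b \<noteq> 0"
  shows "\<psi> (a / b) = \<psi> (a * b ^ (p ^ e - 1)) / b"
proof -
  have "b ^ (p ^ e) = b * b ^ (p ^ e - 1)"
    using assms(2) by (metis Suc_pred' power_Suc zero_less_power)
  then have "a * b ^ (p ^ e - 1) = b ^ (p ^ e) * (a / b)" using assms(3) by simp
  then show ?thesis using p_linear_mult[OF assms(1), of b "a / b"] assms(3) by simp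
qed

section \<open>Extension of p^(-1)-linear maps to the fraction field\<close>

locale fraction_subring =
  fixes R :: "'l::field set"
  assumes R_one: "1 \<in> R"
    and R_plus: "r \<in> R \<Longrightarrow> s \<in> R \<Longrightarrow> r + s \<in> R"
    and R_times: "r \<in> R \<Longrightarrow> s \<in> R \<Longrightarrow> r * s \<in> R"
    and R_frac: "\<exists>r\<in>R. \<exists>s\<in>R. s \<noteq> 0 \<and> x = r / s"
begin

lemma R_pow: "r \<in> R \<Longrightarrow> r ^ k \<in> R"
  by (induction k) (auto intro: R_one R_times)

text \<open>The formula is forced: r / s has numerator \<open>r * s ^ (p - 1)\<close> over the p-th
  power of s.\<close>

lemma p_linear_extension:
  assumes p: "p > 0"
    and add: "\<And>r s. r \<in> R \<Longrightarrow> s \<in> R \<Longrightarrow> \<phi> (r + s) = \<phi> r + \<phi> s"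
    and mult: "\<And>r s. r \<in> R \<Longrightarrow> s \<in> R \<Longrightarrow> \<phi> (r ^ p * s) = r * \<phi> s"
  obtains \<psi> where "p_linear p 1 \<psi>" "\<And>r. r \<in> R \<Longrightarrow> \<psi> r = \<phi> r"
proof -
  define \<psi> where "\<psi> x = (let (r, s) = SOME (r, s). r \<in> R \<and> s \<in> R \<and> s \<noteq> 0 \<and> x = r / s
    in \<phi> (r * s ^ (p - 1)) / s)" for x
  have pow: "b ^ p = b * b ^ (p - 1)" for b :: 'l
    using p by (metis Suc_pred' power_Suc)
  have wd: "\<phi> (r * s ^ (p - 1)) / s = \<phi> (r' * s' ^ (p - 1)) / s'"
    if "r \<in> R" "s \<in> R" "s \<noteq> 0" "r' \<in> R" "s' \<in> R" "s' \<noteq> 0" "r / s = r' / s'" for r s r' s'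
  proof -
    have e: "r * s' = r' * s" using that by (simp add: frac_eq_eq)
    \<comment> \<open>The relation r s' = r' s is multiplied by the (p - 1)-st powers of s and s'.
      Each side becomes a p-th power times an argument of \<phi>, to which \<open>mult\<close>
      applies.\<close>
    have "s' ^ p * (r * s ^ (p - 1)) = (r * s') * (s ^ (p - 1) * s' ^ (p - 1))"
      by (simp add: pow mult_ac)
    also have "\<dots> = s ^ p * (r' * s' ^ (p - 1))" unfolding e by (simp add: pow mult_ac)
    finally have "s' * \<phi> (r * s ^ (p - 1)) = s * \<phi> (r' * s' ^ (p - 1))"
      using that mult[of s' "r * s ^ (p - 1)"] mult[of s "r' * s' ^ (p - 1)"]
      by (simp add: R_times R_pow)
    then show ?thesis using that by (simp add: frac_eq_eq mult.commute)
  qed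
  have \<psi>: "\<psi> (r / s) = \<phi> (r * s ^ (p - 1)) / s" if "r \<in> R" "s \<in> R" "s \<noteq> 0" for r s
  proof -
    define q where "q = (SOME (r', s'). r' \<in> R \<and> s' \<in> R \<and> s' \<noteq> 0 \<and> r / s = r' / s')"
    have "case q of (r', s') \<Rightarrow> r' \<in> R \<and> s' \<in> R \<and> s' \<noteq> 0 \<and> r / s = r' / s'"
      unfolding q_def by (rule someI[of _ "(r, s)"]) (use that in simp)
    moreover obtain r' s' where "q = (r', s')" by (cases q)
    ultimately show ?thesis
      using wd[of r' s' r s] that unfolding \<psi>_def q_def[symmetric] by auto
  qed
  have \<psi>_plus: "\<psi> ((u + u') / m) = \<psi> (u / m) + \<psi> (u' / m)"
    if "u \<in> R" "u' \<in> R" "m \<in> R" "m \<noteq> 0" for u u' m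
    unfolding \<psi>[OF that(1,3,4)] \<psi>[OF that(2,3,4)] \<psi>[OF R_plus[OF that(1,2)] that(3,4)]
      distrib_right using that by (simp only: add R_times R_pow add_divide_distrib)
  show thesis
  proof (rule that[of \<psi>])
    show "\<psi> r = \<phi> r" if "r \<in> R" for r
      using \<psi>[OF that R_one] by simp
    have "\<psi> (x + y) = \<psi> x + \<psi> y \<and> \<psi> (x ^ p * y) = x * \<psi> y" for x y
    proof -
      obtain r s where x: "r \<in> R" "s \<in> R" "s \<noteq> 0" "x = r / s" using R_frac by blast
      obtain r' s' where y: "r' \<in> R" "s' \<in> R" "s' \<noteq> 0" "y = r' / s'" using R_frac by blast
      have "x = (r * s') / (s * s')" "y = (r' * s) / (s * s')" "x + y = (r * s' + r' * s) / (s * s')"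
        using x y by (auto simp: field_simps)
      moreover have "\<psi> ((r * s' + r' * s) / (s * s')) =
          \<psi> ((r * s') / (s * s')) + \<psi> ((r' * s) / (s * s'))"
        using x y \<psi>_plus[of "r * s'" "r' * s" "s * s'"] R_times by simp
      moreover have "x ^ p * y = (r ^ p * r') / (s ^ p * s')"
        using x y by (simp add: power_divide)
      moreover have "\<psi> ((r ^ p * r') / (s ^ p * s')) = x * \<psi> y"
      proof -
        have e: "(r ^ p * r') * (s ^ p * s') ^ (p - 1) = (r * s ^ (p - 1)) ^ p * (r' * s' ^ (p - 1))"
          by (simp add: power_mult_distrib mult_ac flip: power_mult)
        have "\<psi> ((r ^ p * r') / (s ^ p * s')) =
            \<phi> ((r ^ p * r') * (s ^ p * s') ^ (p - 1)) / (s ^ p * s')"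
          by (rule \<psi>) (use x y in \<open>auto intro: R_times R_pow\<close>)
        also have "\<dots> = \<phi> ((r * s ^ (p - 1)) ^ p * (r' * s' ^ (p - 1))) / (s ^ p * s')"
          unfolding e ..
        also have "\<dots> = (r * s ^ (p - 1)) * \<phi> (r' * s' ^ (p - 1)) / (s ^ p * s')"
          using x y by (simp add: mult R_times R_pow)
        also have "\<dots> = x * \<psi> y"
          using x y by (simp add: \<psi> pow)
        finally show ?thesis .
      qed
      ultimately show ?thesis by metis
    qed
    then show "p_linear p 1 \<psi>" by (simp add: p_linear_def)
  qed
qed

end

text \<open>
  \<open>N\<close> does not depend on \<open>v\<close>, because the minimum \<open>\<mu>\<close> is attained on the basis \<open>T\<close>, which is chosen
  before \<open>v\<close>.
\<close>

lemma (in smooth_algebra) value_zero_iterate: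
  assumes frac: "\<And>x. \<exists>r\<in>R. \<exists>s\<in>R. s \<noteq> 0 \<and> x = r / s"
    and g: "g \<in> R" "g \<noteq> 0"
  obtains N where "\<And>v. real_valuation v \<Longrightarrow> (\<And>r. r \<in> R \<Longrightarrow> 0 \<le> v r) \<Longrightarrow>
    \<exists>k \<Psi>. 1 \<le> k \<and> k \<le> N \<and> p_linear p k \<Psi> \<and> \<Psi> ` R \<subseteq> R \<and> v (\<Psi> g) = 0"
proof -
  interpret fraction_subring R
    by standard (use R_1 R_add R_mult frac in auto)
  interpret vs: vector_space "\<lambda>d x. \<iota> d * x" by (rule vector_space_iota)
  let ?A = "box_monomials n (p - 1)"
  have "\<exists>\<Psi>. p_linear p 1 \<Psi> \<and> (\<forall>r\<in>R. \<Psi> r = \<psi> \<alpha> r)" for \<alpha>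
    by (rule p_linear_extension[where \<phi> = "\<psi> \<alpha>", OF pos \<psi>_add \<psi>_power_mult]) auto
  then obtain E where E: "\<And>\<alpha>. p_linear p 1 (E \<alpha>)" "\<And>\<alpha> r. r \<in> R \<Longrightarrow> E \<alpha> r = \<psi> \<alpha> r"
    by metis
  have E_R: "E \<alpha> r \<in> R" if "r \<in> R" for \<alpha> r
    using E(2)[OF that] \<psi>_in_R[OF that] by simp
  have words: "p_linear p (length xs) (foldr E xs) \<and> foldr E xs ` R \<subseteq> R" for xs
  proof (induction xs)
    case (Cons \<alpha> xs)
    then have "p_linear p (length (\<alpha> # xs)) (foldr E (\<alpha> # xs))"
      using p_linear_comp[OF E(1)[of \<alpha>], of "length xs" "foldr E xs"] by (simp add: comp_def)
    moreover have "foldr E (\<alpha> # xs) ` R \<subseteq> R"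
      using Cons E_R unfolding image_subset_iff foldr.simps o_apply by blast
    ultimately show ?case by blast
  qed (auto simp: p_linear_def)
  \<comment> \<open>The empty word is excluded because \<open>log_disc_E\<close> divides by p^k - 1,
    which requires k >= 1.\<close>
  define S where "S = {foldr E xs g | xs. xs \<noteq> [] \<and> set xs \<subseteq> ?A}"
  have words_R: "foldr E xs g \<in> R" for xs
    using words[of xs] imageI[OF g(1), of "foldr E xs"] by (rule conjunct2[THEN subsetD])
  have S_R: "S \<subseteq> R"
  proof
    fix x assume "x \<in> S"
    then obtain xs where "x = foldr E xs g" unfolding S_def by blast
    then show "x \<in> R" using words_R[of xs] by (simp only:)
  qed
  obtain V B where V: "finite B" "g \<in> V" "V \<subseteq> R" "\<And>\<alpha>. \<psi> \<alpha> ` V \<subseteq> V" "V \<subseteq> vs.span B"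
    by (rule bounded_degree_space[OF g(1)], rule that)
  have "foldr E xs g \<in> V" for xs
  proof (induction xs)
    case (Cons \<alpha> xs)
    then have "E \<alpha> (foldr E xs g) = \<psi> \<alpha> (foldr E xs g)" using V(3) E(2) by blast
    then show ?case using Cons V(4) by auto
  qed (use V in simp)
  then have S_V: "S \<subseteq> V" by (auto simp: S_def)
  obtain T where T: "T \<subseteq> S" "vs.independent T" "S \<subseteq> vs.span T"
    by (rule vs.maximal_independent_subset)
  have "finite T"
    using vs.independent_span_bound[OF V(1) T(2)] T(1) S_V V(5) by blast
  \<comment> \<open>If every single letter killed g, the dual basis expansion would give g =
    0.\<close>
  have "T \<noteq> {}"
  proof
    assume "T = {}"
    then have "S \<subseteq> {0}" using T(3) by simp
    moreover have "\<psi> \<alpha> g \<in> S" if "\<alpha> \<in> ?A" for \<alpha>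
      unfolding S_def by (rule CollectI, rule exI[of _ "[\<alpha>]"]) (use that E(2)[OF g(1)] in simp)
    ultimately have "\<psi> \<alpha> g = 0" if "\<alpha> \<in> ?A" for \<alpha> using that by blast
    then have "(\<Sum>\<alpha>\<in>?A. \<psi> \<alpha> g ^ p * w \<alpha>) = 0"
      using pos by (intro sum.neutral) simp
    then show False using dual_basis[OF g(1)] g(2) by simp
  qed
  have "\<exists>xs. xs \<noteq> [] \<and> foldr E xs g = t" if "t \<in> T" for t
    using that T(1) by (auto simp: S_def)
  then obtain word where word: "\<And>t. t \<in> T \<Longrightarrow> word t \<noteq> [] \<and> foldr E (word t) g = t"
    by metis
  show thesis
  proof (rule that[of "Max (length ` word ` T)"])
    fix v :: "'l \<Rightarrow> ereal" assume v: "real_valuation v" and v_R: "\<And>r. r \<in> R \<Longrightarrow> 0 \<le> v r"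
    have "Min (v ` T) \<in> v ` T" using \<open>finite T\<close> \<open>T \<noteq> {}\<close> by (intro Min_in) auto
    then obtain t where t: "t \<in> T" "v t = Min (v ` T)" by auto
    \<comment> \<open>Scalars from the base field lie in \<open>R\<close> and have nonnegative
      value, so a lower bound on T extends to its span.\<close>
    have span: "v t \<le> v x" if "x \<in> vs.span T" for x
      using that
    proof (induction rule: vs.span_induct_alt)
      case base
      then show ?case by (simp add: val_0[OF v])
    next
      case (step d x y)
      have "v t \<le> v x" using t(2) step(1) \<open>finite T\<close> by simp
      moreover have "0 \<le> v (\<iota> d)" using v_R iota_in_R by blast
      ultimately have "v t \<le> v (\<iota> d * x)"
        unfolding val_mult[OF v] by (metis add_0 add_mono)
      then have "v t \<le> min (v (\<iota> d * x)) (v y)" using step by simp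
      also have "\<dots> \<le> v (\<iota> d * x + y)" by (rule val_add[OF v])
      finally show ?case .
    qed
    have "t \<in> S" "t \<in> R" using t T(1) S_R by auto
    have "t \<noteq> 0" using t T(2) vs.dependent_zero by blast
    then obtain \<mu> where \<mu>: "v t = ereal \<mu>" using val_real v by blast
    have "ereal (real p) * v t \<le> v t"
    proof -
      have "ereal (real p) * v t \<le> v (\<psi> \<alpha> t ^ p * w \<alpha>)" if "\<alpha> \<in> ?A" for \<alpha>
      proof -
        obtain xs where xs: "xs \<noteq> []" "set xs \<subseteq> ?A" "t = foldr E xs g"
          using \<open>t \<in> S\<close> by (auto simp: S_def)
        \<comment> \<open>S is closed under prepending a letter; this bounds the values of the
          coordinates of t by that of t itself.\<close>
        have "E \<alpha> t \<in> S"
          unfolding S_def by (rule CollectI, rule exI[of _ "\<alpha> # xs"]) (use xs that in auto)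
        then have "v t \<le> v (\<psi> \<alpha> t)" using span T(3) unfolding E(2)[OF \<open>t \<in> R\<close>] by blast
        then have "ereal (real p) * v t \<le> ereal (real p) * v (\<psi> \<alpha> t)"
          by (intro ereal_mult_left_mono) auto
        moreover have "0 \<le> v (w \<alpha>)" using v_R w_in_R[OF that] by blast
        ultimately show ?thesis
          unfolding val_mult[OF v] val_power[OF v] by (metis add.right_neutral add_mono)
      qed
      then have "ereal (real p) * v t \<le> v (\<Sum>\<alpha>\<in>?A. \<psi> \<alpha> t ^ p * w \<alpha>)"
        by (rule val_sum_ge[OF v])
      then show ?thesis using dual_basis[OF \<open>t \<in> R\<close>] by simp
    qed
    then have "real p * \<mu> \<le> \<mu>" by (simp add: \<mu>)
    moreover have "2 \<le> real p"
      using prime_ge_2_nat[OF prime_CHAR[OF CHAR_pos, folded p_eq]] by simp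
    moreover have "0 \<le> \<mu>" using v_R[OF \<open>t \<in> R\<close>] by (simp add: \<mu>)
    ultimately have "2 * \<mu> \<le> \<mu>" by (meson mult_right_mono order_trans)
    then have "v t = 0" using \<open>0 \<le> \<mu>\<close> by (simp add: \<mu> zero_ereal_def)
    moreover have "length (word t) \<le> Max (length ` word ` T)"
      using t(1) \<open>finite T\<close> by (intro Max_ge) auto
    moreover have "1 \<le> length (word t)" using word[OF t(1)] by (cases "word t") auto
    ultimately show "\<exists>k \<Psi>. 1 \<le> k \<and> k \<le> Max (length ` word ` T) \<and> p_linear p k \<Psi> \<and> \<Psi> ` R \<subseteq> R \<and> v (\<Psi> g) = 0"
      using word[OF t(1)] words[of "word t"] by (metis)
  qed
qed

section \<open>Affine opens and centers\<close>

context integral_scheme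
begin

lemma open_meet:
  assumes "openin \<X> U" "openin \<X> V" "U \<noteq> {}" "V \<noteq> {}" shows "U \<inter> V \<noteq> {}"
proof
  assume "U \<inter> V = {}"
  then have "topspace \<X> \<subseteq> (topspace \<X> - U) \<union> (topspace \<X> - V)" by blast
  moreover have "closedin \<X> (topspace \<X> - U)" "closedin \<X> (topspace \<X> - V)"
    using assms by auto
  ultimately have "topspace \<X> \<subseteq> topspace \<X> - U \<or> topspace \<X> \<subseteq> topspace \<X> - V"
    using irreducible unfolding irreducible_in_def by blast
  then show False using assms openin_subset by blast
qed

lemma sections_closed:
  assumes "openin \<X> U" "U \<noteq> {}"
  shows "0 \<in> \<O> U" "1 \<in> \<O> U" "f \<in> \<O> U \<Longrightarrow> g \<in> \<O> U \<Longrightarrow> f + g \<in> \<O> U"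
    "f \<in> \<O> U \<Longrightarrow> g \<in> \<O> U \<Longrightarrow> f * g \<in> \<O> U"
  using subringE[OF sections_subring[OF assms]] by (auto simp: ring_of_type_algebra_def)

lemma cring_sections: "openin \<X> U \<Longrightarrow> U \<noteq> {} \<Longrightarrow> cring (subring_struct (\<O> U))"
proof -
  assume U: "openin \<X> U" "U \<noteq> {}"
  interpret L: cring "ring_of_type_algebra :: 'l ring" by (rule cring_from_type_algebra)
  show ?thesis
    using L.subcringI'[OF sections_subring[OF U]] L.subcring_iff
    by (simp add: ring_of_type_algebra_def)
qed

lemma sections_mono:
  "openin \<X> U \<Longrightarrow> openin \<X> V \<Longrightarrow> U \<noteq> {} \<Longrightarrow> U \<subseteq> V \<Longrightarrow> \<O> V \<subseteq> \<O> U"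
  using sheaf unfolding function_sheaf_def by blast

lemma stalkI: "openin \<X> U \<Longrightarrow> x \<in> U \<Longrightarrow> f \<in> F U \<Longrightarrow> f \<in> stalk \<X> F x"
  by (auto simp: stalk_def)

lemma one_in_stalk: "openin \<X> U \<Longrightarrow> x \<in> U \<Longrightarrow> 1 \<in> stalk \<X> \<O> x"
  using sections_closed(2)[of U] by (auto intro: stalkI)

lemma affine_open_openin: "affine_open \<X> \<O> U \<Longrightarrow> openin \<X> U"
  and affine_open_nonempty: "affine_open \<X> \<O> U \<Longrightarrow> U \<noteq> {}"
  by (auto simp: affine_open_def)

lemma affine_open_subset: "affine_open \<X> \<O> U \<Longrightarrow> U \<subseteq> topspace \<X>"
  using affine_open_openin openin_subset by blast

lemma affine_open_stalk:
  "affine_open \<X> \<O> U \<Longrightarrow> y \<in> U \<Longrightarrow> stalk \<X> \<O> y = frac_at \<X> \<O> U (\<O> U) y"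
  by (auto simp: affine_open_def)

text \<open>An element of the function field is a section over some open set, which meets U. At a
  common point the stalk consists of fractions of sections over U.\<close>

lemma affine_fractions:
  assumes U: "affine_open \<X> \<O> U" shows "\<exists>r\<in>\<O> U. \<exists>s\<in>\<O> U. s \<noteq> 0 \<and> f = r / s"
proof -
  note U' = affine_open_openin[OF U] affine_open_nonempty[OF U]
  obtain V where V: "openin \<X> V" "V \<noteq> {}" "f \<in> \<O> V" using function_field by blast
  then obtain z where z: "z \<in> U" "z \<in> V" using open_meet[OF U'(1) V(1) U'(2) V(2)] by blast
  then have "f \<in> frac_at \<X> \<O> U (\<O> U) z"
    using stalkI[OF V(1) z(2), of f \<O>, OF V(3)] affine_open_stalk[OF U] by simp
  then obtain r s where rs: "f = r / s" "r \<in> \<O> U" "s \<in> \<O> U" "s \<notin> point_prime \<X> \<O> U z"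
    by (auto simp: frac_at_def)
  have "0 \<in> point_prime \<X> \<O> U z"
    using sections_closed(1)[OF U'] stalkI[OF U'(1) z(1), of 0 \<O>]
    by (auto simp: point_prime_def stalk_nonunits_def)
  then have "s \<noteq> 0" using rs(4) by auto
  then show ?thesis using rs by blast
qed

lemma fraction_subring_affine: "affine_open \<X> \<O> U \<Longrightarrow> fraction_subring (\<O> U)"
  using affine_fractions[of U] sections_closed[of U] affine_open_openin[of U] affine_open_nonempty[of U]
  by unfold_locales auto

text \<open>The generating set for f = 1 already contains all primes, since prime ideals are
  proper.\<close>

lemma topspace_spec:
  assumes "openin \<X> U" "U \<noteq> {}"
  shows "topspace (spec_topology (\<O> U)) = {P. primeideal P (subring_struct (\<O> U))}"
proof -
  have "1 \<notin> P" if P: "primeideal P (subring_struct (\<O> U))" for P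
  proof
    assume "1 \<in> P"
    interpret primeideal P "subring_struct (\<O> U)" by fact
    have "P = carrier (subring_struct (\<O> U))"
      using \<open>1 \<in> P\<close> by (intro one_imp_carrier) (simp add: ring_of_type_algebra_def)
    then show False using I_notcarr by simp
  qed
  then show ?thesis
    unfolding spec_topology_def topology_generated_by_topspace using sections_closed(2)[OF assms]
    by blast
qed

section \<open>Primes, generizations and centers on one affine open\<close>

context
  fixes U assumes U: "affine_open \<X> \<O> U"
begin

lemma point_prime_homeomorphic:
  "homeomorphic_map (subtopology \<X> U) (spec_topology (\<O> U)) (point_prime \<X> \<O> U)"
  using U by (simp add: affine_open_def)

lemma topspace_affine: "topspace (subtopology \<X> U) = U"
  using affine_open_subset[OF U] by auto

lemma point_prime_inj: "inj_on (point_prime \<X> \<O> U) U"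
  using homeomorphic_imp_injective_map[OF point_prime_homeomorphic] topspace_affine by simp

lemma point_prime_image: "point_prime \<X> \<O> U ` U = {P. primeideal P (subring_struct (\<O> U))}"
  using homeomorphic_imp_surjective_map[OF point_prime_homeomorphic]
  unfolding topspace_spec[OF affine_open_openin[OF U] affine_open_nonempty[OF U]] topspace_affine .

lemma point_prime_surj:
  assumes "primeideal P (subring_struct (\<O> U))" obtains y where "y \<in> U" "point_prime \<X> \<O> U y = P"
proof -
  have "P \<in> point_prime \<X> \<O> U ` U" unfolding point_prime_image using assms by simp
  then show thesis using that by (elim imageE) simp
qed

lemma point_prime_primeideal: "y \<in> U \<Longrightarrow> primeideal (point_prime \<X> \<O> U y) (subring_struct (\<O> U))"
  using imageI[of y U "point_prime \<X> \<O> U"] unfolding point_prime_image by simp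

lemma basic_open:
  assumes "g \<in> \<O> U" shows "openin \<X> {z \<in> U. g \<notin> point_prime \<X> \<O> U z}"
proof -
  let ?D = "{P. primeideal P (subring_struct (\<O> U)) \<and> g \<notin> P}"
  have "openin (spec_topology (\<O> U)) ?D"
    unfolding spec_topology_def by (rule topology_generated_by_Basis) (use assms in blast)
  then have "openin (subtopology \<X> U) {z \<in> topspace (subtopology \<X> U). point_prime \<X> \<O> U z \<in> ?D}"
    using homeomorphic_imp_continuous_map[OF point_prime_homeomorphic]
    by (rule openin_continuous_map_preimage[rotated])
  moreover have "{z \<in> topspace (subtopology \<X> U). point_prime \<X> \<O> U z \<in> ?D} =
      {z \<in> U. g \<notin> point_prime \<X> \<O> U z}"
    using point_prime_primeideal unfolding topspace_affine by auto
  ultimately show ?thesis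
    using affine_open_openin[OF U] by (simp add: openin_open_subtopology)
qed

text \<open>The generating open sets of a spectrum are stable under passing to a smaller prime, and
  this is inherited by intersections and unions.\<close>

lemma generization_in_open:
  assumes y: "y \<in> U" and x: "x \<in> U" and le: "point_prime \<X> \<O> U y \<subseteq> point_prime \<X> \<O> U x"
    and W: "openin \<X> W" "x \<in> W"
  shows "y \<in> W"
proof -
  have spec: "P \<in> W'" if "generate_topology_on ((\<lambda>f. {P. primeideal P (subring_struct (\<O> U)) \<and> f \<notin> P}) ` \<O> U) W'"
    "primeideal P (subring_struct (\<O> U))" "P \<subseteq> Q" "Q \<in> W'" for P Q W'
    using that by (induction arbitrary: P Q) blast+
  have "openin (subtopology \<X> U) (U \<inter> W)"
    using W(1) by (simp add: openin_subtopology_Int2)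
  then have "openin (spec_topology (\<O> U)) (point_prime \<X> \<O> U ` (U \<inter> W))"
    using homeomorphic_map_openness_eq[OF point_prime_homeomorphic] by blast
  then have "point_prime \<X> \<O> U y \<in> point_prime \<X> \<O> U ` (U \<inter> W)"
    unfolding spec_topology_def openin_topology_generated_by_iff
    by (rule spec) (use point_prime_primeideal[OF y] le x W in auto)
  then obtain z where "z \<in> U \<inter> W" "point_prime \<X> \<O> U y = point_prime \<X> \<O> U z" by blast
  then show ?thesis using point_prime_inj y by (auto dest: inj_onD)
qed

text \<open>The T0 property: the basic open sets determine which functions vanish at a point, hence
  its prime.\<close>

lemma same_opens_imp_eq:
  assumes "x \<in> U" "y \<in> U" "\<And>W. openin \<X> W \<Longrightarrow> x \<in> W \<longleftrightarrow> y \<in> W" shows "x = y"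
proof -
  have "g \<in> point_prime \<X> \<O> U x \<longleftrightarrow> g \<in> point_prime \<X> \<O> U y" if "g \<in> \<O> U" for g
    using assms(3)[OF basic_open[OF that]] assms(1,2) by auto
  moreover have "point_prime \<X> \<O> U z \<subseteq> \<O> U" for z by (auto simp: point_prime_def)
  ultimately have "point_prime \<X> \<O> U x = point_prime \<X> \<O> U y" by blast
  then show ?thesis using point_prime_inj assms by (auto dest: inj_onD)
qed

text \<open>Elements of the stalk are fractions whose denominators have value 0, so they have the
  values of their numerators, and domination can be tested on sections over U.\<close>

lemma is_center_affine:
  assumes v: "real_valuation v" and y: "y \<in> U"
  shows "is_center \<X> \<O> v y \<longleftrightarrow>
    (\<forall>f\<in>\<O> U. 0 \<le> v f) \<and> point_prime \<X> \<O> U y = {f \<in> \<O> U. 0 < v f}"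
proof
  assume c: "is_center \<X> \<O> v y"
  have 1: "stalk \<X> \<O> y \<subseteq> {f. 0 \<le> v f}"
    and 2: "stalk_nonunits \<X> \<O> y = stalk \<X> \<O> y \<inter> {f. 0 < v f}"
    using c by (simp_all only: is_center_def)
  have 3: "\<O> U \<subseteq> stalk \<X> \<O> y"
    using affine_open_openin[OF U] y by (auto intro: stalkI)
  show "(\<forall>f\<in>\<O> U. 0 \<le> v f) \<and> point_prime \<X> \<O> U y = {f \<in> \<O> U. 0 < v f}"
    unfolding point_prime_def 2 using 1 3 by blast
next
  assume *: "(\<forall>f\<in>\<O> U. 0 \<le> v f) \<and> point_prime \<X> \<O> U y = {f \<in> \<O> U. 0 < v f}"
  have stalk: "stalk \<X> \<O> y = {a / b | a b. a \<in> \<O> U \<and> b \<in> \<O> U \<and> v b = 0}"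
  proof -
    have "b \<in> \<O> U \<and> b \<notin> point_prime \<X> \<O> U y \<longleftrightarrow> b \<in> \<O> U \<and> v b = 0" for b
      using * by (metis (mono_tags, lifting) mem_Collect_eq order_less_irrefl order_less_le)
    then show ?thesis
      unfolding affine_open_stalk[OF U y] frac_at_def by blast
  qed
  have val: "v (a / b) = v a" if "v b = 0" for a b
  proof -
    have "b \<noteq> 0" using that val_0[OF v] by auto
    then show ?thesis using val_div[OF v] that by simp
  qed
  have unit: "f = 0 \<or> inverse f \<notin> stalk \<X> \<O> y \<longleftrightarrow> 0 < v f" if f: "f \<in> stalk \<X> \<O> y" for f
  proof -
    obtain a b where ab: "f = a / b" "a \<in> \<O> U" "b \<in> \<O> U" "v b = 0"
      using f unfolding stalk by blast
    have "0 \<le> v f" using ab val * by simp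
    show ?thesis
    proof (cases "v f = 0")
      case True
      then have "v a = 0" using ab val by simp
      then have "inverse f \<in> stalk \<X> \<O> y" using ab unfolding stalk by auto
      moreover have "f \<noteq> 0" using True val_0[OF v] by auto
      ultimately show ?thesis using True by simp
    next
      case False
      then have "0 < v f" using \<open>0 \<le> v f\<close> by simp
      moreover have "inverse f \<notin> stalk \<X> \<O> y" if "f \<noteq> 0"
      proof
        assume "inverse f \<in> stalk \<X> \<O> y"
        then have "0 \<le> v (inverse f)" using val * unfolding stalk by auto
        moreover have "v f + v (inverse f) = 0"
          using val_mult[OF v, of f "inverse f"] that val_1[OF v] by simp
        ultimately show False using \<open>0 < v f\<close> by (metis add_pos_nonneg order_less_irrefl)
      qed
      ultimately show ?thesis by blast
    qed
  qed
  have "0 \<le> v f" if "f \<in> stalk \<X> \<O> y" for f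
    using that val * unfolding stalk by auto
  then show "is_center \<X> \<O> v y"
    unfolding is_center_def stalk_nonunits_def using unit y affine_open_subset[OF U] by blast
qed

text \<open>The functions of positive value form a prime ideal, and every prime of an affine open is
  a point.\<close>

lemma ex_center:
  assumes v: "real_valuation v" and nonneg: "\<And>f. f \<in> \<O> U \<Longrightarrow> 0 \<le> v f"
  obtains y where "y \<in> U" "is_center \<X> \<O> v y" "point_prime \<X> \<O> U y = {f \<in> \<O> U. 0 < v f}"
proof -
  note U' = affine_open_openin[OF U] affine_open_nonempty[OF U]
  let ?P = "{f \<in> \<O> U. 0 < v f}"
  interpret cring "subring_struct (\<O> U)" using U' by (rule cring_sections)
  have carr: "carrier (subring_struct (\<O> U)) = \<O> U" by simp
  have ops: "x \<otimes>\<^bsub>subring_struct (\<O> U)\<^esub> y = x * y" "x \<oplus>\<^bsub>subring_struct (\<O> U)\<^esub> y = x + y"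
    "\<zero>\<^bsub>subring_struct (\<O> U)\<^esub> = 0" for x y
    by (simp_all add: ring_of_type_algebra_def)
  have pos_mult: "0 < v (a * b)" if "0 < v a" "b \<in> \<O> U" for a b
    using that nonneg unfolding val_mult[OF v] by (simp add: add_pos_nonneg)
  have a_inv: "\<ominus>\<^bsub>subring_struct (\<O> U)\<^esub> f \<in> ?P" if f: "f \<in> ?P" for f
  proof -
    have "\<ominus>\<^bsub>subring_struct (\<O> U)\<^esub> f \<in> \<O> U" using a_inv_closed[of f] f carr by blast
    moreover have "f + \<ominus>\<^bsub>subring_struct (\<O> U)\<^esub> f = 0"
      using r_neg[of f] f unfolding carr ops by blast
    then have "\<ominus>\<^bsub>subring_struct (\<O> U)\<^esub> f = - f" by (simp add: eq_neg_iff_add_eq_0 add.commute)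
    ultimately show ?thesis using f val_minus[OF v] by simp
  qed
  have "primeideal ?P (subring_struct (\<O> U))"
  proof (rule primeidealI)
    show "ideal ?P (subring_struct (\<O> U))"
    proof (rule idealI)
      show "subgroup ?P (add_monoid (subring_struct (\<O> U)))"
      proof (rule add.subgroupI)
        show "?P \<subseteq> carrier (subring_struct (\<O> U))" by auto
        show "?P \<noteq> {}" using val_0[OF v] sections_closed(1)[OF U'] by auto
        show "\<ominus>\<^bsub>subring_struct (\<O> U)\<^esub> f \<in> ?P" if "f \<in> ?P" for f using a_inv[OF that] .
        show "f \<oplus>\<^bsub>subring_struct (\<O> U)\<^esub> g \<in> ?P" if "f \<in> ?P" "g \<in> ?P" for f g
          using that val_add[OF v, of f g] sections_closed(3)[OF U'] unfolding ops
          by (auto simp: min_def split: if_splits)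
      qed
      show "ring (subring_struct (\<O> U))" ..
      show "x \<otimes>\<^bsub>subring_struct (\<O> U)\<^esub> a \<in> ?P" "a \<otimes>\<^bsub>subring_struct (\<O> U)\<^esub> x \<in> ?P"
        if "a \<in> ?P" "x \<in> carrier (subring_struct (\<O> U))" for a x
        using that pos_mult[of a x] sections_closed(4)[OF U', of a x]
        unfolding ops carr by (auto simp: mult.commute)
    qed
    show "cring (subring_struct (\<O> U))" ..
    show "carrier (subring_struct (\<O> U)) \<noteq> ?P"
    proof
      assume "carrier (subring_struct (\<O> U)) = ?P"
      then have "1 \<in> ?P" using sections_closed(2)[OF U'] unfolding carr by (rule subst)
      then show False using val_1[OF v] by simp
    qed
    show "a \<in> ?P \<or> b \<in> ?P"
      if "a \<in> carrier (subring_struct (\<O> U))" "b \<in> carrier (subring_struct (\<O> U))"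
        "a \<otimes>\<^bsub>subring_struct (\<O> U)\<^esub> b \<in> ?P" for a b
    proof (rule ccontr)
      assume "\<not> (a \<in> ?P \<or> b \<in> ?P)"
      then have "v a = 0" "v b = 0" using that(1,2) nonneg[of a] nonneg[of b] unfolding carr by auto
      then show False using that(3) unfolding ops by (simp add: val_mult[OF v])
    qed
  qed
  then obtain y where y: "y \<in> U" "point_prime \<X> \<O> U y = ?P" by (rule point_prime_surj)
  then have "is_center \<X> \<O> v y" using is_center_affine[OF v y(1)] nonneg by blast
  then show thesis using that y by blast
qed

end

end

section \<open>Uniqueness of centers\<close>

context variety
begin

text \<open>The valuative form of separatedness. Sections over U and V generate those over the
  intersection, so v is nonnegative there and has a center in the affine intersection. Within one
  chart the prime determines the center, so x and y both agree with it.\<close>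

lemma center_unique:
  assumes v: "real_valuation v" and x: "is_center \<X> \<O> v x" and y: "is_center \<X> \<O> v y"
  shows "x = y"
proof -
  obtain U V where U: "affine_open \<X> \<O> U" "x \<in> U" and V: "affine_open \<X> \<O> V" "y \<in> V"
    using affine_cover x y unfolding is_center_def by metis
  note W = separated[OF U(1) V(1)]
  have "0 \<le> v f" if "f \<in> \<O> (U \<inter> V)" for f
  proof -
    have "f \<in> generate_ring ring_of_type_algebra (\<O> U \<union> \<O> V)" using that W by simp
    then show ?thesis
    proof (induction)
      case one
      then show ?case using val_1[OF v] by (simp add: ring_of_type_algebra_def)
    next
      case (incl h)
      then show ?case
        using is_center_affine[OF U(1) v U(2)] is_center_affine[OF V(1) v V(2)] x y by blast
    next
      case (a_inv h)
      interpret ring "ring_of_type_algebra :: 'l ring" by (rule ring_from_type_algebra)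
      have "h + \<ominus>\<^bsub>ring_of_type_algebra\<^esub> h = 0"
        using r_neg[of h] by (simp add: ring_of_type_algebra_def)
      then have "\<ominus>\<^bsub>ring_of_type_algebra\<^esub> h = - h" by (simp add: eq_neg_iff_add_eq_0 add.commute)
      then show ?case using a_inv val_minus[OF v] by simp
    next
      case (eng_add h h')
      then have "0 \<le> min (v h) (v h')" by simp
      also have "\<dots> \<le> v (h + h')" by (rule val_add[OF v])
      finally show ?case by (simp add: ring_of_type_algebra_def)
    next
      case (eng_mult h h')
      then show ?case by (simp add: ring_of_type_algebra_def val_mult[OF v])
    qed
  qed
  then obtain z where z: "z \<in> U \<inter> V" "is_center \<X> \<O> v z"
    using ex_center[OF conjunct1[OF W] v] by metis
  have eq: "x' = z" if "affine_open \<X> \<O> U'" "x' \<in> U'" "z \<in> U'" "is_center \<X> \<O> v x'" for U' x'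
  proof (rule inj_onD[OF point_prime_inj[OF that(1)]])
    show "point_prime \<X> \<O> U' x' = point_prime \<X> \<O> U' z"
      using is_center_affine[OF that(1) v that(2)] is_center_affine[OF that(1) v that(3)] z(2) that(4)
      by simp
  qed (use that in auto)
  have "x = z" "y = z"
    using eq[OF U _ x] eq[OF V _ y] z(1) by auto
  then show ?thesis by simp
qed

lemma center_eq: "real_valuation v \<Longrightarrow> is_center \<X> \<O> v x \<Longrightarrow> center \<X> \<O> v = x"
  unfolding center_def using center_unique by blast

end

text \<open>
  \<open>R\<close> is finitely generated over its subring of \<open>p\<^sup>e\<close>-th powers. Phrased as an induction principle
  for additively closed sets, this needs no indexing of the generators by words.
\<close>

lemma (in smooth_algebra) frobenius_generators:
  "\<exists>M. finite M \<and> M \<subseteq> R \<and> (\<forall>S. 0 \<in> S \<longrightarrow> (\<forall>x\<in>S. \<forall>y\<in>S. x + y \<in> S) \<longrightarrow>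
     (\<forall>r\<in>R. \<forall>m\<in>M. r ^ (p ^ e) * m \<in> S) \<longrightarrow> R \<subseteq> S)"
proof (induction e)
  case 0
  show ?case by (rule exI[of _ "{1}"]) (use R_1 in auto)
next
  case (Suc e)
  then obtain M where M: "finite M" "M \<subseteq> R"
    "\<And>S. 0 \<in> S \<Longrightarrow> (\<forall>x\<in>S. \<forall>y\<in>S. x + y \<in> S) \<Longrightarrow> (\<forall>r\<in>R. \<forall>m\<in>M. r ^ (p ^ e) * m \<in> S) \<Longrightarrow> R \<subseteq> S"
    by metis
  let ?A = "box_monomials n (p - 1)"
  \<comment> \<open>A coordinate c is a combination of generators m with p^e-th powers as
    coefficients, so its p-th power is one of the p-th powers of the m with p^(e+1)-st powers as
    coefficients.\<close>
  let ?M = "(\<lambda>(m, \<alpha>). m ^ p * w \<alpha>) ` (M \<times> ?A)"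
  have "R \<subseteq> S" if S0: "0 \<in> S" and S_add: "\<forall>x\<in>S. \<forall>y\<in>S. x + y \<in> S"
    and S: "\<forall>r\<in>R. \<forall>m\<in>?M. r ^ (p ^ Suc e) * m \<in> S" for S
  proof
    fix r assume r: "r \<in> R"
    have "c ^ p * w \<alpha> \<in> S" if c: "c \<in> R" and \<alpha>: "\<alpha> \<in> ?A" for c \<alpha>
    proof -
      \<comment> \<open>The induction hypothesis is applied to the set of admissible coordinates c,
        which is additively closed because the Frobenius is additive.\<close>
      have "R \<subseteq> {c. c ^ p * w \<alpha> \<in> S}"
      proof (rule M(3))
        show "0 \<in> {c. c ^ p * w \<alpha> \<in> S}" using S0 pos by (simp add: power_0_left)
        show "\<forall>x\<in>{c. c ^ p * w \<alpha> \<in> S}. \<forall>y\<in>{c. c ^ p * w \<alpha> \<in> S}. x + y \<in> {c. c ^ p * w \<alpha> \<in> S}"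
        proof safe
          fix x y assume "x ^ p * w \<alpha> \<in> S" "y ^ p * w \<alpha> \<in> S"
          moreover have "(x + y) ^ p = x ^ p + y ^ p"
            using prime_CHAR[OF CHAR_pos] by (intro freshmans_dream) (simp_all add: CHAR_eq p_eq)
          ultimately show "(x + y) ^ p * w \<alpha> \<in> S" using S_add by (simp add: distrib_right)
        qed
        show "\<forall>r\<in>R. \<forall>m\<in>M. r ^ (p ^ e) * m \<in> {c. c ^ p * w \<alpha> \<in> S}"
        proof (intro ballI CollectI)
          fix r m assume rm: "r \<in> R" "m \<in> M"
          then have "m ^ p * w \<alpha> \<in> ?M"
            using \<alpha> by (intro image_eqI[of _ _ "(m, \<alpha>)"]) simp_all
          then have "r ^ (p ^ Suc e) * (m ^ p * w \<alpha>) \<in> S"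
            by (rule S[THEN bspec, OF rm(1), THEN bspec])
          moreover have "(r ^ (p ^ e) * m) ^ p * w \<alpha> = r ^ (p ^ Suc e) * (m ^ p * w \<alpha>)"
            by (simp add: power_mult_distrib mult_ac flip: power_mult)
          ultimately show "(r ^ (p ^ e) * m) ^ p * w \<alpha> \<in> S" by (simp only:)
        qed
      qed
      then show ?thesis using c by (rule subsetD[THEN CollectD])
    qed
    then have summand: "\<psi> \<alpha> r ^ p * w \<alpha> \<in> S" if "\<alpha> \<in> ?A" for \<alpha>
      using that \<psi>_in_R[OF r] by (simp only:)
    have "(\<Sum>\<alpha>\<in>B. \<psi> \<alpha> r ^ p * w \<alpha>) \<in> S" if "finite B" "B \<subseteq> ?A" for B
      using that by (induction rule: finite_induct) (use S0 S_add summand in auto)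
    from this[OF finite_box_monomials order_refl] show "r \<in> S"
      by (subst dual_basis[OF r])
  qed
  moreover have "finite ?M" using M(1) finite_box_monomials by blast
  moreover have "?M \<subseteq> R"
  proof clarify
    fix m \<alpha> assume "m \<in> M" "\<alpha> \<in> ?A"
    then show "m ^ p * w \<alpha> \<in> R" using R_mult[OF R_power[of m p] w_in_R[of \<alpha>]] M(2) by (simp only: subsetD)
  qed
  ultimately show ?case by (intro exI[of _ ?M] conjI allI impI) (simp_all only:)
qed

section \<open>Log discrepancies and values of graded sequences\<close>

text \<open>A form of Fekete's lemma: up to an error of order 1 / m, the slope at m is at most the
  slope at s. A lower bound on the slopes for infinitely many m thus holds for each s.\<close>

lemma subadditive_frequently_le:
  fixes \<beta> :: "nat \<Rightarrow> real"
  assumes sub: "\<And>s t. s \<ge> 1 \<Longrightarrow> t \<ge> 1 \<Longrightarrow> \<beta> (s + t) \<le> \<beta> s + \<beta> t"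
    and nonneg: "\<And>s. s \<ge> 1 \<Longrightarrow> 0 \<le> \<beta> s"
    and lam: "0 < lam" and freq: "\<exists>\<^sub>F m in sequentially. r \<le> lam / real m * \<beta> m" and s: "s \<ge> 1"
  shows "r \<le> lam / real s * \<beta> s"
proof (rule ccontr)
  assume "\<not> r \<le> lam / real s * \<beta> s"
  then have d: "0 < r - lam / real s * \<beta> s" by simp
  define M where "M = Max (\<beta> ` {1..s})"
  have M: "\<beta> t \<le> M" if "1 \<le> t" "t \<le> s" for t
    using that by (auto simp: M_def)
  have M0: "0 \<le> M" using M[of s] nonneg[OF s] s by simp
  have bound: "\<beta> (q * s + t) \<le> real q * \<beta> s + M" if "1 \<le> t" "t \<le> s" for q t
  proof (induction q)
    case (Suc q)
    have "\<beta> (Suc q * s + t) \<le> \<beta> s + \<beta> (q * s + t)"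
      using sub[of s "q * s + t"] s that by (simp add: add.assoc)
    then show ?case using Suc by (simp add: algebra_simps)
  qed (use M that in simp)
  have le: "lam / real m * \<beta> m \<le> lam / real s * \<beta> s + lam * M / real m" if "m \<ge> 1" for m
  proof -
    \<comment> \<open>The remainder is taken between 1 and s, because \<beta> is controlled at
      positive indices only.\<close>
    define q t where "q = (m - 1) div s" and "t = (m - 1) mod s + 1"
    have m: "m = q * s + t" using that by (simp add: q_def t_def)
    have "1 \<le> t" "t \<le> s" using s by (auto simp: t_def Suc_le_eq)
    then have "\<beta> m \<le> real q * \<beta> s + M" using bound m by simp
    moreover have "real q \<le> real m / real s"
      using s m by (simp add: field_simps flip: of_nat_mult)
    ultimately have "\<beta> m \<le> real m / real s * \<beta> s + M"
      using mult_right_mono[of "real q" "real m / real s" "\<beta> s"] nonneg[OF s] by linarith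
    then have "lam / real m * \<beta> m \<le> lam / real m * (real m / real s * \<beta> s + M)"
      using lam that by (intro mult_left_mono) auto
    also have "\<dots> = lam / real s * \<beta> s + lam * M / real m" using that by (simp add: field_simps)
    finally show ?thesis .
  qed
  have "(\<lambda>m. lam * M / real m) \<longlonglongrightarrow> 0" by (rule lim_const_over_n)
  then have "\<forall>\<^sub>F m in sequentially. lam * M / real m < r - lam / real s * \<beta> s"
    using d by (rule order_tendstoD)
  then have "\<forall>\<^sub>F m in sequentially. lam / real m * \<beta> m < r"
    using eventually_ge_at_top[of 1]
  proof eventually_elim
    case (elim m)
    then show ?case using le[of m] by linarith
  qed
  then have "\<forall>\<^sub>F m in sequentially. \<not> r \<le> lam / real m * \<beta> m"
    by eventually_elim simp
  then show False using freq by (simp add: frequently_def)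
qed

section \<open>Cartier maps and bounds for the log discrepancy\<close>

context variety
begin

lemma cartier_maps_affine:
  assumes U: "affine_open \<X> \<O> U" and y: "y \<in> U" and \<psi>: "p_linear p e \<psi>" and p: "p > 0"
    and R: "\<psi> ` \<O> U \<subseteq> \<O> U"
  shows "\<psi> \<in> cartier_maps \<X> \<O> p e y"
proof -
  interpret fraction_subring "\<O> U" using U by (rule fraction_subring_affine)
  have "\<psi> f \<in> stalk \<X> \<O> y" if f: "f \<in> stalk \<X> \<O> y" for f
  proof -
    obtain a b where ab: "f = a / b" "a \<in> \<O> U" "b \<in> \<O> U" "b \<notin> point_prime \<X> \<O> U y"
      using f unfolding affine_open_stalk[OF U y] frac_at_def by blast
    have "0 \<in> point_prime \<X> \<O> U y"
      using sections_closed(1)[OF affine_open_openin[OF U] affine_open_nonempty[OF U]]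
        stalkI[OF affine_open_openin[OF U] y, of 0 \<O>]
      by (auto simp: point_prime_def stalk_nonunits_def)
    then have "b \<noteq> 0" using ab by auto
    then have "\<psi> f = \<psi> (a * b ^ (p ^ e - 1)) / b"
      unfolding ab(1) by (rule p_linear_div[OF \<psi> p])
    moreover have "\<psi> (a * b ^ (p ^ e - 1)) \<in> \<O> U"
      by (rule R[THEN subsetD, OF imageI], intro R_times R_pow ab(2,3))
    ultimately show ?thesis
      unfolding affine_open_stalk[OF U y] frac_at_def using ab by blast
  qed
  then show ?thesis using \<psi> by (auto simp: cartier_maps_def)
qed

lemma log_discrepancy_ge:
  assumes "real_valuation v" "is_center \<X> \<O> v y" "\<psi> \<in> cartier_maps \<X> \<O> p e y"
    and "e \<ge> 1" "f \<noteq> 0" "\<psi> f \<noteq> 0"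
  shows "log_disc_E p e f \<psi> v \<le> log_discrepancy \<X> \<O> p v"
proof -
  have "log_disc_E p e f \<psi> v \<le> log_disc_map p e v \<psi>"
    unfolding log_disc_map_def by (rule SUP_upper2[of "(f, 1)"]) (use assms in auto)
  also have "\<dots> \<le> log_discrepancy \<X> \<O> p v"
    unfolding log_discrepancy_def center_eq[OF assms(1,2)]
    by (rule SUP_upper2[of e], use assms in simp, rule SUP_upper) (use assms in auto)
  finally show ?thesis .
qed

text \<open>The iterates in \<open>log_disc_map\<close> are themselves Cartier maps at y, of order
  \<open>k * e\<close>, so it suffices to bound single maps.\<close>

lemma log_discrepancy_le:
  assumes v: "real_valuation v" "is_center \<X> \<O> v y"
    and le: "\<And>e \<psi> f. e \<ge> 1 \<Longrightarrow> \<psi> \<in> cartier_maps \<X> \<O> p e y \<Longrightarrow> f \<noteq> 0 \<Longrightarrow> log_disc_E p e f \<psi> v \<le> B"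
  shows "log_discrepancy \<X> \<O> p v \<le> B"
proof -
  have "\<psi> ^^ k \<in> cartier_maps \<X> \<O> p (k * e) y" if "\<psi> \<in> cartier_maps \<X> \<O> p e y" for \<psi> e k
  proof -
    have "(\<psi> ^^ k) f \<in> stalk \<X> \<O> y" if f: "f \<in> stalk \<X> \<O> y" for f
      using \<open>\<psi> \<in> _\<close> f by (induction k) (auto simp: cartier_maps_def)
    then show ?thesis
      using that p_linear_funpow[of p e \<psi> k] by (auto simp: cartier_maps_def)
  qed
  then have "log_disc_map p e v \<psi> \<le> B" if "\<psi> \<in> cartier_maps \<X> \<O> p e y" "e \<ge> 1" for e \<psi>
    unfolding log_disc_map_def using that by (intro SUP_least) (auto intro!: le)
  then show ?thesis
    unfolding log_discrepancy_def center_eq[OF v] by (intro SUP_least) auto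
qed

end

section \<open>Values of a graded sequence of ideals\<close>

locale graded_sequence = variety \<X> \<O> \<iota>
  for \<X> :: "'x topology" and \<O> :: "'x set \<Rightarrow> 'l::field set" and \<iota> :: "'k::alg_closed_field \<Rightarrow> 'l" +
  fixes \<aa> :: "nat \<Rightarrow> 'x set \<Rightarrow> 'l set"
  assumes graded: "graded_ideal_sequence \<X> \<O> \<aa>"
begin

lemma qcoh: "m \<ge> 1 \<Longrightarrow> qcoh_ideal \<X> \<O> (\<aa> m)"
  using graded by (auto simp: graded_ideal_sequence_def)

lemma ideal_subset:
  assumes "m \<ge> 1" "openin \<X> U" "U \<noteq> {}" shows "\<aa> m U \<subseteq> \<O> U"
proof -
  interpret qcoh_ideal \<X> \<O> "\<aa> m" using assms(1) by (rule qcoh)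
  interpret ideal "\<aa> m U" "subring_struct (\<O> U)" using assms(2,3) by (rule ideal_sections)
  show ?thesis using a_subset by simp
qed

lemma ideal_mono:
  assumes "m \<ge> 1" "openin \<X> U" "openin \<X> V" "U \<noteq> {}" "U \<subseteq> V" shows "\<aa> m V \<subseteq> \<aa> m U"
proof -
  interpret qcoh_ideal \<X> \<O> "\<aa> m" using assms(1) by (rule qcoh)
  show ?thesis using ideal_sheaf assms unfolding function_sheaf_def by blast
qed

lemma ideal_mult:
  assumes "s \<ge> 1" "t \<ge> 1" "openin \<X> U" "U \<noteq> {}" "f \<in> \<aa> s U" "g \<in> \<aa> t U"
  shows "f * g \<in> \<aa> (s + t) U"
proof -
  have "f \<otimes>\<^bsub>subring_struct (\<O> U)\<^esub> g \<in> ideal_prod (subring_struct (\<O> U)) (\<aa> s U) (\<aa> t U)"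
    using assms(5,6) by (rule ideal_prod.prod)
  moreover have "ideal_prod (subring_struct (\<O> U)) (\<aa> s U) (\<aa> t U) \<subseteq> \<aa> (s + t) U"
    using graded assms(1-4) unfolding graded_ideal_sequence_def by blast
  moreover have "f \<otimes>\<^bsub>subring_struct (\<O> U)\<^esub> g = f * g"
    by (simp add: ring_of_type_algebra_def)
  ultimately show ?thesis by (metis subsetD)
qed

text \<open>The given nonzero section may live away from y. Its domain meets a quasi-coherent chart
  around y, and the numerator of the section at a common point is a nonzero section over the whole
  chart.\<close>

lemma stalk_nonzero:
  assumes m: "m \<ge> 1" and y: "y \<in> topspace \<X>" obtains f where "f \<in> stalk \<X> (\<aa> m) y" "f \<noteq> 0"
proof -
  interpret qcoh_ideal \<X> \<O> "\<aa> m" using m by (rule qcoh)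
  obtain V where V: "openin \<X> V" "V \<noteq> {}" "\<aa> m V \<noteq> {0}"
    using graded m unfolding graded_ideal_sequence_def nonzero_ideal_def by blast
  interpret ideal "\<aa> m V" "subring_struct (\<O> V)" using V(1,2) by (rule ideal_sections)
  have "0 \<in> \<aa> m V" using additive_subgroup.zero_closed[OF is_additive_subgroup]
    by (simp add: ring_of_type_algebra_def)
  then obtain f where f: "f \<in> \<aa> m V" "f \<noteq> 0" using V(3) by blast
  obtain U where U: "affine_open \<X> \<O> U" "y \<in> U" "\<And>z. z \<in> U \<Longrightarrow> stalk \<X> (\<aa> m) z = frac_at \<X> \<O> U (\<aa> m U) z"
    using quasi_coherent[OF y] by blast
  obtain z where z: "z \<in> U" "z \<in> V"
    using open_meet[OF affine_open_openin[OF U(1)] V(1) affine_open_nonempty[OF U(1)] V(2)] by blast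
  have "f \<in> frac_at \<X> \<O> U (\<aa> m U) z"
    unfolding U(3)[OF z(1), symmetric] using V(1) z(2) f(1) by (rule stalkI)
  then obtain a b where "f = a / b" "a \<in> \<aa> m U" by (auto simp: frac_at_def)
  then have "a \<in> \<aa> m U" "a \<noteq> 0" using f(2) by auto
  then show thesis
    using that[of a] stalkI[OF affine_open_openin[OF U(1)] U(2), of a "\<aa> m"] by simp
qed

context
  fixes v y assumes v: "real_valuation v" and y: "is_center \<X> \<O> v y"
begin

lemma center_in_topspace: "y \<in> topspace \<X>"
  using y by (simp add: is_center_def)

lemma val_ideal_eq: "val_ideal \<X> \<O> v (\<aa> m) = (INF f\<in>stalk \<X> (\<aa> m) y. v f)"
  by (simp add: val_ideal_def center_eq[OF v y])

lemma val_ideal_le: "f \<in> stalk \<X> (\<aa> m) y \<Longrightarrow> val_ideal \<X> \<O> v (\<aa> m) \<le> v f"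
  unfolding val_ideal_eq by (rule INF_lower)

lemma val_ideal_nonneg:
  assumes "m \<ge> 1" shows "0 \<le> val_ideal \<X> \<O> v (\<aa> m)"
  unfolding val_ideal_eq
proof (rule INF_greatest)
  fix f assume "f \<in> stalk \<X> (\<aa> m) y"
  then obtain U where "openin \<X> U" "y \<in> U" "f \<in> \<aa> m U" by (auto simp: stalk_def)
  then have "f \<in> stalk \<X> \<O> y" using ideal_subset[OF assms, of U] by (auto simp: stalk_def)
  then show "0 \<le> v f" using y unfolding is_center_def by blast
qed

lemma val_ideal_real:
  assumes m: "m \<ge> 1" shows "val_ideal \<X> \<O> v (\<aa> m) = ereal (real_of_ereal (val_ideal \<X> \<O> v (\<aa> m)))"
proof -
  obtain f where f: "f \<in> stalk \<X> (\<aa> m) y" "f \<noteq> 0" using stalk_nonzero[OF m center_in_topspace] .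
  obtain r where "v f = ereal r" using val_real[OF v f(2)] .
  then have "val_ideal \<X> \<O> v (\<aa> m) \<le> ereal r" using val_ideal_le[OF f(1)] by simp
  then show ?thesis
    using val_ideal_nonneg[OF m] by (cases "val_ideal \<X> \<O> v (\<aa> m)") auto
qed

lemma val_ideal_subadditive:
  assumes st: "s \<ge> 1" "t \<ge> 1"
  shows "val_ideal \<X> \<O> v (\<aa> (s + t)) \<le> val_ideal \<X> \<O> v (\<aa> s) + val_ideal \<X> \<O> v (\<aa> t)"
proof -
  have le: "val_ideal \<X> \<O> v (\<aa> (s + t)) \<le> v f + v g"
    if f: "f \<in> stalk \<X> (\<aa> s) y" and g: "g \<in> stalk \<X> (\<aa> t) y" for f g
  proof -
    obtain U where U: "openin \<X> U" "y \<in> U" "f \<in> \<aa> s U" using f by (auto simp: stalk_def)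
    obtain V where V: "openin \<X> V" "y \<in> V" "g \<in> \<aa> t V" using g by (auto simp: stalk_def)
    have UV: "openin \<X> (U \<inter> V)" "y \<in> U \<inter> V" using U V by auto
    then have ne: "U \<inter> V \<noteq> {}" by blast
    have "f * g \<in> \<aa> (s + t) (U \<inter> V)"
      using ideal_mono[OF st(1) UV(1) U(1) ne] ideal_mono[OF st(2) UV(1) V(1) ne] U(3) V(3)
      by (intro ideal_mult st UV ne) auto
    then have "f * g \<in> stalk \<X> (\<aa> (s + t)) y" by (rule stalkI[OF UV])
    then show ?thesis using val_ideal_le val_mult[OF v] by metis
  qed
  have fin: "\<bar>val_ideal \<X> \<O> v (\<aa> m)\<bar> \<noteq> \<infinity>" if "m \<ge> 1" for m
    by (subst val_ideal_real[OF that]) simp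
  obtain bs where bs: "val_ideal \<X> \<O> v (\<aa> s) = ereal bs" using val_ideal_real[OF st(1)] ..
  obtain bt where bt: "val_ideal \<X> \<O> v (\<aa> t) = ereal bt" using val_ideal_real[OF st(2)] ..
  show ?thesis
  \<comment> \<open>\<open>val_ideal\<close> is an infimum, so f and g are chosen within e / 2 of
    it.\<close>
  proof (rule ereal_le_epsilon2)
    fix e :: real assume e: "0 < e"
    then have e2: "0 < ereal (e / 2)" by simp
    obtain f where f: "f \<in> stalk \<X> (\<aa> s) y" "v f < val_ideal \<X> \<O> v (\<aa> s) + ereal (e / 2)"
      using ereal_between(2)[OF fin[OF st(1)] e2] unfolding val_ideal_eq[of s] INF_less_iff by blast
    obtain g where g: "g \<in> stalk \<X> (\<aa> t) y" "v g < val_ideal \<X> \<O> v (\<aa> t) + ereal (e / 2)"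
      using ereal_between(2)[OF fin[OF st(2)] e2] unfolding val_ideal_eq[of t] INF_less_iff by blast
    have "val_ideal \<X> \<O> v (\<aa> (s + t)) \<le> v f + v g" using f(1) g(1) by (rule le)
    also have "\<dots> \<le> (val_ideal \<X> \<O> v (\<aa> s) + ereal (e / 2)) + (val_ideal \<X> \<O> v (\<aa> t) + ereal (e / 2))"
      using f g by (intro add_mono) auto
    also have "\<dots> = val_ideal \<X> \<O> v (\<aa> s) + val_ideal \<X> \<O> v (\<aa> t) + ereal e"
      by (simp add: bs bt)
    finally show "val_ideal \<X> \<O> v (\<aa> (s + t)) \<le>
        val_ideal \<X> \<O> v (\<aa> s) + val_ideal \<X> \<O> v (\<aa> t) + ereal e" .
  qed
qed

end

end

section \<open>Compactness\<close>

text \<open>Tychonoff's theorem; the topology on functions is that of pointwise convergence.\<close>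

lemma compact_bounded_functions: "compact {u :: 'a \<Rightarrow> real. \<forall>f. \<bar>u f\<bar> \<le> K f}"
proof -
  have "compactin (product_topology (\<lambda>_::'a. euclidean :: real topology) UNIV) (PiE UNIV (\<lambda>f. {- K f..K f}))"
    by (simp add: compactin_PiE)
  moreover have "PiE UNIV (\<lambda>f. {- K f..K f}) = {u. \<forall>f. \<bar>u f\<bar> \<le> K f}"
    by (auto simp: PiE_UNIV_domain abs_le_iff minus_le_iff)
  ultimately show ?thesis
    by (simp add: euclidean_product_topology)
qed

text \<open>The index set will be the neighbourhoods of a point, which need not have a countable
  base; hence a directed family and not a sequence.\<close>

lemma directed_compact_Inter:
  fixes S :: "'i \<Rightarrow> 'a::topological_space set"
  assumes "compact T" and closed: "\<And>V. V \<in> I \<Longrightarrow> closed (S V)"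
    and nonempty: "\<And>V. V \<in> I \<Longrightarrow> S V \<noteq> {}" and sub: "\<And>V. V \<in> I \<Longrightarrow> S V \<subseteq> T"
    and directed: "\<And>V V'. V \<in> I \<Longrightarrow> V' \<in> I \<Longrightarrow> \<exists>W\<in>I. S W \<subseteq> S V \<inter> S V'"
    and "I \<noteq> {}"
  obtains u where "\<And>V. V \<in> I \<Longrightarrow> u \<in> S V"
proof -
  have lower: "\<exists>W\<in>I. S W \<subseteq> \<Inter>(S ` F)" if "finite F" "F \<subseteq> I" for F
    using that
  proof (induction F rule: finite_induct)
    case empty
    then show ?case using \<open>I \<noteq> {}\<close> by auto
  next
    case (insert V F)
    then obtain W where "W \<in> I" "S W \<subseteq> \<Inter>(S ` F)" by auto
    moreover obtain W' where "W' \<in> I" "S W' \<subseteq> S V \<inter> S W"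
      using directed[of V W] insert.prems \<open>W \<in> I\<close> by auto
    ultimately show ?case by (intro bexI[of _ W']) auto
  qed
  have "T \<inter> (\<Inter>V\<in>I. S V) \<noteq> {}"
    using \<open>compact T\<close> closed
  proof (rule compact_imp_fip_image)
    fix F assume "finite F" "F \<subseteq> I"
    then obtain W where "W \<in> I" "S W \<subseteq> \<Inter>(S ` F)" using lower by blast
    then show "T \<inter> (\<Inter>V\<in>F. S V) \<noteq> {}" using nonempty[of W] sub[of W] by blast
  qed
  then obtain u where "u \<in> \<Inter>(S ` I)" by blast
  then show thesis using that[of u] by simp
qed

lemma standard_smooth_algebra:
  fixes \<iota> :: "'k::alg_closed_field \<Rightarrow> 'l::field"
  assumes "standard_smooth \<iota> R" "base_field_hom \<iota>" "CHAR('k) = p" "p > 0"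
  obtains n c a f where "smooth_algebra \<iota> p n c a f" "R = mpoly_eval \<iota> a ` mpolys n"
proof -
  interpret base_field_hom \<iota> by fact
  obtain n c a f where *: "\<forall>i<c. f i \<in> mpolys n" "R = mpoly_eval \<iota> a ` mpolys n"
    "\<forall>F\<in>mpolys n. mpoly_eval \<iota> a F = 0 \<longleftrightarrow>
        (\<exists>g. (\<forall>i<c. g i \<in> mpolys n) \<and> F = (\<Sum>i<c. g i * f i))"
    "det (jacobian \<iota> a f c) \<noteq> 0" "inverse (det (jacobian \<iota> a f c)) \<in> R"
    using assms(1) unfolding standard_smooth_def by (elim exE conjE) (rule that)
  have "smooth_algebra \<iota> p n c a f"
    by unfold_locales (use * assms(3,4) in simp_all)
  then show thesis using that *(2) by blast
qed

section \<open>Limits of normalized valuations\<close>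

locale graded_chart = graded_sequence \<X> \<O> \<iota> \<aa>
  for \<X> :: "'x topology" and \<O> :: "'x set \<Rightarrow> 'l::field set" and \<iota> :: "'k::alg_closed_field \<Rightarrow> 'l"
    and \<aa> :: "nat \<Rightarrow> 'x set \<Rightarrow> 'l set" +
  fixes p :: nat and U :: "'x set"
  assumes char: "CHAR('k) = p" and p_pos: "p > 0"
    and U: "affine_open \<X> \<O> U" and smooth_U: "standard_smooth \<iota> (\<O> U)"
begin

abbreviation "A \<equiv> log_discrepancy \<X> \<O> p"

lemma base_field_hom: "base_field_hom \<iota>"
  by unfold_locales (rule base_hom)+

lemma p_ge_2: "p \<ge> 2"
  using prime_CHAR_semidom[where ?'a = 'k] char p_pos prime_ge_2_nat by metis

lemma power_p_gt_1: "e \<ge> 1 \<Longrightarrow> 1 < real p ^ e"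
  using p_ge_2 by (intro one_less_power) auto

lemma U_sections:
  "0 \<in> \<O> U" "1 \<in> \<O> U" "f \<in> \<O> U \<Longrightarrow> g \<in> \<O> U \<Longrightarrow> f + g \<in> \<O> U" "f \<in> \<O> U \<Longrightarrow> g \<in> \<O> U \<Longrightarrow> f * g \<in> \<O> U"
  using sections_closed[OF affine_open_openin[OF U] affine_open_nonempty[OF U]] by blast+

text \<open>If \<Psi> has order k and \<open>\<Psi> g\<close> has value 0, then E(g, \<Psi>, v) is
  v(g) / (p^k - 1), which is at most A(v).\<close>

lemma val_le_log_discrepancy:
  assumes g: "g \<in> \<O> U" "g \<noteq> 0"
  obtains N where "0 \<le> N" "\<And>v y. real_valuation v \<Longrightarrow> is_center \<X> \<O> v y \<Longrightarrow> y \<in> U \<Longrightarrow> v g \<le> ereal N * A v"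
proof -
  obtain n c a f where sm: "smooth_algebra \<iota> p n c a f" "\<O> U = mpoly_eval \<iota> a ` mpolys n"
    using standard_smooth_algebra[OF smooth_U base_field_hom char p_pos] .
  interpret smooth_algebra \<iota> p n c a f by fact
  obtain N where N: "\<And>v. real_valuation v \<Longrightarrow> (\<And>r. r \<in> \<O> U \<Longrightarrow> 0 \<le> v r) \<Longrightarrow>
    \<exists>k \<Psi>. 1 \<le> k \<and> k \<le> N \<and> p_linear p k \<Psi> \<and> \<Psi> ` \<O> U \<subseteq> \<O> U \<and> v (\<Psi> g) = 0"
    using value_zero_iterate[of g] affine_fractions[OF U] g unfolding sm(2) by blast
  show thesis
  \<comment> \<open>Since k <= N, this constant exceeds p^k - 1 whatever v is.\<close>
  proof (rule that[of "real p ^ N"])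
    show "0 \<le> real p ^ N" by simp
    fix v y assume v: "real_valuation v" and y: "is_center \<X> \<O> v y" "y \<in> U"
    have nonneg: "0 \<le> v r" if "r \<in> \<O> U" for r
      using is_center_affine[OF U v y(2)] y(1) that by blast
    obtain k \<Psi> where k: "1 \<le> k" "k \<le> N" "p_linear p k \<Psi>" "\<Psi> ` \<O> U \<subseteq> \<O> U" "v (\<Psi> g) = 0"
      using N[OF v nonneg] by blast
    have "\<Psi> g \<noteq> 0" using k(5) val_0[OF v] by auto
    then have "log_disc_E p k g \<Psi> v \<le> A v"
      using k g by (intro log_discrepancy_ge[OF v y(1)] cartier_maps_affine[OF U y(2)] p_pos)
    then have le: "v g / ereal (real p ^ k - 1) \<le> A v"
      by (simp add: log_disc_E_def k(5))
    obtain b where b: "v g = ereal b" using val_real[OF v g(2)] .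
    have "0 \<le> b" using nonneg[OF g(1)] by (simp add: b)
    show "v g \<le> ereal (real p ^ N) * A v"
    proof (cases "A v")
      case (real r)
      have "b \<le> (real p ^ k - 1) * r"
        using le power_p_gt_1[OF k(1)] by (simp add: b real pos_divide_le_eq mult.commute)
      moreover have "0 \<le> r"
        using \<open>b \<le> _\<close> \<open>0 \<le> b\<close> power_p_gt_1[OF k(1)] by (smt (verit) mult_pos_neg)
      moreover have "real p ^ k - 1 \<le> real p ^ N"
      proof -
        have "real p ^ k \<le> real p ^ N" using k(2) p_ge_2 by (intro power_increasing) auto
        then show ?thesis by linarith
      qed
      ultimately have "b \<le> real p ^ N * r" by (meson mult_right_mono order_trans)
      then show ?thesis by (simp add: b real)
    next
      case PInf
      then show ?thesis using p_pos by (simp add: b)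
    next
      case MInf
      then show ?thesis using le power_p_gt_1[OF k(1)] by (auto simp: b split: if_splits)
    qed
  qed
qed

text \<open>The function field consists of fractions of \<open>\<O> U\<close>, so a nontrivial
  valuation is positive on some nonzero section, and its value is bounded by a multiple of
  A(v).\<close>

lemma log_discrepancy_pos:
  assumes v: "real_valuation v" "is_center \<X> \<O> v y" "y \<in> U" "v \<noteq> trivial_valuation"
  shows "0 < A v"
proof -
  have nonneg: "0 \<le> v r" if "r \<in> \<O> U" for r
    using is_center_affine[OF U v(1,3)] v(2) that by blast
  have "\<exists>g\<in>\<O> U. g \<noteq> 0 \<and> 0 < v g"
  proof (rule ccontr)
    assume none: "\<not> (\<exists>g\<in>\<O> U. g \<noteq> 0 \<and> 0 < v g)"
    have zero: "v g = 0" if "g \<in> \<O> U" "g \<noteq> 0" for g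
      using that nonneg[OF that(1)] none by (metis order_le_less)
    have "v f = trivial_valuation f" for f
    proof -
      obtain r s where rs: "r \<in> \<O> U" "s \<in> \<O> U" "s \<noteq> 0" "f = r / s"
        using affine_fractions[OF U] by blast
      then show ?thesis
        using zero[of r] zero[of s] val_div[OF v(1) rs(3)] val_0[OF v(1)]
        by (cases "r = 0") (auto simp: trivial_valuation_def)
    qed
    then show False using v(4) by blast
  qed
  then obtain g where g: "g \<in> \<O> U" "g \<noteq> 0" "0 < v g" by blast
  obtain N where N: "0 \<le> N" "\<And>v y. real_valuation v \<Longrightarrow> is_center \<X> \<O> v y \<Longrightarrow> y \<in> U \<Longrightarrow> v g \<le> ereal N * A v"
    by (rule val_le_log_discrepancy[OF g(1,2)], rule that)
  have "0 < ereal N * A v" using g(3) N(2)[OF v(1-3)] by (rule order.strict_trans2)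
  then show ?thesis
    using N(1) by (auto simp: ereal_zero_less_0_iff)
qed

text \<open>The condition on a section f depends only on v(f), which is at least v(1) = 0 at centers
  in its domain. With 1, the sections over all smaller open sets would satisfy it too, and the
  stalks at x would agree.\<close>

lemma multiplier_ideal_one_notin:
  assumes x: "x \<in> ideal_locus \<X> \<O> (multiplier_ideal \<X> \<O> p \<aa> lam)" and V: "openin \<X> V" "x \<in> V"
  shows "1 \<notin> multiplier_ideal \<X> \<O> p \<aa> lam V"
proof
  let ?J = "multiplier_ideal \<X> \<O> p \<aa> lam"
  assume one: "1 \<in> ?J V"
  have "stalk \<X> ?J x = stalk \<X> \<O> x"
  proof
    show "stalk \<X> ?J x \<subseteq> stalk \<X> \<O> x" by (auto simp: stalk_def multiplier_ideal_def)
    show "stalk \<X> \<O> x \<subseteq> stalk \<X> ?J x"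
    proof
      fix f assume "f \<in> stalk \<X> \<O> x"
      then obtain W where W: "openin \<X> W" "x \<in> W" "f \<in> \<O> W" by (auto simp: stalk_def)
      let ?W = "V \<inter> W"
      have W': "openin \<X> ?W" "x \<in> ?W" using V W by auto
      then have "f \<in> \<O> ?W" using sections_mono[of ?W W] W by blast
      moreover have "\<forall>\<^sub>F m in sequentially.
          v f + A v - ereal (lam / real m) * val_ideal \<X> \<O> v (\<aa> m) > 0"
        if v: "v \<in> Val_star \<X> \<O> ?W" for v
      proof -
        have v_val: "real_valuation v" using v by (simp add: Val_star_def Val_def)
        have "v \<in> Val_star \<X> \<O> V" using v by (auto simp: Val_star_def Val_def)
        then have ev: "\<forall>\<^sub>F m in sequentially.
            v 1 + A v - ereal (lam / real m) * val_ideal \<X> \<O> v (\<aa> m) > 0"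
          using one by (auto simp: multiplier_ideal_def)
        have "v 1 \<le> v f"
        proof -
          obtain y where "y \<in> ?W" "is_center \<X> \<O> v y" using v by (auto simp: Val_star_def Val_def)
          then show ?thesis
            using stalkI[OF W'(1), of y f \<O>] \<open>f \<in> \<O> ?W\<close> unfolding is_center_def val_1[OF v_val] by blast
        qed
        then have le: "v 1 + A v - c \<le> v f + A v - c" for c
          by (intro ereal_minus_mono add_mono order_refl)
        show ?thesis
          by (rule eventually_mono[OF ev order.strict_trans2[OF _ le]])
      qed
      ultimately have "f \<in> ?J ?W" by (simp add: multiplier_ideal_def)
      then show "f \<in> stalk \<X> ?J x" using W' by (intro stalkI)
    qed
  qed
  then show False using x by (simp add: ideal_locus_def)
qed

text \<open>The bound on A(v) keeps 1 out of the sections over every open set that contains y. The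
  point z ranges over the specializations of y, so the whole closure of y is covered.\<close>

lemma computing_valuation_in_locus:
  assumes v: "real_valuation v" "v \<noteq> trivial_valuation" "is_center \<X> \<O> v y" "y \<in> U"
    and le: "\<And>m. m \<ge> 1 \<Longrightarrow> A v \<le> ereal (lam / real m) * val_ideal \<X> \<O> v (\<aa> m)"
    and z: "z \<in> topspace \<X>" "\<And>V. openin \<X> V \<Longrightarrow> z \<in> V \<Longrightarrow> y \<in> V"
  shows "z \<in> ideal_locus \<X> \<O> (multiplier_ideal \<X> \<O> p \<aa> lam)"
proof -
  let ?J = "multiplier_ideal \<X> \<O> p \<aa> lam"
  have "1 \<notin> ?J V" if V: "openin \<X> V" "z \<in> V" for V
  proof
    assume "1 \<in> ?J V"
    moreover have "v \<in> Val_star \<X> \<O> V"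
      using v z(2)[OF V] by (auto simp: Val_star_def Val_def)
    ultimately have "\<forall>\<^sub>F m in sequentially.
        v 1 + A v - ereal (lam / real m) * val_ideal \<X> \<O> v (\<aa> m) > 0"
      by (auto simp: multiplier_ideal_def)
    then have "\<forall>\<^sub>F m in sequentially. False"
      using eventually_ge_at_top[of 1]
    proof eventually_elim
      case (elim m)
      then have "0 < A v - ereal (lam / real m) * val_ideal \<X> \<O> v (\<aa> m)"
        by (simp add: val_1[OF v(1)])
      moreover obtain b where b: "val_ideal \<X> \<O> v (\<aa> m) = ereal b"
        using val_ideal_real[OF v(1,3) elim(2)] ..
      ultimately show False
        using le[OF elim(2)] by (cases "A v") auto
    qed
    then show False by simp
  qed
  then have "1 \<notin> stalk \<X> ?J z" by (auto simp: stalk_def)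
  moreover have "1 \<in> stalk \<X> \<O> z" using z(1) by (intro one_in_stalk[of "topspace \<X>"]) auto
  ultimately show ?thesis using z(1) unfolding ideal_locus_def by (metis (mono_tags, lifting) mem_Collect_eq)
qed

text \<open>The absence of 1 over V yields a valuation violating the strict inequality for
  infinitely many m, and \<open>subadditive_frequently_le\<close> gives all m. A single such m
  already makes A(v) finite, and forces \<open>lam\<close> to be positive because A(v) > 0 and
  v(a_m) >= 0.\<close>

lemma locus_valuation:
  assumes x: "x \<in> ideal_locus \<X> \<O> (multiplier_ideal \<X> \<O> p \<aa> lam)" and V: "openin \<X> V" "x \<in> V" "V \<subseteq> U"
  obtains v y r where "real_valuation v" "is_center \<X> \<O> v y" "y \<in> V" "A v = ereal r" "0 < r" "0 < lam"
    "\<And>m. m \<ge> 1 \<Longrightarrow> r \<le> lam / real m * real_of_ereal (val_ideal \<X> \<O> v (\<aa> m))"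
proof -
  have "1 \<in> \<O> V" using sections_closed(2)[of V] V by blast
  then obtain v where v: "v \<in> Val_star \<X> \<O> V" and freq: "\<exists>\<^sub>F m in sequentially.
      \<not> v 1 + A v - ereal (lam / real m) * val_ideal \<X> \<O> v (\<aa> m) > 0"
    using multiplier_ideal_one_notin[OF x V(1,2)] by (auto simp: multiplier_ideal_def not_eventually)
  obtain y where y: "y \<in> V" "is_center \<X> \<O> v y" and val: "real_valuation v" "v \<noteq> trivial_valuation"
    using v by (auto simp: Val_star_def Val_def)
  define \<beta> where "\<beta> m = real_of_ereal (val_ideal \<X> \<O> v (\<aa> m))" for m
  have \<beta>: "val_ideal \<X> \<O> v (\<aa> m) = ereal (\<beta> m)" if "m \<ge> 1" for m
    unfolding \<beta>_def using val(1) y(2) that by (rule val_ideal_real)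
  have \<beta>_nonneg: "0 \<le> \<beta> m" if "m \<ge> 1" for m
    using val_ideal_nonneg[OF val(1) y(2) that] by (simp add: \<beta>[OF that])
  have pos: "0 < A v" using val y V(3) by (intro log_discrepancy_pos) auto
  have freq': "\<exists>\<^sub>F m in sequentially. m \<ge> 1 \<and> A v \<le> ereal (lam / real m * \<beta> m)"
    using frequently_eventually_frequently[OF freq eventually_ge_at_top[of 1]]
  proof (rule frequently_elim1)
    fix m assume m: "\<not> v 1 + A v - ereal (lam / real m) * val_ideal \<X> \<O> v (\<aa> m) > 0 \<and> 1 \<le> m"
    then have "\<not> 0 < A v - ereal (lam / real m * \<beta> m)"
      using \<beta>[of m] by (simp add: val_1[OF val(1)])
    then show "m \<ge> 1 \<and> A v \<le> ereal (lam / real m * \<beta> m)"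
      using m by (cases "A v") auto
  qed
  then obtain m where m: "m \<ge> 1" "A v \<le> ereal (lam / real m * \<beta> m)"
    by (auto dest: frequently_ex)
  obtain r where r: "A v = ereal r" using m(2) pos by (cases "A v") auto
  then have "0 < r" using pos by simp
  have "0 < lam"
  proof (rule ccontr)
    assume "\<not> 0 < lam"
    then have "lam / real m * \<beta> m \<le> 0"
      using \<beta>_nonneg[OF m(1)] by (simp add: mult_nonpos_nonneg divide_nonpos_nonneg)
    then show False using m(2) r \<open>0 < r\<close> by simp
  qed
  have "r \<le> lam / real s * \<beta> s" if "s \<ge> 1" for s
  proof (rule subadditive_frequently_le[OF _ \<beta>_nonneg \<open>0 < lam\<close> _ that])
    show "\<beta> (s + t) \<le> \<beta> s + \<beta> t" if "s \<ge> 1" "t \<ge> 1" for s t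
      using val_ideal_subadditive[OF val(1) y(2) that] that by (simp add: \<beta>)
    show "\<exists>\<^sub>F m in sequentially. r \<le> lam / real m * \<beta> m"
      using freq' by (rule frequently_elim1) (simp add: r)
  qed
  then show thesis
    using that val y r \<open>0 < r\<close> \<open>0 < lam\<close> unfolding \<beta>_def by blast
qed

end

context graded_chart
begin

text \<open>
  The conditions that the valuations centered in \<open>V\<close> with log discrepancy \<open>1\<close> satisfy, each of them
  closed for pointwise convergence; the value at \<open>0\<close> plays no role. The log discrepancy itself need
  not be continuous.
\<close>

definition normalized :: "real \<Rightarrow> ('l \<Rightarrow> real) \<Rightarrow> 'x set \<Rightarrow> ('l \<Rightarrow> real) set" where
  "normalized lam K V = {u.
     (\<forall>f. \<bar>u f\<bar> \<le> K f) \<and>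
     (\<forall>f g. f \<noteq> 0 \<longrightarrow> g \<noteq> 0 \<longrightarrow> u (f * g) = u f + u g) \<and>
     (\<forall>f g. f \<noteq> 0 \<longrightarrow> g \<noteq> 0 \<longrightarrow> f + g \<noteq> 0 \<longrightarrow> min (u f) (u g) \<le> u (f + g)) \<and>
     (\<forall>f. f \<in> \<O> U \<longrightarrow> f \<noteq> 0 \<longrightarrow> 0 \<le> u f) \<and>
     (\<forall>e \<psi> f. e \<ge> 1 \<longrightarrow> p_linear p e \<psi> \<longrightarrow> \<psi> ` \<O> U \<subseteq> \<O> U \<longrightarrow> f \<noteq> 0 \<longrightarrow> \<psi> f \<noteq> 0 \<longrightarrow>
        u f - real p ^ e * u (\<psi> f) \<le> real p ^ e - 1) \<and>
     (\<forall>m W f. m \<ge> 1 \<longrightarrow> openin \<X> W \<longrightarrow> V \<subseteq> W \<longrightarrow> f \<in> \<aa> m W \<longrightarrow> f \<noteq> 0 \<longrightarrow> 1 \<le> lam / real m * u f) \<and>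
     (\<forall>g. g \<in> \<O> U \<longrightarrow> V \<subseteq> {z \<in> U. g \<notin> point_prime \<X> \<O> U z} \<longrightarrow> g \<noteq> 0 \<longrightarrow> u g = 0)}"

lemma normalizedD:
  assumes "u \<in> normalized lam K V"
  shows "\<bar>u f\<bar> \<le> K f" "f \<noteq> 0 \<Longrightarrow> g \<noteq> 0 \<Longrightarrow> u (f * g) = u f + u g"
    "f \<noteq> 0 \<Longrightarrow> g \<noteq> 0 \<Longrightarrow> f + g \<noteq> 0 \<Longrightarrow> min (u f) (u g) \<le> u (f + g)"
    "f \<in> \<O> U \<Longrightarrow> f \<noteq> 0 \<Longrightarrow> 0 \<le> u f"
    "e \<ge> 1 \<Longrightarrow> p_linear p e \<psi> \<Longrightarrow> \<psi> ` \<O> U \<subseteq> \<O> U \<Longrightarrow> f \<noteq> 0 \<Longrightarrow> \<psi> f \<noteq> 0 \<Longrightarrow>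
      u f - real p ^ e * u (\<psi> f) \<le> real p ^ e - 1"
    "m \<ge> 1 \<Longrightarrow> openin \<X> W \<Longrightarrow> V \<subseteq> W \<Longrightarrow> f \<in> \<aa> m W \<Longrightarrow> f \<noteq> 0 \<Longrightarrow> 1 \<le> lam / real m * u f"
    "g \<in> \<O> U \<Longrightarrow> V \<subseteq> {z \<in> U. g \<notin> point_prime \<X> \<O> U z} \<Longrightarrow> g \<noteq> 0 \<Longrightarrow> u g = 0"
  using assms unfolding normalized_def mem_Collect_eq by (elim conjE, simp)+

text \<open>No premise depends on u, and the conclusions are equalities and weak inequalities
  between finitely many coordinates of u.\<close>

lemma closed_normalized: "closed (normalized lam K V)"
proof -
  have coord: "continuous_on UNIV (\<lambda>u :: 'l \<Rightarrow> real. u f)" for f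
    by (rule continuous_on_product_coordinates)
  show ?thesis
    unfolding normalized_def
    by (intro closed_Collect_conj closed_Collect_all closed_Collect_imp open_Collect_const
        closed_Collect_le closed_Collect_eq continuous_on_rabs continuous_on_min continuous_on_diff
        continuous_on_mult continuous_on_add continuous_on_const coord)
qed

lemma normalized_mono: "V' \<subseteq> V \<Longrightarrow> normalized lam K V' \<subseteq> normalized lam K V"
proof
  fix u assume V: "V' \<subseteq> V" and u: "u \<in> normalized lam K V'"
  note * = normalizedD[OF u]
  show "u \<in> normalized lam K V"
    unfolding normalized_def mem_Collect_eq
  proof (intro conjI allI impI)
    show "1 \<le> lam / real m * u f"
      if "m \<ge> 1" "openin \<X> W" "V \<subseteq> W" "f \<in> \<aa> m W" "f \<noteq> 0" for m W f
      using *(6)[OF that(1,2) _ that(4,5)] V that(3) by blast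
    show "u g = 0" if "g \<in> \<O> U" "V \<subseteq> {z \<in> U. g \<notin> point_prime \<X> \<O> U z}" "g \<noteq> 0" for g
      using *(7)[OF that(1) _ that(3)] V that(2) by blast
  qed (fact *(1-5))+
qed

lemma value_bound:
  obtains K :: "'l \<Rightarrow> real" where "\<And>f. 0 \<le> K f"
    "\<And>f v y r. f \<noteq> 0 \<Longrightarrow> real_valuation v \<Longrightarrow> is_center \<X> \<O> v y \<Longrightarrow> y \<in> U \<Longrightarrow> A v = ereal r \<Longrightarrow>
       \<bar>real_of_ereal (v f)\<bar> \<le> K f * r"
proof -
  have "\<exists>N. 0 \<le> N \<and> (g \<in> \<O> U \<longrightarrow> g \<noteq> 0 \<longrightarrow>
      (\<forall>v y. real_valuation v \<longrightarrow> is_center \<X> \<O> v y \<longrightarrow> y \<in> U \<longrightarrow> v g \<le> ereal N * A v))" for g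
  proof (cases "g \<in> \<O> U \<and> g \<noteq> 0")
    case True
    then show ?thesis by (elim conjE, rule_tac val_le_log_discrepancy) auto
  qed auto
  then obtain N where N0: "\<And>g. 0 \<le> N g" and N: "\<And>g v y. g \<in> \<O> U \<Longrightarrow> g \<noteq> 0 \<Longrightarrow>
      real_valuation v \<Longrightarrow> is_center \<X> \<O> v y \<Longrightarrow> y \<in> U \<Longrightarrow> v g \<le> ereal (N g) * A v"
    by metis
  have "\<exists>r s. r \<in> \<O> U \<and> s \<in> \<O> U \<and> s \<noteq> 0 \<and> f = r / s" for f
    using affine_fractions[OF U] by blast
  then obtain num den where nd: "\<And>f. num f \<in> \<O> U" "\<And>f. den f \<in> \<O> U" "\<And>f. den f \<noteq> 0"
    "\<And>f. f = num f / den f"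
    by metis
  show thesis
  \<comment> \<open>The values of numerator and denominator both lie between 0 and their bounds, so
    the sum of the bounds controls the difference.\<close>
  proof (rule that[of "\<lambda>f. N (num f) + N (den f)"])
    show "0 \<le> N (num f) + N (den f)" for f using N0 by (simp add: add_nonneg_nonneg)
    fix f :: 'l and v y r
    assume f: "f \<noteq> 0" and v: "real_valuation v" "is_center \<X> \<O> v y" "y \<in> U" and r: "A v = ereal r"
    have num: "num f \<noteq> 0" using f nd(4)[of f] by auto
    have bd: "\<exists>b. v g = ereal b \<and> 0 \<le> b \<and> b \<le> N g * r" if g: "g \<in> \<O> U" "g \<noteq> 0" for g
    proof -
      obtain b where b: "v g = ereal b" using val_real[OF v(1) g(2)] .
      have "0 \<le> v g" using is_center_affine[OF U v(1,3)] v(2) g(1) by blast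
      then show ?thesis using N[OF g v] by (simp add: b r)
    qed
    obtain b where b: "v (num f) = ereal b" "0 \<le> b" "b \<le> N (num f) * r" using bd[OF nd(1) num] by blast
    obtain c where c: "v (den f) = ereal c" "0 \<le> c" "c \<le> N (den f) * r" using bd[OF nd(2,3)] by blast
    have "v f = v (num f) - v (den f)"
      using val_div[OF v(1) nd(3), of "num f" f] nd(4)[of f] by simp
    then have "v f = ereal (b - c)" by (simp add: b c)
    then show "\<bar>real_of_ereal (v f)\<bar> \<le> (N (num f) + N (den f)) * r"
      using b c by (simp add: distrib_right)
  qed
qed

lemma normalized_nonempty:
  assumes K: "\<And>f. 0 \<le> K f" "\<And>f v y r. f \<noteq> 0 \<Longrightarrow> real_valuation v \<Longrightarrow> is_center \<X> \<O> v y \<Longrightarrow> y \<in> U \<Longrightarrow>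
      A v = ereal r \<Longrightarrow> \<bar>real_of_ereal (v f)\<bar> \<le> K f * r"
    and x: "x \<in> ideal_locus \<X> \<O> (multiplier_ideal \<X> \<O> p \<aa> lam)"
    and V: "openin \<X> V" "x \<in> V" "V \<subseteq> U"
  shows "normalized lam K V \<noteq> {}"
proof -
  obtain v y r where v: "real_valuation v" "is_center \<X> \<O> v y" "y \<in> V" "A v = ereal r" "0 < r" "0 < lam"
    and le: "\<And>m. m \<ge> 1 \<Longrightarrow> r \<le> lam / real m * real_of_ereal (val_ideal \<X> \<O> v (\<aa> m))"
    by (rule locus_valuation[OF x V], rule that)
  have y: "y \<in> U" using v(3) V(3) by blast
  define b where "b f = real_of_ereal (v f)" for f
  have b: "v f = ereal (b f)" if "f \<noteq> 0" for f
    using val_real[OF v(1) that] by (metis b_def real_of_ereal.simps(1))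
  \<comment> \<open>Dividing by r normalizes the log discrepancy to 1. Since u is real-valued, the
    infinite value at 0 is replaced by 0, which respects the bound K.\<close>
  define u where "u f = (if f = 0 then 0 else b f / r)" for f
  have ctr: "(\<forall>f\<in>\<O> U. 0 \<le> v f) \<and> point_prime \<X> \<O> U y = {f \<in> \<O> U. 0 < v f}"
    using is_center_affine[OF U v(1) y] v(2) by blast
  have "u \<in> normalized lam K V"
    unfolding normalized_def mem_Collect_eq
  proof (intro conjI allI impI)
    show "\<bar>u f\<bar> \<le> K f" for f
      using K(1)[of f] K(2)[OF _ v(1,2) y v(4), of f] v(5)
      by (cases "f = 0") (auto simp: u_def b_def pos_divide_le_eq)
    show "u (f * g) = u f + u g" if "f \<noteq> 0" "g \<noteq> 0" for f g
      using that val_mult[OF v(1), of f g] by (simp add: u_def b add_divide_distrib)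
    show "min (u f) (u g) \<le> u (f + g)" if "f \<noteq> 0" "g \<noteq> 0" "f + g \<noteq> 0" for f g
    proof -
      have "min (b f) (b g) \<le> b (f + g)"
        using that val_add[OF v(1), of f g] by (simp add: b min_def split: if_splits)
      then have "min (b f) (b g) / r \<le> b (f + g) / r" using v(5) by (simp add: divide_right_mono)
      moreover have "min (b f) (b g) / r = min (b f / r) (b g / r)"
        using v(5) by (simp add: min_def divide_le_cancel)
      ultimately show ?thesis using that by (simp add: u_def)
    qed
    show "0 \<le> u f" if "f \<in> \<O> U" "f \<noteq> 0" for f
      using ctr that b[of f] v(5) by (auto simp: u_def)
    show "u f - real p ^ e * u (\<psi> f) \<le> real p ^ e - 1"
      if e: "e \<ge> 1" "p_linear p e \<psi>" "\<psi> ` \<O> U \<subseteq> \<O> U" "f \<noteq> 0" "\<psi> f \<noteq> 0" for e \<psi> f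
    proof -
      have "log_disc_E p e f \<psi> v \<le> ereal r"
        unfolding v(4)[symmetric]
        using cartier_maps_affine[OF U y e(2) p_pos e(3)] e by (intro log_discrepancy_ge[OF v(1,2)])
      then have "(b f - real p ^ e * b (\<psi> f)) / (real p ^ e - 1) \<le> r"
        using power_p_gt_1[OF e(1)] e by (simp add: log_disc_E_def b)
      then have "b f - real p ^ e * b (\<psi> f) \<le> (real p ^ e - 1) * r"
        using power_p_gt_1[OF e(1)] by (simp add: pos_divide_le_eq mult.commute)
      then have "(b f - real p ^ e * b (\<psi> f)) / r \<le> real p ^ e - 1"
        using v(5) by (simp add: pos_divide_le_eq)
      then show ?thesis using e by (simp add: u_def diff_divide_distrib)
    qed
    show "1 \<le> lam / real m * u f"
      if m: "m \<ge> 1" "openin \<X> W" "V \<subseteq> W" "f \<in> \<aa> m W" "f \<noteq> 0" for m W f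
    proof -
      have "f \<in> stalk \<X> (\<aa> m) y" using m v(3) by (intro stalkI[of W]) auto
      then have "val_ideal \<X> \<O> v (\<aa> m) \<le> ereal (b f)"
        using val_ideal_le[OF v(1,2)] b[OF m(5)] by metis
      moreover obtain \<beta> where \<beta>: "val_ideal \<X> \<O> v (\<aa> m) = ereal \<beta>"
        using val_ideal_real[OF v(1,2) m(1)] ..
      ultimately have "\<beta> \<le> b f" by simp
      have "r \<le> lam / real m * \<beta>" using le[OF m(1)] by (simp add: \<beta>)
      also have "\<dots> \<le> lam / real m * b f"
        using \<open>\<beta> \<le> b f\<close> v(6) m(1) by (intro mult_left_mono) auto
      finally have "1 \<le> lam / real m * b f / r"
        using v(5) by (simp only: pos_le_divide_eq mult_1)
      then show ?thesis using m(5) by (simp add: u_def)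
    qed
    show "u g = 0" if g: "g \<in> \<O> U" "V \<subseteq> {z \<in> U. g \<notin> point_prime \<X> \<O> U z}" "g \<noteq> 0" for g
    proof -
      have "g \<notin> {f \<in> \<O> U. 0 < v f}" using ctr g v(3) by blast
      moreover have "0 \<le> v g" using ctr g(1) by blast
      ultimately have "v g = 0" using g(1) by auto
      then show ?thesis by (simp add: u_def b_def)
    qed
  qed
  then show ?thesis by blast
qed

section \<open>From Cartier maps on a stalk to maps preserving the chart\<close>

lemma common_denominator:
  assumes v: "real_valuation v" "is_center \<X> \<O> v y" "y \<in> U"
    and "finite M" "M \<subseteq> stalk \<X> \<O> y"
  shows "\<exists>h\<in>\<O> U. v h = 0 \<and> (\<forall>m\<in>M. h * m \<in> \<O> U)"
  using assms(4,5)
proof (induction M rule: finite_induct)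
  case empty
  show ?case using U_sections(2) val_1[OF v(1)] by auto
next
  case (insert m M)
  then obtain h where h: "h \<in> \<O> U" "v h = 0" "\<forall>m\<in>M. h * m \<in> \<O> U" by auto
  have ctr: "(\<forall>f\<in>\<O> U. 0 \<le> v f) \<and> point_prime \<X> \<O> U y = {f \<in> \<O> U. 0 < v f}"
    using is_center_affine[OF U v(1,3)] v(2) by blast
  have "m \<in> frac_at \<X> \<O> U (\<O> U) y" using insert.prems affine_open_stalk[OF U v(3)] by auto
  then obtain a b where ab: "m = a / b" "a \<in> \<O> U" "b \<in> \<O> U" "b \<notin> point_prime \<X> \<O> U y"
    by (auto simp: frac_at_def)
  have "v b = 0"
  proof -
    have "0 \<le> v b" "\<not> 0 < v b" using ctr ab by auto
    then show ?thesis by simp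
  qed
  then have "b \<noteq> 0" using val_0[OF v(1)] by auto
  have "h * b * m' \<in> \<O> U" if "m' \<in> insert m M" for m'
  proof (cases "m' = m")
    case True
    then have "h * b * m' = h * a" using \<open>b \<noteq> 0\<close> by (simp add: ab(1))
    then show ?thesis using U_sections(4)[OF h(1) ab(2)] by (simp only:)
  next
    case False
    then have "b * (h * m') \<in> \<O> U" using U_sections(4) that h(3) ab(3) by blast
    then show ?thesis by (simp add: mult_ac)
  qed
  moreover have "v (h * b) = 0" using \<open>v b = 0\<close> h(2) by (simp add: val_mult[OF v(1)])
  moreover have "h * b \<in> \<O> U" using U_sections(4) h(1) ab(3) by blast
  ultimately show ?case by blast
qed

text \<open>On \<open>\<O> U\<close>, \<psi> is determined by its values on finitely many generators
  over p^e-th powers, and these have a common denominator h that is a unit at y. As v(h) = 0,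
  multiplication by h does not change the values of \<psi>.\<close>

lemma clear_denominators:
  assumes v: "real_valuation v" "is_center \<X> \<O> v y" "y \<in> U" and \<psi>: "\<psi> \<in> cartier_maps \<X> \<O> p e y"
  obtains h where "h \<in> \<O> U" "v h = 0" "(\<lambda>f. h * \<psi> f) ` \<O> U \<subseteq> \<O> U"
proof -
  obtain n c a f where sm: "smooth_algebra \<iota> p n c a f" "\<O> U = mpoly_eval \<iota> a ` mpolys n"
    using standard_smooth_algebra[OF smooth_U base_field_hom char p_pos] .
  interpret smooth_algebra \<iota> p n c a f by fact
  obtain M where M: "finite M" "M \<subseteq> \<O> U" "\<And>S. 0 \<in> S \<Longrightarrow> (\<forall>x\<in>S. \<forall>y\<in>S. x + y \<in> S) \<Longrightarrow>
     (\<forall>r\<in>\<O> U. \<forall>m\<in>M. r ^ (p ^ e) * m \<in> S) \<Longrightarrow> \<O> U \<subseteq> S"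
    using frobenius_generators[of e] unfolding sm(2) by metis
  have lin: "p_linear p e \<psi>" and stalk: "\<psi> ` stalk \<X> \<O> y \<subseteq> stalk \<X> \<O> y"
    using \<psi> by (auto simp: cartier_maps_def)
  have "\<O> U \<subseteq> stalk \<X> \<O> y" using affine_open_openin[OF U] v(3) by (auto intro: stalkI)
  then have "\<psi> ` M \<subseteq> stalk \<X> \<O> y" using M(2) stalk by blast
  then obtain h where h: "h \<in> \<O> U" "v h = 0" "\<forall>m\<in>\<psi> ` M. h * m \<in> \<O> U"
    using common_denominator[OF v finite_imageI[OF M(1)]] by blast
  have "\<O> U \<subseteq> {r. h * \<psi> r \<in> \<O> U}"
  proof (rule M(3))
    show "0 \<in> {r. h * \<psi> r \<in> \<O> U}" using U_sections(1) by (simp add: p_linear_0[OF lin])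
    show "\<forall>x\<in>{r. h * \<psi> r \<in> \<O> U}. \<forall>y\<in>{r. h * \<psi> r \<in> \<O> U}. x + y \<in> {r. h * \<psi> r \<in> \<O> U}"
      using U_sections(3) by (simp add: p_linear_add[OF lin] distrib_left)
    show "\<forall>r\<in>\<O> U. \<forall>m\<in>M. r ^ (p ^ e) * m \<in> {r. h * \<psi> r \<in> \<O> U}"
    proof (intro ballI CollectI)
      fix r m assume "r \<in> \<O> U" "m \<in> M"
      then have "r * (h * \<psi> m) \<in> \<O> U" using h(3) by (intro U_sections(4)[of r]) auto
      then show "h * \<psi> (r ^ (p ^ e) * m) \<in> \<O> U"
        unfolding p_linear_mult[OF lin] by (simp only: mult_ac)
    qed
  qed
  then show thesis using that[OF h(1,2)] by blast
qed

text \<open>A bound for each single Cartier map passes to the pointwise limit, while the supremum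
  may drop; hence \<open>A v \<le> 1\<close> and not equality.\<close>

lemma limit_valuation:
  assumes x: "x \<in> ideal_locus \<X> \<O> (multiplier_ideal \<X> \<O> p \<aa> lam)" "x \<in> U"
  obtains v y where "real_valuation v" "is_center \<X> \<O> v y" "y \<in> U"
    "point_prime \<X> \<O> U y \<subseteq> point_prime \<X> \<O> U x" "A v \<le> 1" "0 < lam"
    "\<And>m. m \<ge> 1 \<Longrightarrow> ereal (real m / lam) \<le> val_ideal \<X> \<O> v (\<aa> m)"
proof -
  note U' = affine_open_openin[OF U]
  obtain K :: "'l \<Rightarrow> real" where K: "\<And>f. 0 \<le> K f"
    "\<And>f v y r. f \<noteq> 0 \<Longrightarrow> real_valuation v \<Longrightarrow> is_center \<X> \<O> v y \<Longrightarrow> y \<in> U \<Longrightarrow> A v = ereal r \<Longrightarrow>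
       \<bar>real_of_ereal (v f)\<bar> \<le> K f * r"
    by (rule value_bound, rule that)
  have lam: "0 < lam"
    by (rule locus_valuation[OF x(1) U' x(2) order_refl])
  define I where "I = {V. openin \<X> V \<and> x \<in> V \<and> V \<subseteq> U}"
  have UI: "U \<in> I" using U' x(2) by (simp add: I_def)
  obtain u where u: "\<And>V. V \<in> I \<Longrightarrow> u \<in> normalized lam K V"
  proof (rule directed_compact_Inter[OF compact_bounded_functions[of K], of I "normalized lam K"])
    show "closed (normalized lam K V)" for V by (rule closed_normalized)
    show "normalized lam K V \<noteq> {}" if "V \<in> I" for V
    proof (rule normalized_nonempty[OF _ _ x(1)])
      show "0 \<le> K f" for f by (rule K(1))
      show "\<bar>real_of_ereal (v f)\<bar> \<le> K f * r"
        if "f \<noteq> 0" "real_valuation v" "is_center \<X> \<O> v y" "y \<in> U" "A v = ereal r" for f v y r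
        using that by (rule K(2))
    qed (use that in \<open>auto simp: I_def\<close>)
    show "normalized lam K V \<subseteq> {u. \<forall>f. \<bar>u f\<bar> \<le> K f}" for V
      by (auto simp: normalized_def)
    show "\<exists>W\<in>I. normalized lam K W \<subseteq> normalized lam K V \<inter> normalized lam K V'"
      if "V \<in> I" "V' \<in> I" for V V'
      using that normalized_mono[of "V \<inter> V'" V] normalized_mono[of "V \<inter> V'" V']
      by (intro bexI[of _ "V \<inter> V'"]) (auto simp: I_def)
    show "I \<noteq> {}" using UI by blast
  qed (rule that)
  note uU = normalizedD[OF u[OF UI]]
  define v where "v f = (if f = 0 then \<infinity> else ereal (u f))" for f
  have v: "real_valuation v"
    unfolding real_valuation_def
  proof (intro conjI allI)
    show "min (v f) (v g) \<le> v (f + g)" for f g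
      using uU(3)[of f g] by (auto simp: v_def min_def split: if_splits)
  qed (auto simp: v_def uU(2))
  have nonneg: "0 \<le> v f" if "f \<in> \<O> U" for f
    using uU(4)[OF that] by (simp add: v_def)
  obtain y where y: "y \<in> U" "is_center \<X> \<O> v y" and Py: "point_prime \<X> \<O> U y = {f \<in> \<O> U. 0 < v f}"
    by (rule ex_center[OF U v nonneg], assumption, rule that)
  have le: "point_prime \<X> \<O> U y \<subseteq> point_prime \<X> \<O> U x"
  proof
    fix g assume g: "g \<in> point_prime \<X> \<O> U y"
    then have g': "g \<in> \<O> U" "0 < v g" using Py by auto
    show "g \<in> point_prime \<X> \<O> U x"
    proof (rule ccontr)
      assume gx: "g \<notin> point_prime \<X> \<O> U x"
      \<comment> \<open>If g did not vanish at x, it would be invertible on this neighbourhood,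
        where \<open>normalized\<close> requires the value 0.\<close>
      let ?V = "{z \<in> U. g \<notin> point_prime \<X> \<O> U z}"
      have "?V \<in> I" using basic_open[OF U g'(1)] gx x(2) by (auto simp: I_def)
      moreover have "g \<noteq> 0"
      proof
        assume "g = 0"
        then show False
          using gx U_sections(1) stalkI[OF U' x(2), of 0 \<O>]
          by (auto simp: point_prime_def stalk_nonunits_def)
      qed
      ultimately have "u g = 0" using normalizedD(7)[OF u g'(1) order_refl] by blast
      then show False using g'(2) \<open>g \<noteq> 0\<close> by (simp add: v_def)
    qed
  qed
  have "A v \<le> 1"
  proof (rule log_discrepancy_le[OF v y(2)])
    fix e \<psi> f assume e: "e \<ge> 1" and \<psi>: "\<psi> \<in> cartier_maps \<X> \<O> p e y" and f: "f \<noteq> (0::'l)"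
    have lin: "p_linear p e \<psi>" using \<psi> by (simp add: cartier_maps_def)
    show "log_disc_E p e f \<psi> v \<le> 1"
    proof (cases "\<psi> f = 0")
      case True
      then show ?thesis
        using power_p_gt_1[OF e] p_pos f by (simp add: log_disc_E_def v_def)
    next
      case False
      obtain h where h: "h \<in> \<O> U" "v h = 0" "(\<lambda>f. h * \<psi> f) ` \<O> U \<subseteq> \<O> U"
        using clear_denominators[OF v y(2,1) \<psi>] .
      have h0: "h \<noteq> 0" "u h = 0" using h(2) by (auto simp: v_def split: if_splits)
      \<comment> \<open>The normalized conditions apply to the multiple by h, which preserves
        \<open>\<O> U\<close>, although \<psi> itself may not.\<close>
      have "u f - real p ^ e * u (h * \<psi> f) \<le> real p ^ e - 1"
        using False h0 by (intro uU(5)[OF e p_linear_scale[OF lin] h(3) f]) simp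
      then have "u f - real p ^ e * u (\<psi> f) \<le> real p ^ e - 1"
        using uU(2)[OF h0(1) False] h0(2) by simp
      then show ?thesis
        using power_p_gt_1[OF e] False f by (simp add: log_disc_E_def v_def one_ereal_def)
    qed
  qed
  moreover have "ereal (real m / lam) \<le> val_ideal \<X> \<O> v (\<aa> m)" if m: "m \<ge> 1" for m
    unfolding val_ideal_eq[OF v y(2)]
  proof (rule INF_greatest)
    interpret qcoh_ideal \<X> \<O> "\<aa> m" using m by (rule qcoh)
    have "x \<in> topspace \<X>" using x(2) affine_open_subset[OF U] by blast
    then obtain W where W: "affine_open \<X> \<O> W" "x \<in> W"
      "\<And>z. z \<in> W \<Longrightarrow> stalk \<X> (\<aa> m) z = frac_at \<X> \<O> W (\<aa> m W) z"
      using quasi_coherent by blast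
    \<comment> \<open>A section of the ideal near y may not extend to x. As y generizes x, it lies
      in the quasi-coherent chart W around x, so f has a numerator defined near x.\<close>
    have yW: "y \<in> W"
      using generization_in_open[OF U y(1) x(2) le affine_open_openin[OF W(1)] W(2)] .
    fix f assume "f \<in> stalk \<X> (\<aa> m) y"
    then obtain a b where ab: "f = a / b" "a \<in> \<aa> m W" "b \<in> \<O> W" "b \<notin> point_prime \<X> \<O> W y"
      unfolding W(3)[OF yW] by (auto simp: frac_at_def)
    have "v b = 0"
    proof -
      have "0 \<le> v b" "\<not> 0 < v b" using is_center_affine[OF W(1) v yW] y(2) ab by auto
      then show ?thesis by simp
    qed
    then have "b \<noteq> 0" using val_0[OF v] by auto
    then have vf: "v f = v a" using val_div[OF v] \<open>v b = 0\<close> by (simp add: ab(1))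
    show "ereal (real m / lam) \<le> v f"
    proof (cases "a = 0")
      case True
      then show ?thesis unfolding vf by (simp add: v_def)
    next
      case False
      have "U \<inter> W \<in> I" using U' affine_open_openin[OF W(1)] x(2) W(2) by (auto simp: I_def)
      then have "1 \<le> lam / real m * u a"
        using False by (intro normalizedD(6)[OF u m affine_open_openin[OF W(1)] _ ab(2)]) auto
      then have "real m / lam \<le> u a"
        using lam m by (simp add: field_simps)
      then show ?thesis unfolding vf using False by (simp add: v_def)
    qed
  qed
  ultimately show thesis using that[OF v y(2,1) le _ lam] by blast
qed

end

section \<open>From the limit valuation to the generic point of the component\<close>

theorem theoremC:
  fixes \<X> :: "'x topology" and \<O> :: "'x set \<Rightarrow> 'l::field set"
    and \<iota> :: "'k::alg_closed_field \<Rightarrow> 'l"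
    and \<aa> :: "nat \<Rightarrow> 'x set \<Rightarrow> 'l set"
    and p :: nat and lam :: real and C :: "'x set" and x :: 'x
  assumes "smooth_variety \<X> \<O> \<iota>"
    and "CHAR('k) = p" and "p > 0"
    and "graded_ideal_sequence \<X> \<O> \<aa>"
    and "lct \<X> \<O> p \<aa> = ereal lam"
    and "irreducible_component_of \<X> (ideal_locus \<X> \<O> (multiplier_ideal \<X> \<O> p \<aa> lam)) C"
    and "generic_point_of \<X> C x"
  shows "\<exists>v \<in> Val_star \<X> \<O> (topspace \<X>).
           is_center \<X> \<O> v x \<and> ereal lam = lct_quotient \<X> \<O> p \<aa> v"
proof -
  interpret smooth_variety \<X> \<O> \<iota> by fact
  interpret graded_sequence \<X> \<O> \<iota> \<aa> by unfold_locales fact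
  let ?Z = "ideal_locus \<X> \<O> (multiplier_ideal \<X> \<O> p \<aa> lam)"
  have C: "irreducible_in \<X> C" "C \<subseteq> ?Z" "\<And>D. irreducible_in \<X> D \<Longrightarrow> C \<subseteq> D \<Longrightarrow> D \<subseteq> ?Z \<Longrightarrow> D = C"
    using assms(6) by (auto simp: irreducible_component_of_def)
  have xC: "x \<in> C" "\<X> closure_of {x} = C"
    using assms(7) by (auto simp: generic_point_of_def)
  have xZ: "x \<in> ?Z" and xX: "x \<in> topspace \<X>" using xC C(1,2) by (auto simp: irreducible_in_def)
  obtain U where chart: "affine_open \<X> \<O> U" "x \<in> U" "standard_smooth \<iota> (\<O> U)"
    using smooth[OF xX] by blast
  interpret graded_chart \<X> \<O> \<iota> \<aa> p U by unfold_locales fact+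
  obtain v y where v: "real_valuation v" "is_center \<X> \<O> v y" "y \<in> U"
    "point_prime \<X> \<O> U y \<subseteq> point_prime \<X> \<O> U x" "A v \<le> 1" and lam: "0 < lam"
    and ideal: "\<And>m. m \<ge> 1 \<Longrightarrow> ereal (real m / lam) \<le> val_ideal \<X> \<O> v (\<aa> m)"
    by (rule limit_valuation[OF xZ chart(2)], rule that)
  have yX: "y \<in> topspace \<X>" using v(3) affine_open_subset[OF chart(1)] by blast
  define \<beta> where "\<beta> m = real_of_ereal (val_ideal \<X> \<O> v (\<aa> m))" for m
  have \<beta>: "val_ideal \<X> \<O> v (\<aa> m) = ereal (\<beta> m)" if "m \<ge> 1" for m
    unfolding \<beta>_def using v(1,2) that by (rule val_ideal_real)
  \<comment> \<open>The value of the first ideal is at least 1 / \<open>lam\<close> > 0, whereas the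
    trivial valuation is 0 on its nonzero elements.\<close>
  have nontriv: "v \<noteq> trivial_valuation"
  proof
    assume triv: "v = trivial_valuation"
    obtain f where f: "f \<in> stalk \<X> (\<aa> 1) y" "f \<noteq> 0" using stalk_nonzero[of 1 y] yX by auto
    have "ereal (1 / lam) \<le> v f"
      using ideal[of 1] val_ideal_le[OF v(1,2) f(1)] by (simp add: order_trans)
    then show False using f(2) lam by (simp add: triv trivial_valuation_def zero_ereal_def)
  qed
  obtain \<alpha> where \<alpha>: "A v = ereal \<alpha>" "0 < \<alpha>" "\<alpha> \<le> 1"
    using log_discrepancy_pos[OF v(1-3) nontriv] v(5) by (cases "A v") auto
  have "ereal (1 / lam) \<le> val_graded \<X> \<O> v \<aa>"
    unfolding val_graded_def
  proof (rule INF_greatest)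
    fix m :: nat assume "m \<in> {1..}"
    then have m: "m \<ge> 1" by simp
    have "real m / lam \<le> \<beta> m" using ideal[OF m] by (simp add: \<beta>[OF m])
    then have "1 / lam \<le> \<beta> m / real m" using m lam by (simp add: field_simps)
    then show "ereal (1 / lam) \<le> val_ideal \<X> \<O> v (\<aa> m) / ereal (real m)"
      using m by (simp add: \<beta>[OF m])
  qed
  moreover have graded_le: "val_graded \<X> \<O> v \<aa> \<le> ereal (\<beta> m / real m)" if "m \<ge> 1" for m
  proof -
    have "val_graded \<X> \<O> v \<aa> \<le> val_ideal \<X> \<O> v (\<aa> m) / ereal (real m)"
      unfolding val_graded_def by (rule INF_lower) (use that in simp)
    then show ?thesis using that by (simp add: \<beta>)
  qed
  ultimately obtain \<gamma> where \<gamma>: "val_graded \<X> \<O> v \<aa> = ereal \<gamma>" "1 / lam \<le> \<gamma>"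
    using graded_le[of 1] by (cases "val_graded \<X> \<O> v \<aa>") auto
  have \<gamma>_pos: "0 < \<gamma>" using \<gamma>(2) lam by (smt (verit) divide_pos_pos)
  have quot: "lct_quotient \<X> \<O> p \<aa> v = ereal (\<alpha> / \<gamma>)"
    using \<gamma>_pos by (simp add: lct_quotient_def \<alpha> \<gamma>)
  have star: "v \<in> Val_star \<X> \<O> (topspace \<X>)"
    using v(1,2) yX nontriv by (auto simp: Val_star_def Val_def)
  have "ereal lam \<le> lct_quotient \<X> \<O> p \<aa> v"
    unfolding assms(5)[symmetric] lct_def using star by (rule INF_lower)
  moreover have "\<alpha> / \<gamma> \<le> lam"
  proof -
    have "1 \<le> \<gamma> * lam" using \<gamma>(2) lam by (simp add: pos_divide_le_eq)
    then show ?thesis using \<alpha>(3) \<gamma>_pos by (simp add: pos_divide_le_eq mult.commute)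
  qed
  ultimately have lam_eq: "lam = \<alpha> / \<gamma>" by (simp add: quot)
  let ?D = "\<X> closure_of {y}"
  have D_locus: "?D \<subseteq> ?Z"
  proof
    fix z assume z: "z \<in> ?D"
    show "z \<in> ?Z"
    proof (rule computing_valuation_in_locus[OF v(1) nontriv v(2,3)])
      fix m :: nat assume m: "m \<ge> 1"
      \<comment> \<open>The asymptotic value \<gamma> is an infimum over m, so the equality of
        \<alpha> with \<open>lam * \<gamma>\<close> yields the required bound for each m.\<close>
      have "\<gamma> \<le> \<beta> m / real m" using graded_le[OF m] by (simp add: \<gamma>)
      then have "lam * \<gamma> \<le> lam * (\<beta> m / real m)"
        by (rule mult_left_mono) (use lam in simp)
      then have "\<alpha> \<le> lam / real m * \<beta> m" using lam_eq \<gamma>_pos by simp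
      then show "A v \<le> ereal (lam / real m) * val_ideal \<X> \<O> v (\<aa> m)"
        by (simp add: \<alpha> \<beta>[OF m])
    qed (use z in \<open>auto simp: in_closure_of\<close>)
  qed
  have "irreducible_in \<X> ?D"
    unfolding irreducible_in_def
  proof (intro conjI allI impI)
    show "?D \<subseteq> topspace \<X>" by (rule closure_of_subset_topspace)
    have "y \<in> ?D" using yX closure_of_subset[of "{y}" \<X>] by blast
    then show "?D \<noteq> {}" by blast
    fix S T assume ST: "closedin \<X> S \<and> closedin \<X> T \<and> ?D \<subseteq> S \<union> T"
    then have "y \<in> S \<or> y \<in> T" using \<open>y \<in> ?D\<close> by blast
    then show "?D \<subseteq> S \<or> ?D \<subseteq> T" using ST closure_of_minimal[of "{y}"] by blast
  qed
  have gen: "y \<in> W" if "openin \<X> W" "x \<in> W" for W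
    using generization_in_open[OF chart(1) v(3) chart(2) v(4) that] .
  then have "x \<in> ?D" using xX by (auto simp: in_closure_of)
  then have "C \<subseteq> ?D" unfolding xC(2)[symmetric] by (intro closure_of_minimal) auto
  with \<open>irreducible_in \<X> ?D\<close> have "?D = C" using D_locus by (rule C(3))
  moreover have "y \<in> ?D" using yX closure_of_subset[of "{y}" \<X>] by blast
  ultimately have "y \<in> \<X> closure_of {x}" using xC(2) by simp
  \<comment> \<open>Each point lies in the closure of the other, so they belong to the same open
    sets.\<close>
  then have "x = y"
    using gen by (intro same_opens_imp_eq[OF chart(1,2) v(3)]) (auto simp: in_closure_of)
  then show ?thesis using star v(2) quot lam_eq by auto
qed

end
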